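(* Let $S_{g,n}$, $\mathcal{T}=(V,E,F)$ be as in the context, and let $\hat k\in\mathbb{R}_{>0}^{|V^{\partial}|}$ and $\hat T\in\mathfrak{T}$. For any initial geodesic curvature $k(0)\in\mathbb{R}_{>0}^{|V^{\circ}|}$, the solution $k(t)$ to the combinatorial Calabi flow $$\frac{dk}{dt}=-KM'(T-\hat T),\qquad k=k(t)\in\mathbb{R}_{>0}^{|V^{\circ}|},$$ converges as $t\to+\infty$ to the generalized circle packing on $S_{g,n}$ that realizes $(\hat k,\hat T)$; that is, $k(t)$ converges to the vector of geodesic curvatures on $V^{\circ}$ of that packing.
   Context: **Generalized circles.** In the hyperbolic plane $\mathbb{H}^2$ (curvature $-1$) a generalized circle is a circle, a horocycle or a hypercycle (a curve at constant distance from a geodesic, its axis). Its shape is determined by its constant geodesic curvature $k>0$: if $k>1$ it is a circle of radius $\operatorname{arccoth}k$; if $k=1$ a horocycle; if $0<k<1$ a hypercycle at distance $\operatorname{arctanh}k$ from its axis. The center is the usual center, the limiting ideal point, or the axis, respectively. Externally tangent means tangent with the convex sides (disk, horodisk, side containing the axis) having disjoint interiors. **Packing of one triangle.** For a triangle $f$ with vertices $v_1,v_2,v_3$ and $(k_1,k_2,k_3)\in\mathbb{R}_{>0}^3$, it is known that there is a configuration $P(f)$, determined by $(k_1,k_2,k_3)$ up to isometry, of three mutually externally tangent generalized circles $C_1,C_2,C_3$ in $\mathbb{H}^2$ with geodesic curvatures $k_1,k_2,k_3$, together with a hyperbolic circle $C_f$ (the dual circle) perpendicular to each $C_i$ and passing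 through all the tangent points. Let $l_i^f$ be the length of the sub-arc of $C_i$ contained in (inside) $C_f$, and $T_i^f=k_i\,l_i^f$ its total geodesic curvature. Joining the centers by shortest geodesics gives the (generalized) hyperbolic triangle $\hat f$. **Surface and triangulation.** $S_{g,n}$ is obtained by removing $n\ge 1$ topological open disks from an oriented compact surface of genus $g\ge 0$. $\mathcal{T}=(V,E,F)$ is a triangulation; $V_f$ is the set of three vertices of $f\in F$. $V^{\partial}$ and $V^{\circ}$ are the sets of boundary and interior vertices, each enumerated $1,2,\dots$. It is assumed that there are at least two boundary vertices and that each face has at most two boundary vertices. **Packing on the surface.** Curvatures in $\mathbb{R}_{>0}^{|V|}$ determine a packing $P(f)$ for each face; gluing the triangles $\hat f$ along edges gives a surface with hyperbolic conical metric, and the resulting pattern is a generalized circle packing $P$ on $S_{g,n}$. The total geodesic curvature at $i\in V^{\circ}$ is $T_i=\sum_{f\in F,\,i\in V_f}T_i^f$. $P$ realizes $(\hat k,\hat T)$ if its geodesic curvature equals $\hat k$ on $V^{\partial}$ and its total geodesic curvature equals $\hat T$ on $V^{\circ}$. For $\hat T\in\mathfrak{T}$ such a packing exists and is unique. **Flow data.** Fix the curvatures $\hat k$ on $V^{\partial}$. For $k\in\mathbb{R}_{>0}^{|V^{\circ}|}$ on $V^{\circ}$, $T=(T_1,\dots,T_{|V^{\circ}|})$ is the vector of total geodesic curvatures, a function of $k$. With $s_i=\ln k_i$, $M=\big(\partial T_i/\partial s_j\big)_{1\le i,j\le|V^{\circ}|}$, $M'$ is its transpose, and $K=\operatorname{diag}(k_1,\dots,k_{|V^{\circ}|})$.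 For $I\subset V^{\circ}$, $F_I=\{f\in F\mid \exists v\in I,\ v\in V_f\}$, and $\mathfrak{T}=\{(T_1,\ldots,T_{|V^{\circ}|})\in\mathbb{R}^{|V^{\circ}|}_{>0}\mid \sum_{v\in I}T_v<\pi|F_I|\ \forall\,\emptyset\ne I\subset V^{\circ}\}$. *)

theory Defs
  imports "HOL-Analysis.Analysis"
begin

section \<open>The hyperbolic plane (hyperboloid model)\<close>

type_synonym minkowski = "complex \<times> real"

definition mink :: "minkowski \<Rightarrow> minkowski \<Rightarrow> real" where
  "mink x y = fst x \<bullet> fst y - snd x * snd y"

definition hyp_plane :: "minkowski set" where
  "hyp_plane = {x. mink x x = -1 \<and> 0 < snd x}"

definition hdist :: "minkowski \<Rightarrow> minkowski \<Rightarrow> real" where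
  "hdist x y = arcosh (- mink x y)"

definition hdist_to :: "minkowski \<Rightarrow> minkowski set \<Rightarrow> real" where
  "hdist_to x A = (INF y\<in>A. hdist x y)"

text \<open>The geodesics are the sets \<open>geodesic n\<close> with \<open>mink n n = 1\<close>; \<open>n\<close> and \<open>- n\<close> give the same one.\<close>

definition geodesic :: "minkowski \<Rightarrow> minkowski set" where
  "geodesic n = {x \<in> hyp_plane. mink x n = 0}"

text \<open>
  \<open>has_hlength A l\<close>: the arc \<open>A\<close> has hyperbolic length \<open>l\<close>.  The Riemannian metric of
  \<open>hyp_plane\<close> is the restriction of \<open>mink\<close>, which is positive definite on tangent vectors.
\<close>

definition has_hlength :: "minkowski set \<Rightarrow> real \<Rightarrow> bool" where
  "has_hlength A l \<longleftrightarrow>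
     (\<exists>\<gamma>. \<gamma> C1_differentiable_on {0..1} \<and> inj_on \<gamma> {0..1} \<and> \<gamma> ` {0..1} = A \<and>
        l = integral {0..1}
          (\<lambda>s. sqrt (mink (vector_derivative \<gamma> (at s)) (vector_derivative \<gamma> (at s)))))"

definition hlength :: "minkowski set \<Rightarrow> real" where
  "hlength A = (THE l. has_hlength A l)"

definition tangent_vectors :: "minkowski set \<Rightarrow> minkowski \<Rightarrow> minkowski set" where
  "tangent_vectors A p =
     {v. \<exists>\<gamma> :: real \<Rightarrow> minkowski. (\<forall>s. \<gamma> s \<in> A) \<and> \<gamma> 0 = p \<and> (\<gamma> has_vector_derivative v) (at 0)}"

definition tangent_at :: "minkowski \<Rightarrow> minkowski set \<Rightarrow> minkowski set \<Rightarrow> bool" where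
  "tangent_at p A B \<longleftrightarrow> p \<in> A \<and> p \<in> B \<and> tangent_vectors A p = tangent_vectors B p"

definition perpendicular :: "minkowski set \<Rightarrow> minkowski set \<Rightarrow> bool" where
  "perpendicular A B \<longleftrightarrow>
     (\<forall>p \<in> A \<inter> B. \<forall>v \<in> tangent_vectors A p. \<forall>w \<in> tangent_vectors B p. mink v w = 0)"


section \<open>Generalized circles\<close>

text \<open>
  \<open>Circle p r\<close> has center \<open>p\<close> and radius \<open>r\<close>.

  \<open>Horocycle u\<close> is given by a future-pointing null vector \<open>u\<close>: the ray of \<open>u\<close> is its ideal
  point, and the scale of \<open>u\<close> selects the horocycle, since \<open>x \<mapsto> ln (- mink x u)\<close> is a
  Busemann function of that ideal point.

  \<open>Hypercycle n d\<close> lies at distance \<open>d\<close> from its axis \<open>geodesic n\<close>, on the side of the axis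
  on which \<open>mink x n < 0\<close>.
\<close>

datatype gcircle =
    Circle minkowski real
  | Horocycle minkowski
  | Hypercycle minkowski real

fun gcircle_valid :: "gcircle \<Rightarrow> bool" where
  "gcircle_valid (Circle p r) \<longleftrightarrow> p \<in> hyp_plane \<and> 0 < r"
| "gcircle_valid (Horocycle u) \<longleftrightarrow> mink u u = 0 \<and> 0 < snd u"
| "gcircle_valid (Hypercycle n d) \<longleftrightarrow> mink n n = 1 \<and> 0 < d"

fun curve :: "gcircle \<Rightarrow> minkowski set" where
  "curve (Circle p r) = {x \<in> hyp_plane. hdist x p = r}"
| "curve (Horocycle u) = {x \<in> hyp_plane. mink x u = -1}"
| "curve (Hypercycle n d) = {x \<in> hyp_plane. mink x n < 0 \<and> hdist_to x (geodesic n) = d}"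

text \<open>Interior of the convex side: open disk, open horodisk, open side containing the axis.\<close>

fun convex_side :: "gcircle \<Rightarrow> minkowski set" where
  "convex_side (Circle p r) = {x \<in> hyp_plane. hdist x p < r}"
| "convex_side (Horocycle u) = {x \<in> hyp_plane. -1 < mink x u}"
| "convex_side (Hypercycle n d) =
     {x \<in> hyp_plane. 0 \<le> mink x n \<or> hdist_to x (geodesic n) < d}"

fun geodesic_curvature :: "gcircle \<Rightarrow> real" where
  "geodesic_curvature (Circle p r) = 1 / tanh r"
| "geodesic_curvature (Horocycle u) = 1"
| "geodesic_curvature (Hypercycle n d) = tanh d"

definition externally_tangent :: "gcircle \<Rightarrow> gcircle \<Rightarrow> bool" where
  "externally_tangent c c' \<longleftrightarrow>
     (\<exists>p. tangent_at p (curve c) (curve c')) \<and> convex_side c \<inter> convex_side c' = {}"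

text \<open>
  \<open>triangle_packing W k C D\<close>: the circles \<open>C i\<close> (\<open>i \<in> W\<close>) and the dual circle \<open>D\<close> form a
  packing of a triangle with vertex set \<open>W\<close> and geodesic curvatures \<open>k i\<close>.
\<close>

definition triangle_packing ::
    "'v set \<Rightarrow> ('v \<Rightarrow> real) \<Rightarrow> ('v \<Rightarrow> gcircle) \<Rightarrow> gcircle \<Rightarrow> bool" where
  "triangle_packing W k C D \<longleftrightarrow>
     (\<forall>i\<in>W. gcircle_valid (C i) \<and> geodesic_curvature (C i) = k i) \<and>
     (\<forall>i\<in>W. \<forall>j\<in>W. i \<noteq> j \<longrightarrow> externally_tangent (C i) (C j)) \<and>
     gcircle_valid D \<and> (\<exists>p r. D = Circle p r) \<and>
     (\<forall>i\<in>W. perpendicular (curve D) (curve (C i))) \<and>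
     (\<forall>i\<in>W. \<forall>j\<in>W. i \<noteq> j \<longrightarrow>
        (\<forall>p. tangent_at p (curve (C i)) (curve (C j)) \<longrightarrow> p \<in> curve D))"

definition sub_arc :: "gcircle \<Rightarrow> gcircle \<Rightarrow> minkowski set" where
  "sub_arc c D = curve c \<inter> (convex_side D \<union> curve D)"


section \<open>Triangulated surfaces with boundary\<close>

text \<open>
  A triangulation is given by its incidence data.  Every triangle has three different vertices
  and three different edges, but different edges may have the same end points and different
  triangles the same vertices, so that simplicial complexes are a special case.
\<close>

record ('v, 'e, 'f) triangulation =
  verts :: "'v set"
  edges :: "'e set"
  faces :: "'f set"
  ends :: "'e \<Rightarrow> 'v set"
  sides :: "'f \<Rightarrow> 'e set"

definition face_verts :: "('v, 'e, 'f) triangulation \<Rightarrow> 'f \<Rightarrow> 'v set" where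
  "face_verts S f = (\<Union>e \<in> sides S f. ends S e)"

definition faces_at :: "('v, 'e, 'f) triangulation \<Rightarrow> 'v \<Rightarrow> 'f set" where
  "faces_at S v = {f \<in> faces S. v \<in> face_verts S f}"

definition boundary_edges :: "('v, 'e, 'f) triangulation \<Rightarrow> 'e set" where
  "boundary_edges S = {e \<in> edges S. card {f \<in> faces S. e \<in> sides S f} = 1}"

definition boundary_verts :: "('v, 'e, 'f) triangulation \<Rightarrow> 'v set" where
  "boundary_verts S = (\<Union>e \<in> boundary_edges S. ends S e)"

definition interior_verts :: "('v, 'e, 'f) triangulation \<Rightarrow> 'v set" where
  "interior_verts S = verts S - boundary_verts S"

text \<open>The vertices reachable from \<open>v\<close> along edges from \<open>A\<close>.\<close>

definition component :: "('v, 'e, 'f) triangulation \<Rightarrow> 'e set \<Rightarrow> 'v \<Rightarrow> 'v set" where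
  "component S A v = {w. (v, w) \<in> {(x, y). \<exists>e\<in>A. ends S e = {x, y}}\<^sup>*}"

text \<open>
  Every edge lies in one or two triangles, and the triangles at a vertex are connected through
  edges at this vertex; hence its link is a circle or an arc.
\<close>

definition closed_or_bordered_surface :: "('v, 'e, 'f) triangulation \<Rightarrow> bool" where
  "closed_or_bordered_surface S \<longleftrightarrow>
     finite (verts S) \<and> finite (edges S) \<and> finite (faces S) \<and> verts S \<noteq> {} \<and>
     (\<forall>e \<in> edges S. ends S e \<subseteq> verts S \<and> card (ends S e) = 2) \<and>
     (\<forall>f \<in> faces S. sides S f \<subseteq> edges S \<and> card (sides S f) = 3 \<and>
        inj_on (ends S) (sides S f) \<and> card (face_verts S f) = 3) \<and>
     (\<forall>e \<in> edges S. card {f \<in> faces S. e \<in> sides S f} \<in> {1, 2}) \<and>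
     (\<forall>v \<in> verts S. faces_at S v \<noteq> {} \<and>
        (\<forall>f \<in> faces_at S v. \<forall>f' \<in> faces_at S v.
           (f, f') \<in> {(h, h'). h \<in> faces_at S v \<and> h' \<in> faces_at S v \<and>
                        (\<exists>e \<in> sides S h \<inter> sides S h'. v \<in> ends S e)}\<^sup>*))"

text \<open>
  An orientation assigns to each triangle a cyclic order of its vertices, such that adjacent
  triangles induce opposite directions on their common edges.
\<close>

definition orientable :: "('v, 'e, 'f) triangulation \<Rightarrow> bool" where
  "orientable S \<longleftrightarrow>
     (\<exists>ori :: 'f \<Rightarrow> ('v \<times> 'v) set.
        (\<forall>f \<in> faces S. \<exists>a b c. face_verts S f = {a, b, c} \<and> ori f = {(a, b), (b, c), (c, a)}) \<and>
        (\<forall>f \<in> faces S. \<forall>f' \<in> faces S. \<forall>e \<in> sides S f \<inter> sides S f'. \<forall>x y.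
           f \<noteq> f' \<and> ends S e = {x, y} \<and> (x, y) \<in> ori f \<longrightarrow> (y, x) \<in> ori f'))"

text \<open>
  By the classification of surfaces, these conditions say that the space triangulated by \<open>S\<close>
  is the oriented compact surface of genus \<open>g\<close> with \<open>n\<close> open disks removed.
\<close>

definition triangulates_surface :: "('v, 'e, 'f) triangulation \<Rightarrow> nat \<Rightarrow> nat \<Rightarrow> bool" where
  "triangulates_surface S g n \<longleftrightarrow>
     closed_or_bordered_surface S \<and>
     (\<forall>v \<in> verts S. component S (edges S) v = verts S) \<and>
     orientable S \<and>
     card (component S (boundary_edges S) ` boundary_verts S) = n \<and>
     int (card (verts S)) - int (card (edges S)) + int (card (faces S)) = 2 - 2 * int g - int n"

definition faces_meeting :: "('v, 'e, 'f) triangulation \<Rightarrow> 'v set \<Rightarrow> 'f set" where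
  "faces_meeting S I = {f \<in> faces S. \<exists>v \<in> I. v \<in> face_verts S f}"

text \<open>Vectors indexed by a set of vertices are functions, of which only the values on that set matter.\<close>

definition admissible :: "('v, 'e, 'f) triangulation \<Rightarrow> ('v \<Rightarrow> real) set" where
  "admissible S =
     {T. (\<forall>v \<in> interior_verts S. 0 < T v) \<and>
         (\<forall>I. I \<noteq> {} \<and> I \<subseteq> interior_verts S \<longrightarrow>
            (\<Sum>v\<in>I. T v) < pi * real (card (faces_meeting S I)))}"


section \<open>Packings on a triangulated surface\<close>

text \<open>
  A packing is given by the packings of its triangles, whose circles at a vertex \<open>v\<close> all have
  the same geodesic curvature \<open>\<kappa> v\<close>.  No further condition is needed to glue the triangles.
\<close>

record ('v, 'f) packing =
  circle_at :: "'f \<Rightarrow> 'v \<Rightarrow> gcircle"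
  dual_circle :: "'f \<Rightarrow> gcircle"

definition is_packing ::
    "('v, 'e, 'f) triangulation \<Rightarrow> ('v \<Rightarrow> real) \<Rightarrow> ('v, 'f) packing \<Rightarrow> bool" where
  "is_packing S \<kappa> P \<longleftrightarrow>
     (\<forall>f \<in> faces S. triangle_packing (face_verts S f) \<kappa> (circle_at P f) (dual_circle P f))"

definition total_curvature ::
    "('v, 'e, 'f) triangulation \<Rightarrow> ('v \<Rightarrow> real) \<Rightarrow> ('v, 'f) packing \<Rightarrow> 'v \<Rightarrow> real" where
  "total_curvature S \<kappa> P i =
     (\<Sum>f \<in> faces_at S i. \<kappa> i * hlength (sub_arc (circle_at P f i) (dual_circle P f)))"

definition realizes ::
    "('v, 'e, 'f) triangulation \<Rightarrow> ('v \<Rightarrow> real) \<Rightarrow> ('v \<Rightarrow> real) \<Rightarrow>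
     ('v \<Rightarrow> real) \<Rightarrow> ('v, 'f) packing \<Rightarrow> bool" where
  "realizes S khat That \<kappa> P \<longleftrightarrow>
     is_packing S \<kappa> P \<and>
     (\<forall>i \<in> boundary_verts S. \<kappa> i = khat i) \<and>
     (\<forall>i \<in> interior_verts S. total_curvature S \<kappa> P i = That i)"


section \<open>The combinatorial Calabi flow\<close>

definition with_boundary ::
    "('v, 'e, 'f) triangulation \<Rightarrow> ('v \<Rightarrow> real) \<Rightarrow> ('v \<Rightarrow> real) \<Rightarrow> 'v \<Rightarrow> real" where
  "with_boundary S khat k v = (if v \<in> boundary_verts S then khat v else k v)"

text \<open>
  The total geodesic curvature as a function of the curvatures \<open>k\<close> of the interior vertices;
  it does not depend on the choice of the packing, which is unique up to isometries.
\<close>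

definition curvature_map ::
    "('v, 'e, 'f) triangulation \<Rightarrow> ('v \<Rightarrow> real) \<Rightarrow> ('v \<Rightarrow> real) \<Rightarrow> 'v \<Rightarrow> real" where
  "curvature_map S khat k i =
     (THE T. \<exists>P. is_packing S (with_boundary S khat k) P \<and>
                 T = total_curvature S (with_boundary S khat k) P i)"

text \<open>The partial derivative of \<open>T i\<close> with respect to \<open>s j = ln (k j)\<close>.\<close>

definition curvature_jacobian ::
    "('v, 'e, 'f) triangulation \<Rightarrow> ('v \<Rightarrow> real) \<Rightarrow> ('v \<Rightarrow> real) \<Rightarrow> 'v \<Rightarrow> 'v \<Rightarrow> real" where
  "curvature_jacobian S khat k i j =
     deriv (\<lambda>s. curvature_map S khat (k(j := exp s)) i) (ln (k j))"

definition calabi_flow ::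
    "('v, 'e, 'f) triangulation \<Rightarrow> ('v \<Rightarrow> real) \<Rightarrow> ('v \<Rightarrow> real) \<Rightarrow> ('v \<Rightarrow> real) \<Rightarrow>
     real set \<Rightarrow> (real \<Rightarrow> 'v \<Rightarrow> real) \<Rightarrow> bool" where
  "calabi_flow S khat That k0 J k \<longleftrightarrow>
     (\<forall>i \<in> interior_verts S. k 0 i = k0 i) \<and>
     (\<forall>t \<in> J. \<forall>i \<in> interior_verts S.
        0 < k t i \<and>
        ((\<lambda>\<tau>. k \<tau> i) has_real_derivative
           - k t i * (\<Sum>j \<in> interior_verts S.
               curvature_jacobian S khat (k t) j i * (curvature_map S khat (k t) j - That j)))
          (at t within J))"

end

theory Submission
  imports Defs "HOL-Real_Asymp.Real_Asymp"
begin

text \<open>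
  A generalized circle of geodesic curvature \<open>k\<close> is a section \<open>mink x u = - k\<close> of the hyperboloid
  with \<open>mink u u = 1 - k\<^sup>2\<close>.  External tangency of two of them means
  \<open>mink u\<^sub>1 u\<^sub>2 = - 1 - k\<^sub>1 * k\<^sub>2\<close>, and perpendicularity to the dual circle \<open>w\<close>, of geodesic curvature
  \<open>\<kappa>\<close>, means \<open>mink w u = - \<kappa> * k\<close>.  Hence \<open>\<kappa>\<^sup>2 = 1 + k\<^sub>1 * k\<^sub>2 + k\<^sub>1 * k\<^sub>3 + k\<^sub>2 * k\<^sub>3\<close>, and a rational
  parametrization of the sub-arc expresses its total geodesic curvature as
  \<open>2 * k / \<kappa>\<close> times the integral of \<open>1 / (1 + c * \<tau>\<^sup>2)\<close> over the unit interval, where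
  \<open>c = (k\<^sup>2 - 1) / \<kappa>\<^sup>2\<close>.

  In the coordinates \<open>s = ln k\<close> the off-diagonal entries of the Jacobian of a triangle are
  \<open>- k\<^sub>i * k\<^sub>j / (\<kappa> * (k\<^sub>i + k\<^sub>j))\<close> and its row sums are positive.  So the Jacobian \<open>M\<close> is symmetric
  and positive definite, and \<open>T - That\<close> is the gradient of a convex function \<open>W\<close>.  Tangent planes
  at points where the total curvatures of a triangle are nearly \<open>(pi, 0, 0)\<close> or \<open>(0, 0, 0)\<close>
  bound \<open>W\<close> from below, and admissibility of \<open>That\<close> makes it coercive.  The flow becomes
  \<open>ds/dt = - M' (T - That)\<close>.  It decreases \<open>W\<close>, so it stays in a compact set and exists for all times.
  On that set \<open>M\<close> is uniformly positive definite, so \<open>T - That\<close> decays exponentially and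
  \<open>s\<close> converges; the limit realizes \<open>That\<close>, and it is unique because \<open>T\<close> is injective.
\<close>


section \<open>Minkowski space and the hyperbolic plane\<close>

text \<open>The equation \<open>mink x u = - k\<close> treats circles, horocycles and hypercycles
  alike, so nothing after it branches on \<open>k\<close>; accordingly the integral of
  \<open>1 / (1 + c * \<tau>\<^sup>2)\<close> is an arctangent, a constant or an inverse hyperbolic
  tangent according to the sign of \<open>c\<close>. Since lengths and the curvature map are
  definite descriptions, their values must be shown independent of parametrization and packing
  before calculus can start.

  Two obstacles shape the analysis. The extreme values of the total curvatures are only approached
  by the witnesses, so each tangent plane costs an error \<open>e\<close> times the sum of the
  absolute coordinates, which a quantitative form of admissibility has to absorb. And the field is
  controlled only on bounded sets, so the logarithms are clamped to a box slightly larger than the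
  sublevel set of \<open>W\<close> that contains the start; the clamped system has global solutions
  by Picard iteration, and its trajectory never reaches the clamp.\<close>

lemma mink_sym: "mink x y = mink y x"
  by (simp add: mink_def inner_commute mult.commute)

text \<open>Besides the algebraic rules below, this supplies the product rule for
  \<open>mink\<close> along differentiable curves.\<close>

lemma bounded_bilinear_mink: "bounded_bilinear mink"
proof -
  have 1: "bounded_bilinear (\<lambda>(x :: minkowski) (y :: minkowski). fst x \<bullet> fst y)"
    by (rule bounded_bilinear.comp[OF bounded_bilinear_inner bounded_linear_fst bounded_linear_fst])
  have 2: "bounded_bilinear (\<lambda>(x :: minkowski) (y :: minkowski). snd x * snd y)"
    by (rule bounded_bilinear.comp[OF bounded_bilinear_mult bounded_linear_snd bounded_linear_snd])
  obtain K1 where K1: "\<And>(x :: minkowski) (y :: minkowski). norm (fst x \<bullet> fst y) \<le> norm x * norm y * K1"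
    using bounded_bilinear.bounded[OF 1] by blast
  obtain K2 where K2: "\<And>(x :: minkowski) (y :: minkowski). norm (snd x * snd y) \<le> norm x * norm y * K2"
    using bounded_bilinear.bounded[OF 2] by blast
  show ?thesis
  proof
    show "\<exists>K. \<forall>a b. norm (mink a b) \<le> norm a * norm b * K"
    proof (intro exI allI)
      fix a b :: minkowski
      have "norm (mink a b) \<le> norm (fst a \<bullet> fst b) + norm (snd a * snd b)"
        unfolding mink_def by (rule norm_triangle_ineq4)
      then show "norm (mink a b) \<le> norm a * norm b * (K1 + K2)"
        using K1[of a b] K2[of a b] by (simp add: distrib_left)
    qed
  qed (simp_all add: mink_def inner_add_left inner_add_right algebra_simps)
qed

lemmas mink_add_left = bounded_bilinear.add_left[OF bounded_bilinear_mink]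
  and mink_add_right = bounded_bilinear.add_right[OF bounded_bilinear_mink]
  and mink_diff_left = bounded_bilinear.diff_left[OF bounded_bilinear_mink]
  and mink_diff_right = bounded_bilinear.diff_right[OF bounded_bilinear_mink]
  and mink_minus_left = bounded_bilinear.minus_left[OF bounded_bilinear_mink]
  and mink_minus_right = bounded_bilinear.minus_right[OF bounded_bilinear_mink]
  and mink_scaleR_left = bounded_bilinear.scaleR_left[OF bounded_bilinear_mink]
  and mink_scaleR_right = bounded_bilinear.scaleR_right[OF bounded_bilinear_mink]
  and mink_zero_left = bounded_bilinear.zero_left[OF bounded_bilinear_mink]
  and mink_zero_right = bounded_bilinear.zero_right[OF bounded_bilinear_mink]

lemmas mink_simps = mink_add_left mink_add_right mink_diff_left mink_diff_right
  mink_minus_left mink_minus_right mink_scaleR_left mink_scaleR_right mink_zero_left mink_zero_right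

lemma mink_coords:
  "mink x y = Re (fst x) * Re (fst y) + Im (fst x) * Im (fst y) - snd x * snd y"
  by (simp add: mink_def inner_complex_def)

lemma hyp_planeD: "x \<in> hyp_plane \<Longrightarrow> mink x x = -1" "x \<in> hyp_plane \<Longrightarrow> 0 < snd x"
  by (auto simp: hyp_plane_def)

text \<open>\<open>snd y *\<^sub>R x\<close> and \<open>snd x *\<^sub>R y\<close> have the same
  height, so their difference is horizontal and its \<open>mink\<close> square is a squared
  Euclidean norm. This one identity yields both the reversed Cauchy-Schwarz inequality on the sheet
  and its equality case.\<close>

lemma hyp_plane_defect:
  assumes "x \<in> hyp_plane" "y \<in> hyp_plane"
  shows "(norm (snd y *\<^sub>R fst x - snd x *\<^sub>R fst y))\<^sup>2
    = - (snd x)\<^sup>2 - (snd y)\<^sup>2 - 2 * snd x * snd y * mink x y"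
proof -
  have a: "fst x \<bullet> fst x = (snd x)\<^sup>2 - 1" and b: "fst y \<bullet> fst y = (snd y)\<^sup>2 - 1"
    using hyp_planeD(1)[OF assms(1)] hyp_planeD(1)[OF assms(2)]
    by (auto simp: mink_def power2_eq_square)
  have "(norm (snd y *\<^sub>R fst x - snd x *\<^sub>R fst y))\<^sup>2 =
    (snd y)\<^sup>2 * (fst x \<bullet> fst x) + (snd x)\<^sup>2 * (fst y \<bullet> fst y) - 2 * snd x * snd y * (fst x \<bullet> fst y)"
    unfolding power2_norm_eq_inner
    by (simp add: inner_diff_left inner_diff_right inner_commute[of "fst y" "fst x"] power2_eq_square algebra_simps)
  also have "\<dots> = - (snd x)\<^sup>2 - (snd y)\<^sup>2 - 2 * snd x * snd y * mink x y"
    unfolding a b mink_def by (simp add: power2_eq_square algebra_simps)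
  finally show ?thesis .
qed

lemma mink_hyp_plane_le:
  assumes "x \<in> hyp_plane" "y \<in> hyp_plane"
  shows "mink x y \<le> -1"
proof -
  have xy: "0 < snd x * snd y" using assms by (simp add: hyp_planeD)
  have "0 \<le> - (snd x)\<^sup>2 - (snd y)\<^sup>2 - 2 * snd x * snd y * mink x y"
    using hyp_plane_defect[OF assms] by (metis zero_le_power2)
  then have "0 \<le> (snd x * snd y) * (-1 - mink x y) * 2 - (snd x - snd y)\<^sup>2"
    by (simp add: power2_eq_square algebra_simps)
  then have "0 \<le> (snd x * snd y) * (-1 - mink x y)"
    using zero_le_power2[of "snd x - snd y"] by linarith
  then show ?thesis using xy by (simp add: zero_le_mult_iff)
qed

lemma mink_hyp_plane_eq:
  assumes "x \<in> hyp_plane" "y \<in> hyp_plane" "mink x y = -1"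
  shows "x = y"
proof -
  have d: "(norm (snd y *\<^sub>R fst x - snd x *\<^sub>R fst y))\<^sup>2 + (snd x - snd y)\<^sup>2 = 0"
    unfolding hyp_plane_defect[OF assms(1,2)] assms(3)
    by (simp add: power2_eq_square algebra_simps)
  then have "(snd x - snd y)\<^sup>2 = 0" "(norm (snd y *\<^sub>R fst x - snd x *\<^sub>R fst y))\<^sup>2 = 0"
    using zero_le_power2[of "snd x - snd y"]
      zero_le_power2[of "norm (snd y *\<^sub>R fst x - snd x *\<^sub>R fst y)"] by linarith+
  then show ?thesis using hyp_planeD(2)[OF assms(1)] by (auto simp: prod_eq_iff)
qed

text \<open>On the opposite sheet products with \<open>p\<close> are positive. Points built from a
  frame are thus placed on the right sheet without computing their height.\<close>

lemma hyp_planeI: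
  assumes "mink x x = -1" "p \<in> hyp_plane" "mink x p < 0"
  shows "x \<in> hyp_plane"
proof (rule ccontr)
  assume n: "x \<notin> hyp_plane"
  have "snd x \<noteq> 0"
  proof
    assume "snd x = 0"
    then have "fst x \<bullet> fst x = -1" using assms(1) by (simp add: mink_def)
    then show False using inner_ge_zero[of "fst x"] by linarith
  qed
  with n assms(1) have "- x \<in> hyp_plane" by (simp add: hyp_plane_def mink_simps)
  from mink_hyp_plane_le[OF this assms(2)] assms(3) show False by (simp add: mink_simps)
qed

text \<open>Cauchy-Schwarz for the spatial parts, with orthogonality to \<open>p\<close> inserted,
  gives \<open>fst v \<bullet> fst v \<le> mink v v * (snd p)\<^sup>2\<close>. This is positive
  definiteness of the metric on tangent planes.\<close>

lemma tangent_spacelike: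
  assumes "p \<in> hyp_plane" "mink v p = 0"
  shows "0 \<le> mink v v" and "mink v v = 0 \<Longrightarrow> v = 0"
proof -
  have pp: "norm (fst p) ^ 2 = (snd p)\<^sup>2 - 1"
    using hyp_planeD(1)[OF assms(1)]
    unfolding mink_def power2_norm_eq_inner by (simp add: power2_eq_square)
  have vp: "fst v \<bullet> fst p = snd v * snd p" using assms(2) by (simp add: mink_def)
  have sp: "0 < (snd p)\<^sup>2" using hyp_planeD(2)[OF assms(1)] by simp
  have "(snd v * snd p)\<^sup>2 \<le> (fst v \<bullet> fst v) * (fst p \<bullet> fst p)"
    using Cauchy_Schwarz_ineq[of "fst v" "fst p"] by (simp add: vp)
  then have *: "(snd v)\<^sup>2 * (snd p)\<^sup>2 \<le> (fst v \<bullet> fst v) * ((snd p)\<^sup>2 - 1)"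
    using pp by (simp add: power2_norm_eq_inner power_mult_distrib)
  have mv: "mink v v = fst v \<bullet> fst v - (snd v)\<^sup>2" by (simp add: mink_def power2_eq_square)
  have **: "fst v \<bullet> fst v \<le> mink v v * (snd p)\<^sup>2"
    using * unfolding mv by (simp add: algebra_simps)
  then have "0 \<le> mink v v * (snd p)\<^sup>2" using inner_ge_zero[of "fst v"] by linarith
  then show "0 \<le> mink v v" using sp by (simp add: zero_le_mult_iff)
  assume "mink v v = 0"
  with ** have "fst v \<bullet> fst v \<le> 0" by simp
  then have "fst v = 0" using inner_gt_zero_iff[of "fst v"] by (meson not_le)
  moreover from this \<open>mink v v = 0\<close> have "snd v = 0" by (simp add: mink_def)
  ultimately show "v = 0" by (simp add: prod_eq_iff)
qed

text \<open>The Euclidean cross product followed by the reflection that turns the dot product into \<open>mink\<close>.\<close>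

definition mink_cross :: "minkowski \<Rightarrow> minkowski \<Rightarrow> minkowski" where
  "mink_cross x y =
     (Complex (Im (fst x) * snd y - snd x * Im (fst y)) (snd x * Re (fst y) - Re (fst x) * snd y),
      - (Re (fst x) * Im (fst y) - Im (fst x) * Re (fst y)))"

lemma mink_cross_orthogonal:
  "mink (mink_cross x y) x = 0" "mink (mink_cross x y) y = 0"
  by (simp_all add: mink_coords mink_cross_def algebra_simps)

lemma mink_cross_self:
  "mink (mink_cross x y) (mink_cross x y) = (mink x y)\<^sup>2 - mink x x * mink y y"
  unfolding mink_coords mink_cross_def by (simp add: power2_eq_square) algebra

text \<open>Cramer's rule: \<open>mink (mink_cross p m) (mink_cross p m)\<close> is the determinant
  of \<open>p\<close>, \<open>m\<close> and \<open>mink_cross p m\<close>.\<close>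

lemma orthogonal_to_basis:
  assumes "mink y p = 0" "mink y m = 0" "mink y (mink_cross p m) = 0"
    and "mink (mink_cross p m) (mink_cross p m) \<noteq> 0"
  shows "y = 0"
proof -
  obtain p1 p2 p3 where p: "p = (Complex p1 p2, p3)" by (metis complex.collapse prod.collapse)
  obtain m1 m2 m3 where m: "m = (Complex m1 m2, m3)" by (metis complex.collapse prod.collapse)
  obtain y1 y2 y3 where y: "y = (Complex y1 y2, y3)" by (metis complex.collapse prod.collapse)
  have "y1 * mink (mink_cross p m) (mink_cross p m) = 0"
    "y2 * mink (mink_cross p m) (mink_cross p m) = 0"
    "y3 * mink (mink_cross p m) (mink_cross p m) = 0"
    using assms(1-3) unfolding p m y mink_coords mink_cross_def
    by (simp_all, algebra+)
  with assms(4) have "y1 = 0" "y2 = 0" "y3 = 0" by auto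
  then show ?thesis unfolding y by (simp add: zero_prod_def complex_eq_iff)
qed

text \<open>In dimension three the last vector of an orthonormal frame is
  \<open>mink_cross p m\<close> up to sign, and the sign cancels in
  \<open>mink x n *\<^sub>R n\<close>.\<close>

lemma frame_expansion:
  assumes "mink p p = -1" "mink m m = 1" "mink n n = 1"
    and "mink p m = 0" "mink p n = 0" "mink m n = 0"
  shows "x = - mink x p *\<^sub>R p + mink x m *\<^sub>R m + mink x n *\<^sub>R n"
proof -
  let ?e = "mink_cross p m"
  have ee: "mink ?e ?e = 1" by (simp add: mink_cross_self assms)
  have ep: "mink ?e p = 0" "mink ?e m = 0" by (rule mink_cross_orthogonal)+
  define y where "y = n - mink n ?e *\<^sub>R ?e"
  have "y = 0"
    by (rule orthogonal_to_basis[of y p m])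
      (simp_all add: y_def mink_simps ep ee assms mink_sym[of n p] mink_sym[of n m])
  then have n: "n = mink n ?e *\<^sub>R ?e" by (simp add: y_def)
  have "mink n n = mink n ?e * mink n ?e"
    by (subst n) (simp add: mink_simps mink_sym)
  then have c1: "mink n ?e * mink n ?e = 1" using assms by simp
  define z where "z = x - (- mink x p *\<^sub>R p + mink x m *\<^sub>R m + mink x n *\<^sub>R n)"
  have nn: "mink x n *\<^sub>R n = mink x ?e *\<^sub>R ?e"
  proof -
    have "mink x n = mink n ?e * mink x ?e" by (subst n) (simp add: mink_simps)
    then have "mink x n *\<^sub>R n = (mink n ?e * mink x ?e) *\<^sub>R (mink n ?e *\<^sub>R ?e)" using n by simp
    also have "\<dots> = ((mink n ?e * mink n ?e) * mink x ?e) *\<^sub>R ?e" by (simp add: ac_simps)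
    finally show ?thesis using c1 by simp
  qed
  have "z = 0"
    by (rule orthogonal_to_basis[of z p m])
      (simp_all add: z_def nn mink_simps ep ee assms mink_sym[of m p] mink_sym[of p ?e] mink_sym[of m ?e])
  then show ?thesis by (simp add: z_def)
qed

section \<open>Generalized circles as plane sections\<close>

definition cycle :: "minkowski \<Rightarrow> real \<Rightarrow> minkowski set" where
  "cycle u k = {x \<in> hyp_plane. mink x u = - k}"

text \<open>
  All three kinds of generalized circles become \<open>mink x u = - k\<close>, where \<open>k\<close> is the geodesic
  curvature, once the vector \<open>u\<close> is scaled to \<open>mink u u = 1 - k\<^sup>2\<close>.
\<close>

fun cycle_vec :: "gcircle \<Rightarrow> minkowski" where
  "cycle_vec (Circle p r) = (1 / sinh r) *\<^sub>R p"
| "cycle_vec (Horocycle u) = u"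
| "cycle_vec (Hypercycle n d) = (1 / cosh d) *\<^sub>R n"

lemma arcosh_le_iff: "1 \<le> x \<Longrightarrow> 0 \<le> r \<Longrightarrow> arcosh x \<le> r \<longleftrightarrow> x \<le> cosh (r::real)"
  by (metis arcosh_cosh_real arcosh_nonneg_real cosh_arcosh_real cosh_real_nonneg_le_iff)

lemma arcosh_eq_iff: "1 \<le> x \<Longrightarrow> 0 \<le> r \<Longrightarrow> arcosh x = r \<longleftrightarrow> x = cosh (r::real)"
  by (metis arcosh_cosh_real cosh_arcosh_real)

lemma hdist_eq_iff:
  assumes "x \<in> hyp_plane" "p \<in> hyp_plane" "0 \<le> r"
  shows "hdist x p = r \<longleftrightarrow> mink x p = - cosh r" and "hdist x p < r \<longleftrightarrow> - cosh r < mink x p"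
proof -
  have 1: "1 \<le> - mink x p" using mink_hyp_plane_le[OF assms(1,2)] by simp
  show "hdist x p = r \<longleftrightarrow> mink x p = - cosh r"
    unfolding hdist_def arcosh_eq_iff[OF 1 assms(3)] by linarith
  show "hdist x p < r \<longleftrightarrow> - cosh r < mink x p"
    using arcosh_le_iff[OF 1 assms(3)] arcosh_eq_iff[OF 1 assms(3)] unfolding hdist_def by linarith
qed

text \<open>The distance to a geodesic is attained at the orthogonal projection \<open>y\<close>.\<close>

lemma hdist_to_geodesic:
  assumes "x \<in> hyp_plane" "mink n n = 1"
  shows "hdist_to x (geodesic n) = arcosh (sqrt (1 + (mink x n)\<^sup>2))"
proof -
  define h where "h = sqrt (1 + (mink x n)\<^sup>2)"
  have h1: "1 \<le> h" unfolding h_def by simp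
  have h2: "h * h = 1 + (mink x n)\<^sup>2" unfolding h_def by simp
  define y where "y = (1 / h) *\<^sub>R (x - mink x n *\<^sub>R n)"
  have hy: "h *\<^sub>R y = x - mink x n *\<^sub>R n" using h1 by (simp add: y_def)
  have nx: "mink n x = mink x n" by (rule mink_sym)
  have "mink (h *\<^sub>R y) (h *\<^sub>R y) = -1 - (mink x n)\<^sup>2"
    unfolding hy using assms hyp_planeD(1)[OF assms(1)] nx
    by (simp add: mink_simps power2_eq_square algebra_simps)
  moreover have "mink (h *\<^sub>R y) (h *\<^sub>R y) = (h * h) * mink y y" by (simp add: mink_simps)
  ultimately have "(h * h) * mink y y = - (h * h)" unfolding h2 by linarith
  then have yy: "mink y y = -1"
  proof -
    have "(h * h) * (mink y y + 1) = 0" using \<open>(h * h) * mink y y = - (h * h)\<close> by (simp add: algebra_simps)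
    then show ?thesis using h1 by auto
  qed
  have "mink (h *\<^sub>R y) x = -1 - (mink x n)\<^sup>2"
    unfolding hy using hyp_planeD(1)[OF assms(1)] nx
    by (simp add: mink_simps power2_eq_square algebra_simps)
  then have "h * mink y x = - (h * h)" unfolding h2 by (simp add: mink_simps)
  then have "h * (mink y x + h) = 0" by (simp add: algebra_simps)
  then have yx: "mink y x = - h" using h1 by auto
  have yH: "y \<in> hyp_plane" by (rule hyp_planeI[OF yy assms(1)]) (use yx h1 in simp)
  have yn: "mink y n = 0" unfolding y_def using assms(2) by (simp add: mink_simps)
  have ymem: "y \<in> geodesic n" using yH yn by (simp add: geodesic_def)
  have le: "arcosh h \<le> hdist x z" if "z \<in> geodesic n" for z
  proof -
    have z: "z \<in> hyp_plane" "mink z n = 0" using that by (auto simp: geodesic_def)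
    have "mink (h *\<^sub>R y) z = mink x z" unfolding hy using z(2) by (simp add: mink_simps mink_sym[of n z])
    then have "mink x z = h * mink y z" by (simp add: mink_simps)
    also have "\<dots> \<le> h * -1" using mink_hyp_plane_le[OF yH z(1)] h1 by (intro mult_left_mono) auto
    finally have "h \<le> - mink x z" by simp
    then show ?thesis unfolding hdist_def using h1
      by (metis arcosh_le_iff arcosh_nonneg_real cosh_arcosh_real order_trans)
  qed
  have "hdist x y = arcosh h" unfolding hdist_def using yx mink_sym[of x y] by simp
  then have "(INF z\<in>geodesic n. hdist x z) = arcosh h"
    by (intro cInf_eq_minimum) (use ymem le in \<open>force+\<close>)
  then show ?thesis unfolding hdist_to_def h_def .
qed

lemma hdist_to_geodesic_iff:
  assumes "x \<in> hyp_plane" "mink n n = 1" "0 < d"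
  shows "hdist_to x (geodesic n) = d \<longleftrightarrow> \<bar>mink x n\<bar> = sinh d"
    and "hdist_to x (geodesic n) < d \<longleftrightarrow> \<bar>mink x n\<bar> < sinh d"
proof -
  have c: "cosh d = sqrt (1 + (sinh d)\<^sup>2)"
    using cosh_square_eq[of d] by (metis add.commute cosh_real_nonneg real_sqrt_abs abs_of_nonneg)
  have s: "0 < sinh d" using assms(3) by simp
  have 1: "1 \<le> sqrt (1 + (mink x n)\<^sup>2)" by simp
  have sq: "(mink x n)\<^sup>2 \<le> (sinh d)\<^sup>2 \<longleftrightarrow> \<bar>mink x n\<bar> \<le> sinh d"
    using abs_le_square_iff[of "mink x n" "sinh d"] s by simp
  have sq': "(sinh d)\<^sup>2 \<le> (mink x n)\<^sup>2 \<longleftrightarrow> sinh d \<le> \<bar>mink x n\<bar>"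
    using abs_le_square_iff[of "sinh d" "mink x n"] s by simp
  have eq: "hdist_to x (geodesic n) = d \<longleftrightarrow> (mink x n)\<^sup>2 = (sinh d)\<^sup>2"
    unfolding hdist_to_geodesic[OF assms(1,2)] using arcosh_eq_iff[OF 1, of d] assms(3) c by simp
  have le: "hdist_to x (geodesic n) \<le> d \<longleftrightarrow> (mink x n)\<^sup>2 \<le> (sinh d)\<^sup>2"
    unfolding hdist_to_geodesic[OF assms(1,2)] using arcosh_le_iff[OF 1, of d] assms(3) c by simp
  show "hdist_to x (geodesic n) = d \<longleftrightarrow> \<bar>mink x n\<bar> = sinh d"
    unfolding eq using sq sq' by linarith
  then show "hdist_to x (geodesic n) < d \<longleftrightarrow> \<bar>mink x n\<bar> < sinh d"
    using le sq by linarith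
qed

lemma geodesic_curvature_pos: "gcircle_valid c \<Longrightarrow> 0 < geodesic_curvature c"
  by (cases c) auto

text \<open>The inverse square of sinh is coth squared minus 1, that of cosh is 1 minus tanh
  squared; this explains the scale factors in \<open>cycle_vec\<close>.\<close>

lemma mink_cycle_vec_self:
  assumes "gcircle_valid c"
  shows "mink (cycle_vec c) (cycle_vec c) = 1 - (geodesic_curvature c)\<^sup>2"
proof (cases c)
  case (Circle p r)
  with assms have p: "mink p p = -1" and r: "0 < r" by (auto simp: hyp_planeD)
  have "cosh r ^ 2 = sinh r ^ 2 + 1" by (simp add: cosh_square_eq)
  then show ?thesis using Circle p r
    by (simp add: mink_simps tanh_def field_simps power2_eq_square)
next
  case (Hypercycle n d)
  with assms have p: "mink n n = 1" by auto
  have c: "cosh d \<noteq> 0" by simp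
  have "cosh d ^ 2 = sinh d ^ 2 + 1" by (simp add: cosh_square_eq)
  then have "1 / (cosh d)\<^sup>2 = 1 - (sinh d / cosh d)\<^sup>2" using c
    by (metis (no_types) add_diff_cancel_left' diff_divide_distrib divide_self power_divide power_not_zero)
  then show ?thesis using Hypercycle p c
    by (simp add: mink_simps tanh_def power2_eq_square)
qed (use assms in auto)

lemma curve_eq_cycle:
  assumes "gcircle_valid c"
  shows "curve c = cycle (cycle_vec c) (geodesic_curvature c)"
proof (cases c)
  case (Circle p r)
  with assms have p: "p \<in> hyp_plane" and r: "0 < r" by auto
  have "mink x p = - cosh r \<longleftrightarrow> mink x p / sinh r = - (cosh r / sinh r)" for x
    using r by (simp add: field_simps)
  then show ?thesis using Circle p r hdist_eq_iff(1)[OF _ p, of _ r]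
    by (auto simp: cycle_def mink_simps tanh_def)
next
  case (Hypercycle n d)
  with assms have n: "mink n n = 1" and d: "0 < d" by auto
  have s: "0 < sinh d" and c: "0 < cosh d" using d by auto
  have "mink x n < 0 \<and> \<bar>mink x n\<bar> = sinh d \<longleftrightarrow> mink x n / cosh d = - (sinh d / cosh d)" for x
    using s c by (auto simp: field_simps)
  then show ?thesis using Hypercycle hdist_to_geodesic_iff(1)[OF _ n d]
    by (auto simp: cycle_def mink_simps tanh_def)
qed (auto simp: cycle_def)

lemma convex_side_eq:
  assumes "gcircle_valid c"
  shows "convex_side c = {x \<in> hyp_plane. - geodesic_curvature c < mink x (cycle_vec c)}"
proof (cases c)
  case (Circle p r)
  with assms have p: "p \<in> hyp_plane" and r: "0 < r" by auto
  have s: "0 < sinh r" using r by simp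
  have "- cosh r < mink x p \<longleftrightarrow> - (cosh r / sinh r) < mink x p / sinh r" for x
    using divide_less_cancel[of "- cosh r" "sinh r" "mink x p"] s by auto
  then show ?thesis using Circle p r hdist_eq_iff(2)[OF _ p, of _ r]
    by (auto simp: mink_simps tanh_def)
next
  case (Hypercycle n d)
  with assms have n: "mink n n = 1" and d: "0 < d" by auto
  have s: "0 < sinh d" and c: "0 < cosh d" using d by auto
  have "0 \<le> mink x n \<or> \<bar>mink x n\<bar> < sinh d \<longleftrightarrow> - (sinh d / cosh d) < mink x n / cosh d" for x
  proof -
    have "- (sinh d / cosh d) < mink x n / cosh d \<longleftrightarrow> - sinh d < mink x n"
      using divide_less_cancel[of "- sinh d" "cosh d" "mink x n"] c by auto
    then show ?thesis using s by linarith
  qed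
  then show ?thesis using Hypercycle hdist_to_geodesic_iff(2)[OF _ n d]
    by (auto simp: mink_simps tanh_def)
qed auto

lemma obtain_tanh:
  assumes "0 < x" "x < (1::real)"
  obtains r where "0 < r" "tanh r = x"
proof -
  define y where "y = sqrt ((1 + x) / (1 - x))"
  have y: "0 < y" "y\<^sup>2 = (1 + x) / (1 - x)" using assms by (auto simp: y_def)
  have "tanh (ln y) = x"
    unfolding tanh_ln_real[OF y(1)] y(2) using assms by (simp add: field_simps)
  then show ?thesis using that assms(1) by (metis tanh_real_pos_iff)
qed

text \<open>The sign of \<open>1 - k\<^sup>2\<close> makes \<open>u\<close> timelike, null or
  spacelike, which decides the kind of circle. In the first two cases \<open>0 < snd u\<close>
  selects the future-pointing vector. The last conclusion is what \<open>triangle_packing\<close>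
  asks of the dual circle.\<close>

lemma gcircle_of_cycle_vec:
  assumes "0 < k" "mink u u = 1 - k\<^sup>2" "0 < snd u"
  obtains c where "gcircle_valid c" "geodesic_curvature c = k" "cycle_vec c = u"
    "1 < k \<Longrightarrow> \<exists>p r. c = Circle p r"
proof -
  consider "1 < k" | "k = 1" | "k < 1" by linarith
  then show ?thesis
  proof cases
    case 1
    obtain r where r: "0 < r" and t: "tanh r = 1 / k"
      using obtain_tanh[of "1 / k"] 1 by auto
    have s: "0 < sinh r" using r by simp
    have "cosh r = k * sinh r" using t assms(1) cosh_real_pos[of r] by (simp add: tanh_def field_simps)
    then have "(k * sinh r)\<^sup>2 = (sinh r)\<^sup>2 + 1" using cosh_square_eq[of r] by simp
    then have ks: "(k\<^sup>2 - 1) * (sinh r)\<^sup>2 = 1" by (simp add: power_mult_distrib algebra_simps)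
    let ?p = "sinh r *\<^sub>R u"
    have "mink ?p ?p = (sinh r)\<^sup>2 * (1 - k\<^sup>2)" by (simp add: mink_simps assms power2_eq_square)
    also have "\<dots> = -1" using ks by (simp add: algebra_simps)
    finally have "?p \<in> hyp_plane" using s assms(3) by (simp add: hyp_plane_def)
    then show ?thesis using that[of "Circle ?p r"] r s t by simp
  next
    case 2
    show ?thesis by (rule that[of "Horocycle u"]) (use 2 assms in auto)
  next
    case 3
    obtain d where d: "0 < d" and t: "tanh d = k" using obtain_tanh 3 assms(1) by blast
    have c: "0 < cosh d" by simp
    have "sinh d = k * cosh d" using t c by (simp add: tanh_def field_simps)
    then have "(cosh d)\<^sup>2 = (k * cosh d)\<^sup>2 + 1" using cosh_square_eq[of d] by simp
    then have kc: "(1 - k\<^sup>2) * (cosh d)\<^sup>2 = 1" by (simp add: power_mult_distrib algebra_simps)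
    let ?n = "cosh d *\<^sub>R u"
    have "mink ?n ?n = (1 - k\<^sup>2) * (cosh d)\<^sup>2" by (simp add: mink_simps assms power2_eq_square)
    then have "mink ?n ?n = 1" using kc by simp
    then show ?thesis using that[of "Hypercycle ?n d"] d t 3 c by simp
  qed
qed

text \<open>\<open>u - k *\<^sub>R p\<close> is the unit normal of the cycle at \<open>p\<close>,
  pointing to the convex side. Tangency and perpendicularity become statements about two such
  normals.\<close>

lemma cycle_normal:
  assumes "p \<in> cycle u k" "mink u u = 1 - k\<^sup>2"
  shows "mink (u - k *\<^sub>R p) p = 0" "mink (u - k *\<^sub>R p) (u - k *\<^sub>R p) = 1"
  using assms hyp_planeD(1)[of p]
  by (auto simp: cycle_def mink_simps mink_sym[of u p] power2_eq_square algebra_simps)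

text \<open>
  Rational parametrization of the cycle through \<open>p\<close> with initial velocity \<open>v\<close>.  The parameter is
  proportional to the tangent of half of the arc length (suitably interpreted for \<open>k \<le> 1\<close>).
\<close>

definition cycle_path :: "minkowski \<Rightarrow> minkowski \<Rightarrow> real \<Rightarrow> minkowski \<Rightarrow> real \<Rightarrow> minkowski" where
  "cycle_path p u k v t = p + (1 / (1 + (k\<^sup>2 - 1) * (mink v v * t\<^sup>2 / 4))) *\<^sub>R
     (t *\<^sub>R v + (mink v v * t\<^sup>2 / 2) *\<^sub>R ((1 - k\<^sup>2) *\<^sub>R p + k *\<^sub>R u))"

lemma cycle_path_mem:
  assumes p: "p \<in> cycle u k" and u: "mink u u = 1 - k\<^sup>2"
    and v: "mink v p = 0" "mink v u = 0"
    and pos: "0 < 1 + (k\<^sup>2 - 1) * (mink v v * t\<^sup>2 / 4)"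
  shows "cycle_path p u k v t \<in> cycle u k"
proof -
  define D where "D = 1 + (k\<^sup>2 - 1) * (mink v v * t\<^sup>2 / 4)"
  define m where "m = mink v v"
  define w where "w = (1 - k\<^sup>2) *\<^sub>R p + k *\<^sub>R u"
  define y where "y = t *\<^sub>R v + (m * t\<^sup>2 / 2) *\<^sub>R w"
  have D: "0 < D" "D = 1 + (k\<^sup>2 - 1) * (m * t\<^sup>2 / 4)" using pos by (auto simp: D_def m_def)
  have H: "p \<in> hyp_plane" and pu: "mink p u = - k" using p by (auto simp: cycle_def)
  note pp = hyp_planeD(1)[OF H]
  have m0: "0 \<le> m" unfolding m_def by (rule tangent_spacelike(1)[OF H v(1)])
  have up: "mink u p = - k" using pu mink_sym by metis
  have vs: "mink p v = 0" "mink u v = 0" using v mink_sym by metis+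
  have wp: "mink w p = -1" "mink p w = -1" by (simp_all add: w_def mink_simps pp up pu power2_eq_square algebra_simps)
  have wu: "mink w u = 0" by (simp add: w_def mink_simps pu u power2_eq_square algebra_simps)
  have uw: "mink u w = 0" using wu mink_sym by metis
  have ww: "mink w w = k\<^sup>2 - 1"
    by (subst w_def) (simp add: mink_simps wp uw)
  have wv: "mink w v = 0" "mink v w = 0" by (simp_all add: w_def mink_simps v vs)
  have x: "cycle_path p u k v t = p + (1 / D) *\<^sub>R y"
    by (simp add: cycle_path_def D_def m_def w_def y_def)
  have yp: "mink y p = - (m * t\<^sup>2 / 2)" "mink p y = - (m * t\<^sup>2 / 2)" by (simp_all add: y_def mink_simps v vs wp)
  have yu: "mink y u = 0" by (simp add: y_def mink_simps v wu)
  have "mink y y = t\<^sup>2 * m + (m * t\<^sup>2 / 2)\<^sup>2 * (k\<^sup>2 - 1)"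
    by (simp add: y_def mink_simps wv ww m_def power2_eq_square)
  \<comment> \<open>The denominator \<open>D\<close> is chosen for this factorization: the
    contributions \<open>2 * mink p y / D\<close> and \<open>mink y y / D\<^sup>2\<close> then
    cancel.\<close>
  also have "\<dots> = m * t\<^sup>2 * D" by (simp add: D(2) power2_eq_square algebra_simps)
  finally have yy: "mink y y = m * t\<^sup>2 * D" .
  have xx: "mink (p + (1 / D) *\<^sub>R y) (p + (1 / D) *\<^sub>R y) = -1"
    using D(1) by (simp add: mink_simps pp yp yy)
  have xp: "mink (p + (1 / D) *\<^sub>R y) p < 0"
  proof -
    have "0 \<le> m * t\<^sup>2 / 2 / D" using m0 D(1) by simp
    then show ?thesis by (simp add: mink_simps pp yp)
  qed
  have "p + (1 / D) *\<^sub>R y \<in> hyp_plane" by (rule hyp_planeI[OF xx H xp])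
  then show ?thesis unfolding x cycle_def by (simp add: mink_simps pu yu)
qed

lemma tangent_vectors_cycle:
  assumes p: "p \<in> cycle u k" and u: "mink u u = 1 - k\<^sup>2"
  shows "tangent_vectors (cycle u k) p = {v. mink v p = 0 \<and> mink v u = 0}"
proof (intro equalityI subsetI)
  fix v assume "v \<in> tangent_vectors (cycle u k) p"
  then obtain \<gamma> where g: "\<And>s. \<gamma> s \<in> cycle u k" "\<gamma> 0 = p" "(\<gamma> has_vector_derivative v) (at 0)"
    by (auto simp: tangent_vectors_def)
  have "((\<lambda>s. mink (\<gamma> s) (\<gamma> s)) has_vector_derivative mink (\<gamma> 0) v + mink v (\<gamma> 0)) (at 0)"
    by (rule bounded_bilinear.has_vector_derivative[OF bounded_bilinear_mink g(3) g(3)])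
  moreover have "(\<lambda>s. mink (\<gamma> s) (\<gamma> s)) = (\<lambda>s. -1)" using g(1) by (auto simp: cycle_def hyp_planeD)
  ultimately have "((\<lambda>s::real. -1 :: real) has_vector_derivative mink p v + mink v p) (at 0)" using g(2) by simp
  then have "mink p v + mink v p = 0"
    by (rule vector_derivative_unique_at) (rule has_vector_derivative_const)
  moreover
  have "((\<lambda>s. mink (\<gamma> s) u) has_vector_derivative mink (\<gamma> 0) 0 + mink v u) (at 0)"
    by (rule bounded_bilinear.has_vector_derivative[OF bounded_bilinear_mink g(3) has_vector_derivative_const])
  moreover have "(\<lambda>s. mink (\<gamma> s) u) = (\<lambda>s. - k)" using g(1) by (auto simp: cycle_def)
  ultimately have "((\<lambda>s::real. -k) has_vector_derivative mink v u) (at 0)" "mink v p = 0"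
    using mink_sym[of p v] by (simp_all add: mink_simps)
  moreover from this(1) have "mink v u = 0"
    by (rule vector_derivative_unique_at) (rule has_vector_derivative_const)
  ultimately show "v \<in> {v. mink v p = 0 \<and> mink v u = 0}" by simp
next
  fix v assume "v \<in> {v. mink v p = 0 \<and> mink v u = 0}"
  then have v: "mink v p = 0" "mink v u = 0" by auto
  define m where "m = mink v v"
  have H: "p \<in> hyp_plane" using p by (auto simp: cycle_def)
  have m0: "0 \<le> m" unfolding m_def by (rule tangent_spacelike(1)[OF H v(1)])
  \<comment> \<open>\<open>tangent_vectors\<close> wants a curve defined for every real parameter,
    while the denominator of \<open>cycle_path\<close> may vanish for \<open>k < 1\<close>. The
    substitution \<open>s / (1 + m * s\<^sup>2)\<close> has derivative 1 at 0 and keeps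
    \<open>m\<close> times its square at most 1/4.\<close>
  have pos: "0 < 1 + (k\<^sup>2 - 1) * (m * (s / (1 + m * s\<^sup>2))\<^sup>2 / 4)" for s
  proof -
    have d: "0 < 1 + m * s\<^sup>2" using m0 by (simp add: add_pos_nonneg)
    have "0 \<le> (1 - m * s\<^sup>2)\<^sup>2" by simp
    then have "4 * (m * s\<^sup>2) \<le> (1 + m * s\<^sup>2)\<^sup>2" by (simp add: power2_eq_square algebra_simps)
    then have "m * s\<^sup>2 / (1 + m * s\<^sup>2)\<^sup>2 \<le> 1 / 4" using d
      by (subst divide_le_eq) auto
    then have b: "m * (s / (1 + m * s\<^sup>2))\<^sup>2 / 4 \<le> 1 / 16" by (simp add: power_divide ac_simps)
    have "0 \<le> m * (s / (1 + m * s\<^sup>2))\<^sup>2 / 4" using m0 by simp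
    then have "0 \<le> k\<^sup>2 * (m * (s / (1 + m * s\<^sup>2))\<^sup>2 / 4)" by (intro mult_nonneg_nonneg) auto
    with b show ?thesis unfolding left_diff_distrib mult_1 by linarith
  qed
  let ?t = "\<lambda>s. s / (1 + m * s\<^sup>2)"
  let ?\<gamma> = "\<lambda>s. cycle_path p u k v (?t s)"
  have mem: "?\<gamma> s \<in> cycle u k" for s
    by (rule cycle_path_mem[OF p u v]) (use pos[of s] in \<open>simp add: m_def\<close>)
  have t: "(?t has_real_derivative 1) (at 0)"
    by (auto intro!: derivative_eq_intros)
  have t': "(?t has_vector_derivative 1) (at 0)"
    using t by (simp add: has_real_derivative_iff_has_vector_derivative)
  have "(cycle_path p u k v has_vector_derivative v) (at 0)"
    unfolding cycle_path_def
    by (auto intro!: derivative_eq_intros simp: has_vector_derivative_def)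
  then have "((cycle_path p u k v \<circ> ?t) has_vector_derivative 1 *\<^sub>R v) (at 0)"
    by (intro vector_diff_chain_at) (use t' in auto)
  then have "(?\<gamma> has_vector_derivative v) (at 0)" by (simp add: o_def)
  moreover have "?\<gamma> 0 = p" by (simp add: cycle_path_def)
  ultimately show "v \<in> tangent_vectors (cycle u k) p"
    unfolding tangent_vectors_def using mem by (intro CollectI exI[of _ ?\<gamma>]) blast
qed

section \<open>Packings of a triangle\<close>

text \<open>Serves to exclude internal tangency. \<open>x\<close> lies on the geodesic from
  \<open>p\<close> in direction \<open>N\<close>, at the distance whose hyperbolic sine is
  \<open>e\<close>. One and the same \<open>x\<close> works for all \<open>k\<close> with
  \<open>k * e < 2\<close>, hence for two cycles with a common normal.\<close>

lemma cycle_push_inward: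
  assumes p: "p \<in> hyp_plane" and N: "mink N p = 0" "mink N N = 1" and e: "0 < e"
  shows "\<exists>x \<in> hyp_plane. \<forall>k. k * e < 2 \<longrightarrow> - k < mink x (k *\<^sub>R p + N)"
proof
  define x where "x = sqrt (1 + e\<^sup>2) *\<^sub>R p + e *\<^sub>R N"
  note pp = hyp_planeD(1)[OF p]
  have pN: "mink p N = 0" using N mink_sym by metis
  have xp: "mink x p = - sqrt (1 + e\<^sup>2)" by (simp add: x_def mink_simps pp N)
  have xN: "mink x N = e" by (simp add: x_def mink_simps pN N)
  have "mink x x = - (sqrt (1 + e\<^sup>2))\<^sup>2 + e\<^sup>2"
    by (subst x_def) (simp add: mink_simps x_def pp N pN power2_eq_square)
  then have xx: "mink x x = -1" by simp
  show "x \<in> hyp_plane" by (rule hyp_planeI[OF xx p]) (simp add: xp add_pos_nonneg)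
  show "\<forall>k. k * e < 2 \<longrightarrow> - k < mink x (k *\<^sub>R p + N)"
  proof (intro allI impI)
    fix k :: real assume k: "k * e < 2"
    have s1: "1 \<le> sqrt (1 + e\<^sup>2)" by simp
    have s2: "sqrt (1 + e\<^sup>2) \<le> 1 + e\<^sup>2 / 2"
      by (rule real_le_lsqrt) (use e in \<open>auto simp: power2_eq_square algebra_simps\<close>)
    have "k * (sqrt (1 + e\<^sup>2) - 1) < e"
    proof (cases "0 \<le> k")
      case True
      then have "k * (sqrt (1 + e\<^sup>2) - 1) \<le> k * (e\<^sup>2 / 2)" using s2 by (intro mult_left_mono) auto
      also have "\<dots> = (k * e) * e / 2" by (simp add: power2_eq_square)
      also have "\<dots> < 2 * e / 2" using k e by (intro divide_strict_right_mono mult_strict_right_mono) auto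
      finally show ?thesis by simp
    next
      case False
      then have "k * (sqrt (1 + e\<^sup>2) - 1) \<le> 0" using s1 by (intro mult_nonpos_nonneg) auto
      then show ?thesis using e by linarith
    qed
    then show "- k < mink x (k *\<^sub>R p + N)" by (simp add: mink_simps xp xN algebra_simps)
  qed
qed

text \<open>Equality case of Cauchy-Schwarz in the positive definite tangent plane at
  \<open>p\<close>.\<close>

lemma unit_tangent_unique:
  assumes p: "p \<in> hyp_plane" and "mink a p = 0" "mink a a = 1" "mink b p = 0" "mink b b = 1"
    and c: "(mink a b)\<^sup>2 = 1"
  shows "b = mink a b *\<^sub>R a"
proof -
  let ?v = "b - mink a b *\<^sub>R a"
  have "mink ?v ?v = 1 - (mink a b)\<^sup>2"
    using assms by (simp add: mink_simps mink_sym[of b a] power2_eq_square)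
  then have "mink ?v ?v = 0" using c by simp
  moreover have "mink ?v p = 0" using assms by (simp add: mink_simps)
  ultimately have "?v = 0" using tangent_spacelike(2)[OF p] by blast
  then show ?thesis by simp
qed

text \<open>Equal tangent lines make the unit normals at \<open>p\<close> equal or opposite. Equal
  normals would give the convex sides a common point; opposite ones give
  \<open>u1 + u2 = (k1 + k2) *\<^sub>R p\<close>, which also pins down the tangent point.\<close>

lemma externally_tangent_cycles:
  assumes v: "gcircle_valid c1" "gcircle_valid c2"
    and et: "externally_tangent c1 c2"
  defines "u1 \<equiv> cycle_vec c1" and "u2 \<equiv> cycle_vec c2"
    and "k1 \<equiv> geodesic_curvature c1" and "k2 \<equiv> geodesic_curvature c2"
  shows "mink u1 u2 = - 1 - k1 * k2"
    and "tangent_at ((1 / (k1 + k2)) *\<^sub>R (u1 + u2)) (curve c1) (curve c2)"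
proof -
  have k: "0 < k1" "0 < k2" using v by (auto simp: k1_def k2_def geodesic_curvature_pos)
  have uu: "mink u1 u1 = 1 - k1\<^sup>2" "mink u2 u2 = 1 - k2\<^sup>2"
    using v by (auto simp: u1_def u2_def k1_def k2_def mink_cycle_vec_self)
  have cv: "curve c1 = cycle u1 k1" "curve c2 = cycle u2 k2"
    using v by (auto simp: u1_def u2_def k1_def k2_def curve_eq_cycle)
  obtain p where ta: "tangent_at p (cycle u1 k1) (cycle u2 k2)"
    and dj: "convex_side c1 \<inter> convex_side c2 = {}"
    using et unfolding externally_tangent_def cv by blast
  have p: "p \<in> cycle u1 k1" "p \<in> cycle u2 k2"
    and tv: "tangent_vectors (cycle u1 k1) p = tangent_vectors (cycle u2 k2) p"
    using ta by (auto simp: tangent_at_def)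
  have H: "p \<in> hyp_plane" using p by (simp add: cycle_def)
  define N1 where "N1 = u1 - k1 *\<^sub>R p"
  define N2 where "N2 = u2 - k2 *\<^sub>R p"
  note n1 = cycle_normal[OF p(1) uu(1), folded N1_def]
  note n2 = cycle_normal[OF p(2) uu(2), folded N2_def]
  have u1: "u1 = k1 *\<^sub>R p + N1" and u2: "u2 = k2 *\<^sub>R p + N2" by (simp_all add: N1_def N2_def)
  define a where "a = mink N1 N2"
  have aa: "mink N2 N1 = a" unfolding a_def by (rule mink_sym)
  \<comment> \<open>\<open>?v\<close> is tangent to the first cycle, hence to the second, hence
    orthogonal to \<open>N2\<close>; this reads \<open>a\<^sup>2 = 1\<close>.\<close>
  let ?v = "N2 - a *\<^sub>R N1"
  have "mink ?v p = 0" by (simp add: mink_simps n1 n2)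
  moreover have "mink ?v u1 = 0" unfolding u1 by (simp add: mink_simps n1 n2 aa)
  ultimately have "?v \<in> tangent_vectors (cycle u2 k2) p"
    unfolding tv[symmetric] tangent_vectors_cycle[OF p(1) uu(1)] by simp
  then have "mink ?v u2 = 0" unfolding tangent_vectors_cycle[OF p(2) uu(2)] by simp
  then have "1 - a\<^sup>2 = 0" unfolding u2 by (simp add: mink_simps n1 n2 a_def power2_eq_square)
  then have a2: "a\<^sup>2 = 1" by simp
  have N21: "N2 = a *\<^sub>R N1"
    unfolding a_def by (rule unit_tangent_unique[OF H n1 n2]) (use a2 a_def in simp)
  have "a \<noteq> 1"
  proof
    assume "a = 1"
    then have e: "N2 = N1" using N21 by simp
    obtain x where x: "x \<in> hyp_plane" "\<And>k. k * (1 / (k1 + k2)) < 2 \<Longrightarrow> - k < mink x (k *\<^sub>R p + N1)"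
      using cycle_push_inward[OF H n1, of "1 / (k1 + k2)"] k by auto
    have "k1 * (1 / (k1 + k2)) < 2" "k2 * (1 / (k1 + k2)) < 2" using k by (auto simp: field_simps)
    then have "- k1 < mink x u1" "- k2 < mink x u2" unfolding u1 u2 e using x(2) by auto
    then have "x \<in> convex_side c1 \<inter> convex_side c2"
      using v x(1) by (simp add: convex_side_eq u1_def u2_def k1_def k2_def)
    then show False using dj by simp
  qed
  then have a: "a = -1" using a2 by (auto simp: power2_eq_1_iff)
  show "mink u1 u2 = - 1 - k1 * k2"
    unfolding u1 u2 using a aa n1 n2 hyp_planeD(1)[OF H]
    by (simp add: mink_simps a_def mink_sym[of p N2])
  have "u1 + u2 = (k1 + k2) *\<^sub>R p" unfolding u1 u2 N21 a by (simp add: scaleR_left_distrib)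
  then have "(1 / (k1 + k2)) *\<^sub>R (u1 + u2) = p" using k by simp
  then show "tangent_at ((1 / (k1 + k2)) *\<^sub>R (u1 + u2)) (curve c1) (curve c2)"
    using ta cv by simp
qed

text \<open>\<open>perpendicular\<close> is vacuous for disjoint curves, hence the common point
  \<open>p\<close>. Testing with the tangent vectors \<open>N - a *\<^sub>R M\<close> and
  \<open>M - a *\<^sub>R N\<close> gives \<open>a * (1 - a\<^sup>2) = 0\<close>. If
  \<open>a\<^sup>2 = 1\<close>, both vectors vanish, and the common tangent direction
  \<open>mink_cross p M\<close> is tested instead.\<close>

lemma perpendicular_cycles:
  assumes u: "mink u u = 1 - k\<^sup>2" "mink w w = 1 - h\<^sup>2"
    and p: "p \<in> cycle u k" "p \<in> cycle w h"
    and pe: "perpendicular (cycle w h) (cycle u k)"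
  shows "mink w u = - h * k"
proof -
  have H: "p \<in> hyp_plane" using p by (simp add: cycle_def)
  define N where "N = u - k *\<^sub>R p"
  define M where "M = w - h *\<^sub>R p"
  note n = cycle_normal[OF p(1) u(1), folded N_def]
  note m = cycle_normal[OF p(2) u(2), folded M_def]
  have uN: "u = k *\<^sub>R p + N" and wM: "w = h *\<^sub>R p + M" by (simp_all add: N_def M_def)
  define a where "a = mink M N"
  have aa: "mink N M = a" unfolding a_def by (rule mink_sym)
  have orth: "mink x y = 0" if "mink x p = 0" "mink x M = 0" "mink y p = 0" "mink y N = 0" for x y
  proof -
    have "mink x w = 0" "mink y u = 0" by (simp_all add: wM uN mink_simps that)
    then have "x \<in> tangent_vectors (cycle w h) p" "y \<in> tangent_vectors (cycle u k) p"
      unfolding tangent_vectors_cycle[OF p(2) u(2)] tangent_vectors_cycle[OF p(1) u(1)]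
      using that by auto
    then show ?thesis using pe p unfolding perpendicular_def by blast
  qed
  have "mink (N - a *\<^sub>R M) (M - a *\<^sub>R N) = 0"
    by (rule orth) (simp_all add: mink_simps n m aa a_def[symmetric])
  then have "a * (1 - a\<^sup>2) = 0"
    by (simp add: mink_simps n m aa a_def[symmetric] power2_eq_square algebra_simps)
  moreover have "a\<^sup>2 \<noteq> 1"
  proof
    assume a2: "a\<^sup>2 = 1"
    have MN: "N = a *\<^sub>R M"
      unfolding a_def by (rule unit_tangent_unique[OF H m n]) (use a2 a_def in simp)
    let ?e = "mink_cross p M"
    have e: "mink ?e p = 0" "mink ?e M = 0" by (rule mink_cross_orthogonal)+
    have "mink ?e ?e = 0" by (rule orth) (simp_all add: e MN mink_simps)
    moreover have "mink ?e ?e = 1"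
      using m hyp_planeD(1)[OF H] by (simp add: mink_cross_self mink_sym[of p M])
    ultimately show False by simp
  qed
  ultimately have "a = 0" by auto
  then show ?thesis unfolding uN wM using n m hyp_planeD(1)[OF H]
    by (simp add: mink_simps a_def mink_sym[of p N])
qed

text \<open>At a common point, \<open>p\<close>, \<open>M\<close>, \<open>N\<close> form an
  orthonormal frame, so a vector tangent to \<open>cycle w h\<close> is a multiple of
  \<open>N\<close>, the normal of the other curve.\<close>

lemma perpendicular_cyclesI:
  assumes u: "mink u u = 1 - k\<^sup>2" "mink w w = 1 - h\<^sup>2" and wu: "mink w u = - h * k"
  shows "perpendicular (cycle w h) (cycle u k)"
  unfolding perpendicular_def
proof (intro ballI)
  fix p x y
  assume "p \<in> cycle w h \<inter> cycle u k"
  then have p: "p \<in> cycle u k" "p \<in> cycle w h" by auto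
  assume "x \<in> tangent_vectors (cycle w h) p" "y \<in> tangent_vectors (cycle u k) p"
  then have x: "mink x p = 0" "mink x w = 0" and y: "mink y p = 0" "mink y u = 0"
    unfolding tangent_vectors_cycle[OF p(1) u(1)] tangent_vectors_cycle[OF p(2) u(2)] by auto
  define N where "N = u - k *\<^sub>R p"
  define M where "M = w - h *\<^sub>R p"
  note n = cycle_normal[OF p(1) u(1), folded N_def]
  note m = cycle_normal[OF p(2) u(2), folded M_def]
  have H: "mink p p = -1" and pu: "mink p u = -k" "mink w p = -h"
    using p by (auto simp: cycle_def hyp_planeD mink_sym[of w p])
  have MN: "mink M N = 0" by (simp add: M_def N_def mink_simps wu H pu)
  have xM: "mink x M = 0" and yN: "mink y N = 0" by (simp_all add: M_def N_def mink_simps x y)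
  have pM: "mink p M = 0" "mink p N = 0" using m n mink_sym by metis+
  have "x = - mink x p *\<^sub>R p + mink x M *\<^sub>R M + mink x N *\<^sub>R N"
    by (rule frame_expansion[OF H m(2) n(2) pM MN])
  then have "x = mink x N *\<^sub>R N" using x xM by simp
  moreover have "mink N y = 0" using yN mink_sym by metis
  ultimately show "mink x y = 0" by (metis mink_scaleR_left mult_zero_right real_scaleR_def)
qed

text \<open>This turns out to be the squared geodesic curvature of the dual circle, see \<open>triangle_sub_arc_length\<close>.\<close>

definition dual_sq :: "'v set \<Rightarrow> ('v \<Rightarrow> real) \<Rightarrow> real" where
  "dual_sq U k = 1 + ((\<Sum>v\<in>U. k v)\<^sup>2 - (\<Sum>v\<in>U. (k v)\<^sup>2)) / 2"

lemma dual_sq_triple: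
  assumes "a \<noteq> b" "a \<noteq> c" "b \<noteq> c"
  shows "dual_sq {a, b, c} k = 1 + k a * k b + k a * k c + k b * k c"
  using assms by (simp add: dual_sq_def power2_eq_square algebra_simps)

text \<open>
  The dual circle is centered at \<open>(0, 1)\<close>.  Perpendicularity to it then determines the heights of
  the vectors \<open>ua\<close>, \<open>ub\<close>, \<open>uc\<close>, and their complex parts are found by placing the first one on
  the real axis.
\<close>

lemma triangle_existence:
  assumes U: "card U = 3" and k: "\<And>v. v \<in> U \<Longrightarrow> 0 < k v"
  shows "\<exists>C D. triangle_packing U k C D"
proof -
  obtain a b c where Ue: "U = {a, b, c}" and ne: "a \<noteq> b" "a \<noteq> c" "b \<noteq> c"
    using U by (auto simp: card_Suc_eq numeral_3_eq_3)
  define x where "x = k a" define y where "y = k b" define z where "z = k c"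
  have pos: "0 < x" "0 < y" "0 < z" using k Ue by (auto simp: x_def y_def z_def)
  define s where "s = x * y + x * z + y * z"
  have s: "0 < s" using pos by (simp add: s_def add_pos_pos)
  \<comment> \<open>\<open>s\<close> is the squared curvature of the dual circle minus 1. With the
    dual vector \<open>w = (0, sqrt s)\<close>, perpendicularity forces the heights to be
    \<open>h\<close> times the curvatures; \<open>r\<close> then solves
    \<open>mink ua ua = 1 - x\<^sup>2\<close>, and the tangency equations with \<open>ua\<close> fix
    the real parts of \<open>ub\<close> and \<open>uc\<close>.\<close>
  define h where "h = sqrt ((1 + s) / s)"
  have h: "0 < h" "h * h = (1 + s) / s" using s by (auto simp: h_def)
  define r where "r = sqrt ((x + y) * (x + z) / s)"
  have r: "0 < r" "r * r = (x + y) * (x + z) / s" using s pos by (auto simp: r_def)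
  define q where "q = sqrt ((x + y) / (x + z))"
  have q: "0 < q" "q * q = (x + y) / (x + z)" using pos by (auto simp: q_def)
  define ua where "ua = (Complex r 0, x * h)"
  define ub where "ub = (Complex (- (z * (x + y)) / (s * r)) q, y * h)"
  define uc where "uc = (Complex (- (y * (x + z)) / (s * r)) (- 1 / q), z * h)"
  have rr: "r \<noteq> 0" "q \<noteq> 0" "s \<noteq> 0" "x + y \<noteq> 0" "x + z \<noteq> 0" using r q s pos by auto
  have R: "r\<^sup>2 = (x + y) * (x + z) / s" and Q: "q\<^sup>2 = (x + y) / (x + z)" and Hh: "h\<^sup>2 = (1 + s) / s"
    using r q h by (auto simp: power2_eq_square)
  have aa: "mink ua ua = 1 - x\<^sup>2"
  proof -
    have "mink ua ua = r\<^sup>2 - x\<^sup>2 * h\<^sup>2" by (simp add: ua_def mink_coords power2_eq_square)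
    also have "\<dots> = 1 - x\<^sup>2" unfolding R Hh using rr by (simp add: field_simps) (simp add: s_def power2_eq_square algebra_simps)
    finally show ?thesis .
  qed
  have bb: "mink ub ub = 1 - y\<^sup>2"
  proof -
    have "mink ub ub = z\<^sup>2 * (x + y)\<^sup>2 / (s\<^sup>2 * r\<^sup>2) + q\<^sup>2 - y\<^sup>2 * h\<^sup>2"
      by (simp add: ub_def mink_coords power2_eq_square ac_simps)
    also have "\<dots> = z\<^sup>2 * (x + y) / (s * (x + z)) + (x + y) / (x + z) - y\<^sup>2 * ((1 + s) / s)"
      unfolding R Q Hh using rr by (simp add: power2_eq_square)
    also have "\<dots> = (x + y) * (z\<^sup>2 + s) / (s * (x + z)) - y\<^sup>2 * ((1 + s) / s)"
      using rr by (simp add: distrib_left[of "x + y"] distrib_left[of "x + z"] add_divide_distrib mult.commute[of s])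
    also have "\<dots> = (x + y) * (y + z) / s - y\<^sup>2 * ((1 + s) / s)"
    proof -
      have "z\<^sup>2 + s = (x + z) * (y + z)" by (simp add: s_def power2_eq_square algebra_simps)
      then show ?thesis using rr by simp
    qed
    also have "\<dots> = (y\<^sup>2 + s) / s - y\<^sup>2 * ((1 + s) / s)"
      by (simp add: s_def power2_eq_square algebra_simps)
    also have "\<dots> = 1 - y\<^sup>2" using rr by (simp add: field_simps)
    finally show ?thesis .
  qed
  have cc: "mink uc uc = 1 - z\<^sup>2"
  proof -
    have "mink uc uc = y\<^sup>2 * (x + z)\<^sup>2 / (s\<^sup>2 * r\<^sup>2) + 1 / q\<^sup>2 - z\<^sup>2 * h\<^sup>2"
      by (simp add: uc_def mink_coords power2_eq_square ac_simps)
    also have "\<dots> = y\<^sup>2 * (x + z) / (s * (x + y)) + (x + z) / (x + y) - z\<^sup>2 * ((1 + s) / s)"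
      unfolding R Q Hh using rr by (simp add: power2_eq_square)
    also have "\<dots> = (x + z) * (y\<^sup>2 + s) / (s * (x + y)) - z\<^sup>2 * ((1 + s) / s)"
      using rr by (simp add: distrib_left[of "x + y"] distrib_left[of "x + z"] add_divide_distrib mult.commute[of s])
    also have "\<dots> = (x + z) * (y + z) / s - z\<^sup>2 * ((1 + s) / s)"
    proof -
      have "y\<^sup>2 + s = (x + y) * (y + z)" by (simp add: s_def power2_eq_square algebra_simps)
      then show ?thesis using rr by simp
    qed
    also have "\<dots> = (z\<^sup>2 + s) / s - z\<^sup>2 * ((1 + s) / s)"
      by (simp add: s_def power2_eq_square algebra_simps)
    also have "\<dots> = 1 - z\<^sup>2" using rr by (simp add: field_simps)
    finally show ?thesis .
  qed
  have ab: "mink ua ub = - 1 - x * y"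
  proof -
    have "mink ua ub = - (z * (x + y)) / s - x * y * h\<^sup>2"
      using rr by (simp add: ua_def ub_def mink_coords power2_eq_square)
    also have "\<dots> = - 1 - x * y" unfolding Hh using rr by (simp add: field_simps) (simp add: s_def algebra_simps)
    finally show ?thesis .
  qed
  have ac: "mink ua uc = - 1 - x * z"
  proof -
    have "mink ua uc = - (y * (x + z)) / s - x * z * h\<^sup>2"
      using rr by (simp add: ua_def uc_def mink_coords power2_eq_square)
    also have "\<dots> = - 1 - x * z" unfolding Hh using rr by (simp add: field_simps) (simp add: s_def algebra_simps)
    finally show ?thesis .
  qed
  have bc: "mink ub uc = - 1 - y * z"
  proof -
    have "mink ub uc = z * y * ((x + y) * (x + z)) / (s\<^sup>2 * r\<^sup>2) - 1 - y * z * h\<^sup>2"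
      using rr by (simp add: ub_def uc_def mink_coords power2_eq_square ac_simps)
    also have "\<dots> = z * y / s - 1 - y * z * ((1 + s) / s)" unfolding R Hh using rr
      by (simp add: power2_eq_square)
    also have "\<dots> = - 1 - y * z" using rr by (simp add: field_simps)
    finally show ?thesis .
  qed
  define u where "u = (\<lambda>v. if v = a then ua else if v = b then ub else uc)"
  have uu: "mink (u v) (u v) = 1 - (k v)\<^sup>2" if "v \<in> U" for v
    using that aa bb cc ne unfolding Ue u_def x_def y_def z_def by auto
  have us: "0 < snd (u v)" "snd (u v) = k v * h" if "v \<in> U" for v
    using that pos h ne unfolding Ue u_def x_def y_def z_def by (auto simp: ua_def ub_def uc_def x_def y_def z_def)
  have uv: "mink (u v) (u w) = - 1 - k v * k w" if "v \<in> U" "w \<in> U" "v \<noteq> w" for v w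
    using that ab ac bc ne mink_sym[of ub ua] mink_sym[of uc ua] mink_sym[of uc ub]
    unfolding Ue u_def x_def y_def z_def by (auto simp: mult.commute)
  have "\<exists>c. gcircle_valid c \<and> geodesic_curvature c = k v \<and> cycle_vec c = u v" if "v \<in> U" for v
    using gcircle_of_cycle_vec[OF k[OF that] uu[OF that] us(1)[OF that]] by metis
  then obtain C where C: "\<And>v. v \<in> U \<Longrightarrow> gcircle_valid (C v)"
    "\<And>v. v \<in> U \<Longrightarrow> geodesic_curvature (C v) = k v" "\<And>v. v \<in> U \<Longrightarrow> cycle_vec (C v) = u v"
    by metis
  define w where "w = (0 :: complex, sqrt s)"
  define \<kappa> where "\<kappa> = sqrt (1 + s)"
  have \<kappa>: "1 < \<kappa>" "\<kappa>\<^sup>2 = 1 + s" using s by (auto simp: \<kappa>_def)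
  have sh: "sqrt s * h = \<kappa>" unfolding h_def \<kappa>_def using s by (simp flip: real_sqrt_mult)
  have ww: "mink w w = 1 - \<kappa>\<^sup>2" using s \<kappa> by (simp add: w_def mink_def)
  have wu: "mink w (u v) = - \<kappa> * k v" if "v \<in> U" for v
    using us(2)[OF that] sh by (simp add: w_def mink_def)
  obtain D where D: "gcircle_valid D" "geodesic_curvature D = \<kappa>" "cycle_vec D = w" "\<exists>p r. D = Circle p r"
    using gcircle_of_cycle_vec[of \<kappa> w] \<kappa> ww s by (metis less_trans real_sqrt_gt_0_iff snd_conv w_def zero_less_one)
  have cv: "curve (C v) = cycle (u v) (k v)" if "v \<in> U" for v
    using curve_eq_cycle[OF C(1)[OF that]] C(2,3)[OF that] by simp
  have cD: "curve D = cycle w \<kappa>" using curve_eq_cycle[OF D(1)] D by simp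
  have pt: "\<exists>p. p \<in> hyp_plane \<and> u i + u j = (k i + k j) *\<^sub>R p" if "i \<in> U" "j \<in> U" "i \<noteq> j" for i j
  proof (intro exI conjI)
    let ?p = "(1 / (k i + k j)) *\<^sub>R (u i + u j)"
    have kk: "0 < k i" "0 < k j" using k that by auto
    show eq: "u i + u j = (k i + k j) *\<^sub>R ?p" using kk by simp
    have "mink (u i + u j) (u i + u j) = - ((k i + k j) * (k i + k j))"
      using uv[OF that] uu[OF that(1)] uu[OF that(2)] mink_sym[of "u j" "u i"]
      by (simp add: mink_simps power2_eq_square algebra_simps)
    moreover have "mink ?p ?p = (1 / (k i + k j)) * ((1 / (k i + k j)) * mink (u i + u j) (u i + u j))"
      unfolding mink_scaleR_left mink_scaleR_right real_scaleR_def ..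
    moreover have "(1 / m) * ((1 / m) * - (m * m)) = -1" if "0 < m" for m :: real using that by simp
    note this[OF add_pos_pos[OF kk]]
    ultimately have "mink ?p ?p = -1" by (simp only:)
    moreover have "0 < snd ?p" using kk us that by (simp add: add_pos_pos)
    ultimately show "?p \<in> hyp_plane" by (simp add: hyp_plane_def)
  qed
  have ta: "p \<in> curve D \<and> tangent_at p (curve (C i)) (curve (C j))"
    if ij: "i \<in> U" "j \<in> U" "i \<noteq> j" and p: "p \<in> hyp_plane" "u i + u j = (k i + k j) *\<^sub>R p" for i j p
  proof
    have kk: "0 < k i" "0 < k j" using k ij by auto
    have cancel: "a = b" if "(k i + k j) * a = (k i + k j) * b" for a b
      using that add_pos_pos[OF kk] by (metis mult_cancel_left less_irrefl)
    have "(k i + k j) * mink p w = mink (u i + u j) w" using p by (simp add: mink_simps)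
    also have "\<dots> = (k i + k j) * (- \<kappa>)"
      using wu ij by (simp add: mink_simps mink_sym[of _ w] algebra_simps)
    finally have "mink p w = - \<kappa>" by (rule cancel)
    then show "p \<in> curve D" using p by (simp add: cD cycle_def)
    have "(k i + k j) * mink p (u i) = mink (u i + u j) (u i)" using p by (simp add: mink_simps)
    also have "\<dots> = (k i + k j) * (- k i)"
      using uv[OF ij] uu[OF ij(1)] by (simp add: mink_simps mink_sym[of "u j"] power2_eq_square algebra_simps)
    finally have "mink p (u i) = - k i" by (rule cancel)
    then have pi: "p \<in> cycle (u i) (k i)" using p by (simp add: cycle_def)
    have "(k i + k j) * mink p (u j) = mink (u i + u j) (u j)" using p by (simp add: mink_simps)
    also have "\<dots> = (k i + k j) * (- k j)"
      using uv[OF ij] uu[OF ij(2)] by (simp add: mink_simps power2_eq_square algebra_simps)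
    finally have "mink p (u j) = - k j" by (rule cancel)
    then have pj: "p \<in> cycle (u j) (k j)" using p by (simp add: cycle_def)
    have "mink v (u i) = 0 \<longleftrightarrow> mink v (u j) = 0" if "mink v p = 0" for v
    proof -
      have "mink v (u i) + mink v (u j) = 0"
        using arg_cong[OF p(2), of "mink v"] that by (simp add: mink_simps)
      then show ?thesis by linarith
    qed
    then have "{v. mink v p = 0 \<and> mink v (u i) = 0} = {v. mink v p = 0 \<and> mink v (u j) = 0}" by blast
    then show "tangent_at p (curve (C i)) (curve (C j))"
      unfolding tangent_at_def cv[OF ij(1)] cv[OF ij(2)]
        tangent_vectors_cycle[OF pi uu[OF ij(1)]] tangent_vectors_cycle[OF pj uu[OF ij(2)]]
      using pi pj by blast
  qed
  \<comment> \<open>For a common point, adding the two inequalities and using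
    \<open>u i + u j = (k i + k j) *\<^sub>R p\<close> would push its product with the tangent point
    \<open>p\<close> above \<open>-1\<close>, which is impossible on the sheet.\<close>
  have dj: "convex_side (C i) \<inter> convex_side (C j) = {}" if ij: "i \<in> U" "j \<in> U" "i \<noteq> j" for i j
  proof -
    obtain p where p: "p \<in> hyp_plane" "u i + u j = (k i + k j) *\<^sub>R p" using pt[OF ij] by blast
    have kk: "0 < k i" "0 < k j" using k ij by auto
    have False if "x \<in> convex_side (C i)" "x \<in> convex_side (C j)" for x
    proof -
      have x: "x \<in> hyp_plane" "- k i < mink x (u i)" "- k j < mink x (u j)"
        using that ij C by (auto simp: convex_side_eq)
      have "(k i + k j) * mink x p = mink x (u i) + mink x (u j)"
        using arg_cong[OF p(2), of "mink x"] by (simp add: mink_simps)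
      also have "\<dots> > (k i + k j) * (-1)" using x by simp
      finally have "-1 < mink x p" using kk by (simp only: mult_less_cancel_left_pos add_pos_pos)
      then show False using mink_hyp_plane_le[OF x(1) p(1)] by simp
    qed
    then show ?thesis by blast
  qed
  \<comment> \<open>\<open>triangle_packing\<close> speaks of every tangent point of two circles, so
    the point supplied by \<open>pt\<close> has to be the only one.\<close>
  have uniq: "q' = p" if ij: "i \<in> U" "j \<in> U" "i \<noteq> j" and p: "p \<in> hyp_plane" "u i + u j = (k i + k j) *\<^sub>R p"
    and q': "tangent_at q' (curve (C i)) (curve (C j))" for i j p q'
  proof -
    have kk: "0 < k i" "0 < k j" using k ij by auto
    have q: "q' \<in> hyp_plane" "mink q' (u i) = - k i" "mink q' (u j) = - k j"
      using q' cv ij by (auto simp: tangent_at_def cycle_def)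
    have "(k i + k j) * mink q' p = (k i + k j) * (-1)"
      using arg_cong[OF p(2), of "mink q'"] q by (simp add: mink_simps)
    then have "mink q' p = -1" using add_pos_pos[OF kk] by (metis mult_cancel_left less_irrefl)
    then show ?thesis using mink_hyp_plane_eq q p by blast
  qed
  have "triangle_packing U k C D"
    unfolding triangle_packing_def
  proof (intro conjI ballI impI allI)
    fix i assume i: "i \<in> U"
    show "gcircle_valid (C i)" "geodesic_curvature (C i) = k i" using C i by auto
    show "perpendicular (curve D) (curve (C i))"
      unfolding cD cv[OF i] by (rule perpendicular_cyclesI[OF uu[OF i] ww wu[OF i]])
    fix j assume j: "j \<in> U" "i \<noteq> j"
    obtain p where p: "p \<in> hyp_plane" "u i + u j = (k i + k j) *\<^sub>R p" using pt[OF i j] by blast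
    note tap = ta[OF i j p]
    show "externally_tangent (C i) (C j)" unfolding externally_tangent_def using tap dj[OF i j] by blast
    fix q' assume "tangent_at q' (curve (C i)) (curve (C j))"
    then have "q' = p" by (rule uniq[OF i j p])
    then show "q' \<in> curve D" using tap by blast
  qed (use D in auto)
  then show ?thesis by blast
qed

section \<open>Lengths of the sub-arcs\<close>

lemma mono_has_real_derivative_nonneg:
  fixes g :: "real \<Rightarrow> real"
  assumes m: "\<And>x y. x \<in> {a..b} \<Longrightarrow> y \<in> {a..b} \<Longrightarrow> x \<le> y \<Longrightarrow> g x \<le> g y"
    and d: "(g has_real_derivative D) (at s within {a..b})" and s: "s \<in> {a..b}" "a < b"
  shows "0 \<le> D"
proof (rule tendsto_lowerbound)
  show "((\<lambda>y. (g y - g s) / (y - s)) \<longlongrightarrow> D) (at s within {a..b})"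
    using d unfolding has_field_derivative_iff .
  have "0 \<le> (g y - g s) / (y - s)" if "y \<in> {a..b}" for y
    using m[of y s] m[of s y] s that by (cases "y \<le> s") (auto simp: divide_nonpos_nonpos)
  then show "\<forall>\<^sub>F y in at s within {a..b}. 0 \<le> (g y - g s) / (y - s)"
    by (auto simp: eventually_at_filter)
  show "at s within {a..b} \<noteq> bot"
    using s by (simp add: trivial_limit_within)
qed

text \<open>
  The inverse \<open>\<phi>\<close> of one regular parametrization \<open>X\<close> turns any other injective parametrization
  into a monotone change of parameter, so that all have the same length.
\<close>

lemma hlength_eq:
  fixes X X' :: "real \<Rightarrow> minkowski" and \<phi> :: "minkowski \<Rightarrow> real"
  assumes X: "\<And>\<tau>. \<tau> \<in> {0..1} \<Longrightarrow> (X has_vector_derivative X' \<tau>) (at \<tau>)"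
    and X': "continuous_on {0..1} X'"
    and \<phi>X: "\<And>\<tau>. \<tau> \<in> {0..1} \<Longrightarrow> \<phi> (X \<tau>) = \<tau>"
    and \<phi>: "\<And>\<tau>. \<tau> \<in> {0..1} \<Longrightarrow> \<phi> differentiable (at (X \<tau>))"
    and speed: "\<And>\<tau>. \<tau> \<in> {0..1} \<Longrightarrow> sqrt (mink (X' \<tau>) (X' \<tau>)) = \<nu> \<tau>"
    and \<nu>: "continuous_on {0..1} \<nu>"
  shows "hlength (X ` {0..1}) = integral {0..1} \<nu>"
  unfolding hlength_def
proof (rule the_equality)
  have injX: "inj_on X {0..1}" by (rule inj_on_inverseI[of _ \<phi>]) (rule \<phi>X)
  have vd: "vector_derivative X (at \<tau>) = X' \<tau>" if "\<tau> \<in> {0..1}" for \<tau>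
    by (rule vector_derivative_at[OF X[OF that]])
  show "has_hlength (X ` {0..1}) (integral {0..1} \<nu>)"
    unfolding has_hlength_def
  proof (intro exI conjI)
    show "X C1_differentiable_on {0..1}" unfolding C1_differentiable_on_def using X X' by blast
    show "integral {0..1} \<nu> = integral {0..1}
      (\<lambda>s. sqrt (mink (vector_derivative X (at s)) (vector_derivative X (at s))))"
      by (rule integral_cong) (simp add: vd speed)
  qed (use injX in auto)
  fix l assume "has_hlength (X ` {0..1}) l"
  then obtain \<gamma> where C1: "\<gamma> C1_differentiable_on {0..1}" and inj: "inj_on \<gamma> {0..1}"
    and im: "\<gamma> ` {0..1} = X ` {0..1}"
    and l: "l = integral {0..1} (\<lambda>s. sqrt (mink (vector_derivative \<gamma> (at s)) (vector_derivative \<gamma> (at s))))"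
    unfolding has_hlength_def by blast
  obtain \<gamma>' where g': "\<And>s. s \<in> {0..1} \<Longrightarrow> (\<gamma> has_vector_derivative \<gamma>' s) (at s)"
    using C1 unfolding C1_differentiable_on_def by blast
  \<comment> \<open>\<open>g\<close> is the change of parameter from \<open>\<gamma>\<close> to
    \<open>X\<close>; it inherits differentiability from \<open>\<phi>\<close>.\<close>
  define g where "g = (\<lambda>s. \<phi> (\<gamma> s))"
  have gmem: "g s \<in> {0..1} \<and> X (g s) = \<gamma> s" if s: "s \<in> {0..1}" for s
  proof -
    have "\<gamma> s \<in> X ` {0..1}" using im s by blast
    then show ?thesis unfolding g_def using \<phi>X by auto
  qed
  have gim: "g ` {0..1} = {0..1}"
  proof -
    have "\<phi> ` (\<gamma> ` {0..1}) = \<phi> ` X ` {0..1}" unfolding im ..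
    also have "\<dots> = {0..1}" using \<phi>X by force
    finally show ?thesis by (simp add: g_def image_image)
  qed
  have ginj: "inj_on g {0..1}"
    by (rule inj_onI) (metis gmem inj inj_onD)
  have "\<exists>D. (g has_real_derivative D) (at s)" if s: "s \<in> {0..1}" for s
  proof -
    have "\<phi> differentiable (at (\<gamma> s))" using \<phi>[of "g s"] gmem[OF s] by simp
    then obtain F where F: "(\<phi> has_derivative F) (at (\<gamma> s))" unfolding differentiable_def by blast
    have "((\<phi> \<circ> \<gamma>) has_derivative (F \<circ> (\<lambda>x. x *\<^sub>R \<gamma>' s))) (at s)"
      by (rule diff_chain_at) (use g'[OF s] F in \<open>auto simp: has_vector_derivative_def\<close>)
    then have "g differentiable (at s)" unfolding g_def o_def differentiable_def by blast
    then show ?thesis by (auto simp: real_differentiable_def)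
  qed
  then obtain g1 where g1: "\<And>s. s \<in> {0..1} \<Longrightarrow> (g has_real_derivative g1 s) (at s)" by metis
  have gcont: "continuous_on {0..1} g"
    by (rule continuous_at_imp_continuous_on) (use g1 DERIV_isCont in blast)
  have gamma': "\<gamma>' s = g1 s *\<^sub>R X' (g s)" if s: "s \<in> {0..1}" for s
  proof -
    have "((X \<circ> g) has_vector_derivative (g1 s *\<^sub>R X' (g s))) (at s)"
      by (rule vector_diff_chain_at)
        (use g1[OF s] X gmem[OF s] in \<open>auto simp: has_real_derivative_iff_has_vector_derivative\<close>)
    then have "((X \<circ> g) has_vector_derivative (g1 s *\<^sub>R X' (g s))) (at s within {0..1})"
      by (rule has_vector_derivative_at_within)
    then have "(\<gamma> has_vector_derivative (g1 s *\<^sub>R X' (g s))) (at s within {0..1})"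
      by (rule has_vector_derivative_transform[rotated 2]) (use gmem s in auto)
    moreover have "(\<gamma> has_vector_derivative \<gamma>' s) (at s within {0..1})"
      using g'[OF s] by (rule has_vector_derivative_at_within)
    ultimately show ?thesis
      using s by (intro vector_derivative_unique_within[of s "{0..1}"]) (auto simp: trivial_limit_within)
  qed
  have lg: "l = integral {0..1} (\<lambda>s. \<bar>g1 s\<bar> * \<nu> (g s))"
    unfolding l
  proof (rule integral_cong)
    fix s :: real assume s: "s \<in> {0..1}"
    have "vector_derivative \<gamma> (at s) = g1 s *\<^sub>R X' (g s)"
      using vector_derivative_at[OF g'[OF s]] gamma'[OF s] by simp
    then show "sqrt (mink (vector_derivative \<gamma> (at s)) (vector_derivative \<gamma> (at s))) = \<bar>g1 s\<bar> * \<nu> (g s)"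
      using speed[of "g s"] gmem[OF s] by (simp add: mink_simps real_sqrt_mult)
  qed
  \<comment> \<open>\<open>N (g s)\<close> is an antiderivative of the signed integrand, so the
    substitution needs pointwise derivatives only. Monotonicity of \<open>g\<close> then decides the
    sign in \<open>\<bar>g1 s\<bar>\<close>.\<close>
  define N where "N = (\<lambda>\<tau>. integral {0..\<tau>} \<nu>)"
  have N: "(N has_real_derivative \<nu> \<tau>) (at \<tau> within {0..1})" if "\<tau> \<in> {0..1}" for \<tau>
    unfolding N_def by (rule integral_has_real_derivative[OF \<nu> that])
  have Ng: "((\<lambda>s. N (g s)) has_real_derivative (\<nu> (g s) * g1 s)) (at s within {0..1})" if s: "s \<in> {0..1}" for s
  proof -
    have "((N \<circ> g) has_real_derivative (\<nu> (g s) * g1 s)) (at s within {0..1})"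
    proof (rule DERIV_image_chain)
      show "(N has_real_derivative \<nu> (g s)) (at (g s) within g ` {0..1})"
        unfolding gim using N gmem[OF s] by blast
      show "(g has_real_derivative g1 s) (at s within {0..1})"
        using g1[OF s] by (rule has_field_derivative_at_within)
    qed
    then show ?thesis by (simp add: o_def)
  qed
  have int: "((\<lambda>s. \<nu> (g s) * g1 s) has_integral (N (g 1) - N (g 0))) {0..1}"
    by (rule fundamental_theorem_of_calculus)
      (use Ng in \<open>auto simp: has_real_derivative_iff_has_vector_derivative\<close>)
  have g01: "g 0 \<in> {0..1}" "g 1 \<in> {0..1}" using gmem by auto
  have "strict_mono_on {0..1} g \<or> strict_antimono_on {0..1} g"
    using injective_eq_monotone_map[of "{0..1}" g] gcont ginj by (simp add: is_interval_cc)
  then show "l = integral {0..1} \<nu>"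
  proof
    assume "strict_mono_on {0..1} g"
    then have m: "g x \<le> g y" if "x \<in> {0..1}" "y \<in> {0..1}" "x \<le> y" for x y
      using that unfolding strict_mono_on_def monotone_on_def by (metis order.order_iff_strict)
    have p: "0 \<le> g1 s" if s: "s \<in> {0..1}" for s
      by (rule mono_has_real_derivative_nonneg[OF m has_field_derivative_at_within[OF g1[OF s]] s]) auto
    have "0 \<in> g ` {0..1}" "1 \<in> g ` {0..1}" unfolding gim by auto
    then obtain x y where "x \<in> {0..1}" "g x = 0" "y \<in> {0..1}" "g y = 1" by (metis imageE)
    then have "g 0 = 0" "g 1 = 1" using m[of 0 x] m[of y 1] g01 by auto
    then have "((\<lambda>s. \<nu> (g s) * g1 s) has_integral integral {0..1} \<nu>) {0..1}" using int by (simp add: N_def)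
    then have "((\<lambda>s. \<bar>g1 s\<bar> * \<nu> (g s)) has_integral integral {0..1} \<nu>) {0..1}"
      by (rule has_integral_eq[rotated]) (use p in \<open>simp add: mult.commute\<close>)
    then show ?thesis unfolding lg by (rule integral_unique)
  next
    assume "strict_antimono_on {0..1} g"
    then have m: "g y \<le> g x" if "x \<in> {0..1}" "y \<in> {0..1}" "x \<le> y" for x y
      using that unfolding monotone_on_def by (metis order.order_iff_strict)
    have p: "0 \<le> - g1 s" if s: "s \<in> {0..1}" for s
      by (rule mono_has_real_derivative_nonneg[of 0 1 "\<lambda>s. - g s" _ s])
        (use m s in \<open>auto intro!: derivative_eq_intros has_field_derivative_at_within[OF g1[OF s]]\<close>)
    have "1 \<in> g ` {0..1}" "0 \<in> g ` {0..1}" unfolding gim by auto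
    then obtain x y where "x \<in> {0..1}" "g x = 1" "y \<in> {0..1}" "g y = 0" by (metis imageE)
    then have "g 0 = 1" "g 1 = 0" using m[of 0 x] m[of y 1] g01 by auto
    then have "((\<lambda>s. \<nu> (g s) * g1 s) has_integral - integral {0..1} \<nu>) {0..1}" using int by (simp add: N_def)
    then have "((\<lambda>s. - (\<nu> (g s) * g1 s)) has_integral - (- integral {0..1} \<nu>)) {0..1}" by (rule has_integral_neg)
    then have "((\<lambda>s. \<bar>g1 s\<bar> * \<nu> (g s)) has_integral integral {0..1} \<nu>) {0..1}"
      unfolding minus_minus by (rule has_integral_eq[rotated]) (use p in \<open>simp add: mult.commute\<close>)
    then show ?thesis unfolding lg by (rule integral_unique)
  qed
qed

text \<open>For \<open>m = 0\<close>, \<open>n = 1\<close> this is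
  \<open>arctan (sqrt c) / sqrt c\<close>, continued analytically through \<open>c = 0\<close> to
  all \<open>c > -1\<close>. The exponents make the family closed under differentiation in
  \<open>c\<close>.\<close>

definition arc_integral :: "nat \<Rightarrow> nat \<Rightarrow> real \<Rightarrow> real" where
  "arc_integral m n c = integral {0..1} (\<lambda>\<tau>. \<tau> ^ m / (1 + c * \<tau>\<^sup>2) ^ n)"

lemma arc_denominator_pos:
  assumes "-1 < c" "\<tau> \<in> {0..1::real}"
  shows "0 < 1 + c * \<tau>\<^sup>2"
proof -
  have t: "0 \<le> \<tau>\<^sup>2" "\<tau>\<^sup>2 \<le> 1" using assms by (auto simp: power_le_one)
  show ?thesis
  proof (cases "\<tau> = 0")
    case False
    then have "-1 * \<tau>\<^sup>2 < c * \<tau>\<^sup>2" using assms by (intro mult_strict_right_mono) auto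
    then show ?thesis using t by linarith
  qed simp
qed

text \<open>\<open>X\<close> is \<open>cycle_path\<close> with initial velocity along
  \<open>M\<close>, the inward normal of the dual circle at \<open>p\<close>, and with the parameter
  scaled so that \<open>\<tau> = 1\<close> is the second point on the dual circle. Its speed is
  rational because \<open>(1 - c * \<tau>\<^sup>2)\<^sup>2 + 4 * c * \<tau>\<^sup>2\<close> is a
  perfect square. The last two claims locate the far end of the arc, from which
  \<open>\<kappa>\<close> is later determined.\<close>

lemma hlength_cycle_arc:
  assumes p: "p \<in> cycle u k" "p \<in> cycle w \<kappa>"
    and u: "mink u u = 1 - k\<^sup>2" and w: "mink w w = 1 - \<kappa>\<^sup>2" and wu: "mink w u = - \<kappa> * k"
    and \<kappa>: "1 < \<kappa>"
  defines "w1 \<equiv> (1 - k\<^sup>2) *\<^sub>R p + k *\<^sub>R u" and "M \<equiv> w - \<kappa> *\<^sub>R p" and "c \<equiv> (k\<^sup>2 - 1) / \<kappa>\<^sup>2"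
  defines "X \<equiv> \<lambda>\<tau>. p + (1 / (1 + c * \<tau>\<^sup>2)) *\<^sub>R ((2 * \<tau> / \<kappa>) *\<^sub>R M + (2 * \<tau>\<^sup>2 / \<kappa>\<^sup>2) *\<^sub>R w1)"
  shows "{x \<in> cycle u k. - \<kappa> \<le> mink x w} = X ` {0..1}"
    and "hlength (X ` {0..1}) = 2 / \<kappa> * arc_integral 0 1 c"
    and "\<And>x. x \<in> cycle u k \<Longrightarrow> mink x w = - \<kappa> \<Longrightarrow> x = p \<or> x = X 1"
    and "mink (X 1) p = -1 - 2 / (\<kappa>\<^sup>2 + k\<^sup>2 - 1)"
proof -
  have H: "p \<in> hyp_plane" and pu: "mink p u = - k" "mink u p = -k" and pw: "mink p w = - \<kappa>" "mink w p = - \<kappa>"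
    using p by (auto simp: cycle_def mink_sym[of u p] mink_sym[of w p])
  note pp = hyp_planeD(1)[OF H]
  define N where "N = u - k *\<^sub>R p"
  note n = cycle_normal[OF p(1) u(1), folded N_def]
  note m = cycle_normal[OF p(2) w, folded M_def]
  have uw: "mink u w = - \<kappa> * k" using wu mink_sym by metis
  have MN: "mink M N = 0" "mink N M = 0" by (simp_all add: M_def N_def mink_simps wu uw pp pu pw)
  have pM: "mink p M = 0" "mink p N = 0" using m n mink_sym by metis+
  have w1N: "w1 = p + k *\<^sub>R N" by (simp add: w1_def N_def algebra_simps power2_eq_square)
  have uN: "u = k *\<^sub>R p + N" and wM: "w = \<kappa> *\<^sub>R p + M" by (simp_all add: N_def M_def)
  have c1: "-1 < c"
  proof -
    have "0 < \<kappa>\<^sup>2 + k\<^sup>2 - 1" using \<kappa> by (smt (verit) one_less_power pos2 zero_le_power2)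
    then show ?thesis unfolding c_def using \<kappa> by (simp add: field_simps)
  qed
  have kc: "k\<^sup>2 - 1 = c * \<kappa>\<^sup>2" using \<kappa> by (simp add: c_def)
  define D where "D = (\<lambda>\<tau>. 1 + c * \<tau>\<^sup>2)"
  have D: "0 < D \<tau>" if "\<tau> \<in> {0..1}" for \<tau> unfolding D_def by (rule arc_denominator_pos[OF c1 that])
  have Xp: "mink (X \<tau>) p = -1 - 2 * \<tau>\<^sup>2 / \<kappa>\<^sup>2 / D \<tau>" and XM: "mink (X \<tau>) M = 2 * \<tau> / \<kappa> / D \<tau>"
    and XN: "mink (X \<tau>) N = 2 * \<tau>\<^sup>2 / \<kappa>\<^sup>2 * k / D \<tau>" for \<tau>
    by (simp_all add: X_def D_def w1N mink_simps pp pM n m MN)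
  text \<open>In the frame \<open>p, M, N\<close>, a point of the cycle is given by \<open>z\<close> and \<open>y\<close> as below.\<close>
  have coords: "x = X \<tau> \<and> \<tau> \<in> {0..1}"
    if x: "x \<in> cycle u k" and xw: "- \<kappa> \<le> mink x w" and nz: "mink x p \<noteq> -1"
      and t: "\<tau> = \<kappa> * (-1 - mink x p) / mink x M" for x \<tau>
  proof -
    define z where "z = -1 - mink x p"
    define y where "y = mink x M"
    have xH: "x \<in> hyp_plane" and xu: "mink x u = - k" using x by (auto simp: cycle_def)
    have z: "0 < z" using mink_hyp_plane_le[OF xH H] nz by (simp add: z_def)
    have xp: "mink x p = - 1 - z" by (simp add: z_def)
    have xN: "mink x N = k * z" using xu by (simp add: N_def mink_simps xp algebra_simps)
    have exp: "x = (1 + z) *\<^sub>R p + y *\<^sub>R M + (k * z) *\<^sub>R N"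
      using frame_expansion[OF pp m(2) n(2) pM MN(1), of x] xN by (simp add: xp y_def add.commute)
    have "mink p x = - 1 - z" "mink M x = y" "mink N x = k * z"
      using xp xN y_def mink_sym by metis+
    moreover have "mink x x = (1 + z) * mink p x + y * mink M x + (k * z) * mink N x"
      using arg_cong[OF exp, of "\<lambda>v. mink v x"] by (simp add: mink_simps)
    ultimately have "mink x x = - (1 + z)\<^sup>2 + y\<^sup>2 + (k * z)\<^sup>2"
      by (simp only:) (simp add: power2_eq_square algebra_simps)
    then have "y\<^sup>2 = z * (2 - (k\<^sup>2 - 1) * z)"
      using hyp_planeD(1)[OF xH] by (simp add: power2_eq_square algebra_simps)
    then have yz: "y\<^sup>2 = z * (2 - c * \<kappa>\<^sup>2 * z)" unfolding kc .
    have "mink x w = - \<kappa> * (1 + z) + y" by (simp add: wM mink_simps xp y_def algebra_simps)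
    then have yk: "\<kappa> * z \<le> y" using xw by (simp add: algebra_simps)
    have ypos: "0 < y" using yk z \<kappa> by (smt (verit) mult_pos_pos)
    have t: "\<tau> = \<kappa> * z / y" using t by (simp add: z_def y_def)
    have t01: "\<tau> \<in> {0..1}" unfolding t using yk ypos z \<kappa> by simp
    have "D \<tau> = (y\<^sup>2 + c * \<kappa>\<^sup>2 * z\<^sup>2) / y\<^sup>2"
      unfolding D_def t using ypos by (simp add: field_simps)
    also have "y\<^sup>2 + c * \<kappa>\<^sup>2 * z\<^sup>2 = 2 * z" unfolding yz by (simp add: power2_eq_square algebra_simps)
    finally have Dt: "D \<tau> = 2 * z / y\<^sup>2" .
    have e1: "2 * \<tau> / \<kappa> / D \<tau> = y" unfolding Dt unfolding t using z \<kappa> ypos by (simp add: field_simps power2_eq_square)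
    have e2: "2 * \<tau>\<^sup>2 / \<kappa>\<^sup>2 / D \<tau> = z" unfolding Dt unfolding t using z \<kappa> ypos by (simp add: field_simps power2_eq_square)
    have "X \<tau> = p + (2 * \<tau> / \<kappa> / D \<tau>) *\<^sub>R M + (2 * \<tau>\<^sup>2 / \<kappa>\<^sup>2 / D \<tau>) *\<^sub>R (p + k *\<^sub>R N)"
      by (simp add: X_def D_def w1N scaleR_right_distrib mult.commute)
    also have "\<dots> = x" unfolding e1 e2 by (subst exp) (simp add: algebra_simps)
    finally show ?thesis using t01 by simp
  qed
  have X0: "X 0 = p" by (simp add: X_def)
  have mem: "X \<tau> \<in> cycle u k \<and> - \<kappa> \<le> mink (X \<tau>) w" if t: "\<tau> \<in> {0..1}" for \<tau>
  proof
    have "X \<tau> = cycle_path p u k M (2 * \<tau> / \<kappa>)"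
      unfolding X_def cycle_path_def w1_def m c_def by (simp add: power_divide power2_eq_square)
    then show "X \<tau> \<in> cycle u k"
      using cycle_path_mem[OF p(1) u m(1), of "2 * \<tau> / \<kappa>"] D[OF t] MN pM
      by (simp add: uN mink_simps m c_def D_def power_divide)
    have "mink (X \<tau>) w = - \<kappa> + (2 * \<tau> / \<kappa> - 2 * \<tau>\<^sup>2 / \<kappa>) / D \<tau>"
      using \<kappa> by (simp add: wM mink_simps Xp XM power2_eq_square diff_divide_distrib algebra_simps)
    moreover have "0 \<le> 2 * \<tau> / \<kappa> - 2 * \<tau>\<^sup>2 / \<kappa>"
    proof -
      have "0 \<le> 2 * (\<tau> * (1 - \<tau>)) / \<kappa>" using t \<kappa> by auto
      then show ?thesis by (simp add: power2_eq_square algebra_simps diff_divide_distrib)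
    qed
    ultimately show "- \<kappa> \<le> mink (X \<tau>) w" using D[OF t] by simp
  qed
  show "{x \<in> cycle u k. - \<kappa> \<le> mink x w} = X ` {0..1}"
  proof (intro equalityI subsetI)
    fix x assume x: "x \<in> {x \<in> cycle u k. - \<kappa> \<le> mink x w}"
    show "x \<in> X ` {0..1}"
    proof (cases "mink x p = -1")
      case True
      then have "x = X 0" using mink_hyp_plane_eq[of x p] x H X0 by (auto simp: cycle_def)
      then show ?thesis by auto
    qed (use coords x in blast)
  qed (use mem in auto)
  show "x = p \<or> x = X 1" if x: "x \<in> cycle u k" "mink x w = - \<kappa>" for x
  proof (cases "mink x p = -1")
    case True
    then show ?thesis using mink_hyp_plane_eq[of x p] x H by (auto simp: cycle_def)
  next
    case False
    have "mink x M = \<kappa> * (-1 - mink x p)" unfolding M_def by (simp add: mink_simps x algebra_simps)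
    then have "\<kappa> * (-1 - mink x p) / mink x M = 1" using False \<kappa> by simp
    then show ?thesis using coords[OF x(1) _ False] x(2) by (metis order_refl)
  qed
  show "mink (X 1) p = -1 - 2 / (\<kappa>\<^sup>2 + k\<^sup>2 - 1)"
    unfolding Xp D_def c_def using \<kappa> by (simp add: field_simps)
  define y1 where "y1 = (\<lambda>\<tau>. 2 / \<kappa> * (1 - c * \<tau>\<^sup>2) / (D \<tau>)\<^sup>2)"
  define z1 where "z1 = (\<lambda>\<tau>. 4 * \<tau> / \<kappa>\<^sup>2 / (D \<tau>)\<^sup>2)"
  define X' where "X' = (\<lambda>\<tau>. y1 \<tau> *\<^sub>R M + z1 \<tau> *\<^sub>R w1)"
  \<comment> \<open>By \<open>y\<^sup>2 = z * (2 - (k\<^sup>2 - 1) * z)\<close> the parameter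
    \<open>\<kappa> * z / y\<close> equals \<open>\<kappa> * y / (2 - (k\<^sup>2 - 1) * z)\<close>;
    the second form is differentiable also at \<open>p\<close>, where \<open>y\<close> and
    \<open>z\<close> vanish.\<close>
  define \<phi> where "\<phi> = (\<lambda>x. \<kappa> * mink x M / (2 - (k\<^sup>2 - 1) * (-1 - mink x p)))"
  have \<phi>D: "2 - (k\<^sup>2 - 1) * (-1 - mink (X \<tau>) p) = 2 / D \<tau>" if "\<tau> \<in> {0..1}" for \<tau>
  proof -
    have "2 - (k\<^sup>2 - 1) * (-1 - mink (X \<tau>) p) = 2 - 2 * c * \<tau>\<^sup>2 / D \<tau>"
      unfolding Xp kc using \<kappa> by (simp add: field_simps)
    also have "\<dots> = 2 / D \<tau>" using D[OF that] by (simp add: field_simps) (simp add: D_def algebra_simps)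
    finally show ?thesis .
  qed
  have "hlength (X ` {0..1}) = integral {0..1} (\<lambda>\<tau>. 2 / \<kappa> / D \<tau>)"
  proof (rule hlength_eq[where \<phi> = \<phi> and X' = X'])
    fix \<tau> :: real assume t: "\<tau> \<in> {0..1}"
    have Dt: "D \<tau> \<noteq> 0" using D[OF t] by simp
    have dD: "(D has_real_derivative 2 * c * \<tau>) (at \<tau>)"
      unfolding D_def by (auto intro!: derivative_eq_intros)
    have l1: "((\<lambda>\<tau>. 2 * \<tau> / \<kappa>) has_real_derivative 2 / \<kappa>) (at \<tau>)"
      and l2: "((\<lambda>\<tau>. 2 * \<tau>\<^sup>2 / \<kappa>\<^sup>2) has_real_derivative 4 * \<tau> / \<kappa>\<^sup>2) (at \<tau>)"
      by (rule DERIV_cdivide, (auto intro!: derivative_eq_intros)[1])+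
    have "2 / \<kappa> * D \<tau> - 2 * \<tau> / \<kappa> * (2 * c * \<tau>) = 2 / \<kappa> * (1 - c * \<tau>\<^sup>2)"
      by (simp add: D_def power2_eq_square algebra_simps diff_divide_distrib add_divide_distrib)
    then have d1: "((\<lambda>\<tau>. 2 * \<tau> / \<kappa> / D \<tau>) has_real_derivative y1 \<tau>) (at \<tau>)"
      using DERIV_divide[OF l1 dD Dt] by (simp add: y1_def power2_eq_square)
    have "4 * \<tau> / \<kappa>\<^sup>2 * D \<tau> - 2 * \<tau>\<^sup>2 / \<kappa>\<^sup>2 * (2 * c * \<tau>) = 4 * \<tau> / \<kappa>\<^sup>2"
      by (simp add: D_def power2_eq_square algebra_simps add_divide_distrib)
    then have d2: "((\<lambda>\<tau>. 2 * \<tau>\<^sup>2 / \<kappa>\<^sup>2 / D \<tau>) has_real_derivative z1 \<tau>) (at \<tau>)"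
      using DERIV_divide[OF l2 dD Dt] by (simp add: z1_def power2_eq_square)
    have Xeq: "X = (\<lambda>\<tau>. p + ((2 * \<tau> / \<kappa> / D \<tau>) *\<^sub>R M + (2 * \<tau>\<^sup>2 / \<kappa>\<^sup>2 / D \<tau>) *\<^sub>R w1))"
      by (rule ext) (simp add: X_def D_def scaleR_right_distrib mult.commute)
    show "(X has_vector_derivative X' \<tau>) (at \<tau>)"
      unfolding Xeq X'_def
      using has_vector_derivative_add[OF has_vector_derivative_const
        has_vector_derivative_add[OF has_vector_derivative_scaleR[OF d1 has_vector_derivative_const]
          has_vector_derivative_scaleR[OF d2 has_vector_derivative_const]]]
      by simp
    show "\<phi> (X \<tau>) = \<tau>"
      unfolding \<phi>_def \<phi>D[OF t] XM using Dt \<kappa> by simp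
    have "(\<lambda>x. mink x q) differentiable (at x)" for q x
      using bounded_linear_imp_differentiable bounded_bilinear.bounded_linear_left[OF bounded_bilinear_mink] by blast
    then show "\<phi> differentiable at (X \<tau>)"
      unfolding \<phi>_def using \<phi>D[OF t] Dt
      by (intro differentiable_divide differentiable_mult differentiable_diff differentiable_const) auto
    have w1: "mink w1 w1 = k\<^sup>2 - 1" "mink w1 M = 0" "mink M w1 = 0"
      by (simp_all add: w1N mink_simps pp pM n m MN power2_eq_square)
    have "mink (X' \<tau>) (X' \<tau>) = (y1 \<tau>)\<^sup>2 + (k\<^sup>2 - 1) * (z1 \<tau>)\<^sup>2"
      by (simp add: X'_def mink_simps w1 m power2_eq_square)
    also have "\<dots> = 4 / \<kappa>\<^sup>2 * ((1 - c * \<tau>\<^sup>2)\<^sup>2 + 4 * c * \<tau>\<^sup>2) / ((D \<tau>)\<^sup>2 * (D \<tau>)\<^sup>2)"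
      unfolding kc y1_def z1_def using \<kappa> Dt by (simp add: field_simps power2_eq_square)
    also have "(1 - c * \<tau>\<^sup>2)\<^sup>2 + 4 * c * \<tau>\<^sup>2 = (D \<tau>)\<^sup>2"
      by (simp add: D_def power2_eq_square algebra_simps)
    also have "4 / \<kappa>\<^sup>2 * (D \<tau>)\<^sup>2 / ((D \<tau>)\<^sup>2 * (D \<tau>)\<^sup>2) = (2 / \<kappa> / D \<tau>)\<^sup>2"
      using Dt \<kappa> by (simp add: field_simps power2_eq_square)
    finally show "sqrt (mink (X' \<tau>) (X' \<tau>)) = 2 / \<kappa> / D \<tau>" using D[OF t] \<kappa> by simp
  next
    have Dc: "continuous_on {0..1} D" unfolding D_def by (intro continuous_intros)
    have nz: "\<forall>\<tau>\<in>{0..1}. D \<tau> \<noteq> 0" using D by (metis less_irrefl)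
    show "continuous_on {0..1} X'"
      unfolding X'_def y1_def z1_def using nz \<kappa> by (intro continuous_intros Dc) auto
    show "continuous_on {0..1} (\<lambda>\<tau>. 2 / \<kappa> / D \<tau>)" using nz \<kappa> by (intro continuous_intros Dc) auto
  qed
  also have "\<dots> = 2 / \<kappa> * arc_integral 0 1 c"
    unfolding arc_integral_def D_def
    by (subst integral_mult_right[symmetric]) (rule integral_cong, simp)
  finally show "hlength (X ` {0..1}) = 2 / \<kappa> * arc_integral 0 1 c" .
qed

text \<open>Nothing in \<open>triangle_packing\<close> states the curvature \<open>\<kappa>\<close>
  of the dual circle. The far end of the arc at \<open>i\<close> is the other tangent point, so the
  product of the two tangent points is known both from the tangency relations and from the arc;
  comparing them gives \<open>\<kappa>\<^sup>2 = dual_sq U k\<close>.\<close>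

lemma triangle_sub_arc_length:
  assumes U: "card U = 3" and pk: "triangle_packing U k C D" and i: "i \<in> U"
  shows "0 < k i"
    and "hlength (sub_arc (C i) D) = 2 / sqrt (dual_sq U k) * arc_integral 0 1 (((k i)\<^sup>2 - 1) / dual_sq U k)"
proof -
  obtain a b c where abc: "U = {a, b, c}" "a \<noteq> b" "a \<noteq> c" "b \<noteq> c"
    using U by (auto simp: card_Suc_eq numeral_3_eq_3)
  then obtain j l where Ue: "U = {i, j, l}" and ne: "i \<noteq> j" "i \<noteq> l" "j \<noteq> l"
    using i by (metis insert_commute insertE singletonD)
  have mem: "i \<in> U" "j \<in> U" "l \<in> U" using Ue by auto
  obtain q \<rho> where Dq: "D = Circle q \<rho>" using pk by (auto simp: triangle_packing_def)
  have vC: "gcircle_valid (C v)" "geodesic_curvature (C v) = k v" if "v \<in> U" for v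
    using pk that by (auto simp: triangle_packing_def)
  have vD: "gcircle_valid D" using pk by (simp add: triangle_packing_def)
  define \<kappa> where "\<kappa> = geodesic_curvature D"
  have \<rho>: "0 < \<rho>" using vD Dq by simp
  have \<kappa>: "1 < \<kappa>" unfolding \<kappa>_def Dq using \<rho> tanh_real_lt_1[of \<rho>] by simp
  have k: "0 < k v" if "v \<in> U" for v using geodesic_curvature_pos vC that by metis
  show "0 < k i" by (rule k[OF i])
  define u where "u = (\<lambda>v. cycle_vec (C v))"
  define w where "w = cycle_vec D"
  have uu: "mink (u v) (u v) = 1 - (k v)\<^sup>2" if "v \<in> U" for v
    unfolding u_def using mink_cycle_vec_self vC that by metis
  have ww: "mink w w = 1 - \<kappa>\<^sup>2" unfolding w_def \<kappa>_def by (rule mink_cycle_vec_self[OF vD])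
  have cv: "curve (C v) = cycle (u v) (k v)" if "v \<in> U" for v
    unfolding u_def using curve_eq_cycle vC that by metis
  have cD: "curve D = cycle w \<kappa>" unfolding w_def \<kappa>_def by (rule curve_eq_cycle[OF vD])
  define P where "P = (\<lambda>v v'. (1 / (k v + k v')) *\<^sub>R (u v + u v'))"
  have et: "mink (u v) (u v') = - 1 - k v * k v'" "tangent_at (P v v') (curve (C v)) (curve (C v'))"
    if "v \<in> U" "v' \<in> U" "v \<noteq> v'" for v v'
  proof -
    have e: "externally_tangent (C v) (C v')" using pk that by (auto simp: triangle_packing_def)
    show "mink (u v) (u v') = - 1 - k v * k v'" "tangent_at (P v v') (curve (C v)) (curve (C v'))"
      using externally_tangent_cycles[OF vC(1)[OF that(1)] vC(1)[OF that(2)] e] vC(2) that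
      by (simp_all add: u_def P_def)
  qed
  have Pm: "P v v' \<in> cycle (u v) (k v)" "P v v' \<in> cycle w \<kappa>" if "v \<in> U" "v' \<in> U" "v \<noteq> v'" for v v'
  proof -
    show "P v v' \<in> cycle (u v) (k v)" using et(2)[OF that] cv that by (simp add: tangent_at_def)
    show "P v v' \<in> cycle w \<kappa>" unfolding cD[symmetric]
      using pk et(2)[OF that] that unfolding triangle_packing_def by blast
  qed
  have wu: "mink w (u i) = - \<kappa> * k i"
  proof (rule perpendicular_cycles[OF uu[OF mem(1)] ww])
    show "P i j \<in> cycle (u i) (k i)" "P i j \<in> cycle w \<kappa>" using Pm mem ne by auto
    have "perpendicular (curve D) (curve (C i))"
      using pk mem(1) unfolding triangle_packing_def by blast
    then show "perpendicular (cycle w \<kappa>) (cycle (u i) (k i))"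
      unfolding cD cv[OF mem(1)] .
  qed
  note arc = hlength_cycle_arc[OF Pm[OF mem(1,2) ne(1)] uu[OF mem(1)] ww wu \<kappa>]
  have kp: "0 < k i" "0 < k j" "0 < k l" using k mem by auto
  have PP: "mink (P i l) (P i j) = -1 - 2 / ((k i + k j) * (k i + k l))"
  proof -
    have "mink (u i + u l) (u i + u j) = - (k i + k j) * (k i + k l) - 2"
      using et(1)[of i j] et(1)[of l i] et(1)[of l j] uu[of i] mem ne
      by (simp add: mink_simps power2_eq_square algebra_simps)
    moreover have "(1 / a) * ((1 / b) * (- b * a - 2)) = -1 - 2 / (b * a)" if "0 < a" "0 < b" for a b :: real
      using that by (simp add: field_simps)
    note this[OF add_pos_pos[OF kp(1) kp(3)] add_pos_pos[OF kp(1) kp(2)]]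
    ultimately show ?thesis unfolding P_def mink_scaleR_left mink_scaleR_right real_scaleR_def
      by (simp only: mult.left_commute)
  qed
  have P1: "0 < (k i + k j) * (k i + k l)" using kp by (intro mult_pos_pos) auto
  \<comment> \<open>On the cycle of \<open>i\<close> only \<open>P i j\<close> and the far end of
    the arc lie on the dual circle, so distinctness identifies \<open>P i l\<close> with the far
    end.\<close>
  have "P i l \<noteq> P i j"
  proof
    assume "P i l = P i j"
    then have "mink (P i l) (P i j) = -1" using Pm[OF mem(1,2) ne(1)] by (simp add: cycle_def hyp_planeD)
    then have "2 / ((k i + k j) * (k i + k l)) = 0" using PP by linarith
    then show False using P1 by (metis divide_eq_0_iff less_irrefl zero_neq_numeral)
  qed
  then have "mink (P i l) (P i j) = -1 - 2 / (\<kappa>\<^sup>2 + (k i)\<^sup>2 - 1)"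
    using arc(3)[of "P i l"] arc(4) Pm[OF mem(1,3) ne(2)] by (auto simp: cycle_def)
  then have "2 / ((k i + k j) * (k i + k l)) = 2 / (\<kappa>\<^sup>2 + (k i)\<^sup>2 - 1)" using PP by linarith
  then have "(k i + k j) * (k i + k l) = \<kappa>\<^sup>2 + (k i)\<^sup>2 - 1" using P1
    by (smt (verit, best) divide_cancel_left divide_eq_0_iff)
  then have \<kappa>2: "\<kappa>\<^sup>2 = dual_sq U k"
    unfolding Ue dual_sq_triple[OF ne] by (simp add: power2_eq_square algebra_simps)
  then have \<kappa>s: "\<kappa> = sqrt (dual_sq U k)" using \<kappa> by (metis abs_of_pos less_trans real_sqrt_abs zero_less_one)
  have "sub_arc (C i) D = {x \<in> cycle (u i) (k i). - \<kappa> \<le> mink x w}"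
    unfolding sub_arc_def convex_side_eq[OF vD] cD cv[OF mem(1)] w_def[symmetric] \<kappa>_def[symmetric]
    by (auto simp: cycle_def)
  then show "hlength (sub_arc (C i) D) = 2 / sqrt (dual_sq U k) * arc_integral 0 1 (((k i)\<^sup>2 - 1) / dual_sq U k)"
    using arc(1,2) \<kappa>2 \<kappa>s by simp
qed

section \<open>Total geodesic curvatures of a triangle\<close>

lemma arc_integrand_integrable:
  assumes "-1 < c"
  shows "(\<lambda>\<tau>. \<tau> ^ m / (1 + c * \<tau>\<^sup>2) ^ n) integrable_on {0..1::real}"
proof (rule integrable_continuous_real)
  have "1 + c * \<tau>\<^sup>2 \<noteq> 0" if "\<tau> \<in> {0..1}" for \<tau> using arc_denominator_pos[OF assms that] by simp
  then show "continuous_on {0..1} (\<lambda>\<tau>. \<tau> ^ m / (1 + c * \<tau>\<^sup>2) ^ n)"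
    by (intro continuous_intros) auto
qed

lemma arc_integral_has_derivative:
  assumes c: "-1 < c"
  shows "(arc_integral m n has_real_derivative - real n * arc_integral (m + 2) (n + 1) c) (at c)"
proof -
  let ?fx = "\<lambda>c \<tau>. - real n * (\<tau> ^ (m + 2) / (1 + c * \<tau>\<^sup>2) ^ (n + 1))"
  have pos: "1 + c * \<tau>\<^sup>2 \<noteq> 0" if "c \<in> {-1<..}" "\<tau> \<in> {0..1}" for c \<tau> :: real
    using arc_denominator_pos[of c \<tau>] that by auto
  have "((\<lambda>c. integral (cbox 0 1) (\<lambda>\<tau>. \<tau> ^ m / (1 + c * \<tau>\<^sup>2) ^ n)) has_field_derivative
    integral (cbox 0 1) (?fx c)) (at c within {-1<..})"
  proof (rule leibniz_rule_field_derivative)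
    fix c \<tau> :: real assume *: "c \<in> {-1<..}" "\<tau> \<in> cbox 0 1"
    then have nz: "1 + c * \<tau>\<^sup>2 \<noteq> 0" using pos by auto
    show "((\<lambda>c. \<tau> ^ m / (1 + c * \<tau>\<^sup>2) ^ n) has_field_derivative ?fx c \<tau>) (at c within {-1<..})"
    proof (cases n)
      case (Suc n')
      have eq: "(0 * d ^ Suc n' - a * ((1 + real n') * (b * d ^ n'))) / (d ^ Suc n' * d ^ Suc n')
        = - real (Suc n') * (a * b / d ^ (Suc n' + 1))" if "d \<noteq> 0" for a b d :: real
        using that by (simp add: field_simps)
      have "((\<lambda>c. 1 + c * \<tau>\<^sup>2) has_field_derivative \<tau>\<^sup>2) (at c within {-1<..})"
        by (auto intro!: derivative_eq_intros)
      note D = DERIV_divide[OF DERIV_const[of "\<tau> ^ m"] DERIV_power_Suc[OF this, of n']]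
      show ?thesis unfolding Suc
      proof (rule DERIV_cong[OF D])
        show "(1 + c * \<tau>\<^sup>2) ^ Suc n' \<noteq> 0" using nz by simp
      qed (unfold eq[OF nz], simp add: power_add power2_eq_square)
    qed simp
  next
    fix c :: real assume "c \<in> {-1<..}"
    then show "(\<lambda>\<tau>. \<tau> ^ m / (1 + c * \<tau>\<^sup>2) ^ n) integrable_on cbox 0 1"
      using arc_integrand_integrable by auto
  next
    show "continuous_on ({-1<..} \<times> cbox 0 1) (\<lambda>(c, \<tau>). ?fx c \<tau>)"
      unfolding split_def using pos by (intro continuous_intros) auto
  qed (use c in auto)
  moreover have "integral (cbox 0 1) (?fx c) = - real n * arc_integral (m + 2) (n + 1) c"
    unfolding arc_integral_def by (subst integral_mult_right[symmetric]) simp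
  moreover have "(\<lambda>c. integral (cbox 0 1) (\<lambda>\<tau>. \<tau> ^ m / (1 + c * \<tau>\<^sup>2) ^ n)) = arc_integral m n"
    by (rule ext) (simp add: arc_integral_def)
  ultimately have "(arc_integral m n has_real_derivative - real n * arc_integral (m + 2) (n + 1) c) (at c within {-1<..})"
    by (simp only:)
  then show ?thesis using c at_within_open[of c "{-1<..}"] by simp
qed

lemma continuous_on_arc_integral: "continuous_on {-1<..} (arc_integral m n)"
  by (rule DERIV_continuous_on) (rule has_field_derivative_at_within, rule arc_integral_has_derivative, simp)

lemma continuous_on_arc_integral_compose [continuous_intros]:
  assumes "continuous_on X f" "\<And>x. x \<in> X \<Longrightarrow> -1 < f x"
  shows "continuous_on X (\<lambda>x. arc_integral m n (f x))"
  by (rule continuous_on_compose2[OF continuous_on_arc_integral assms(1)]) (use assms(2) in auto)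

text \<open>Integrate the derivative of \<open>\<tau> / (1 + c * \<tau>\<^sup>2)\<close>. In the
  derivative of \<open>face_curvature\<close> this trades \<open>arc_integral 0 1\<close> for
  \<open>arc_integral 2 2\<close>, whereupon the off-diagonal entries become algebraic.\<close>

lemma arc_integral_recurrence:
  assumes c: "-1 < c"
  shows "arc_integral 0 1 c = 1 / (1 + c) + 2 * c * arc_integral 2 2 c"
proof -
  have i1: "((\<lambda>\<tau>. 1 / (1 + c * \<tau>\<^sup>2) - 2 * c * (\<tau>\<^sup>2 / (1 + c * \<tau>\<^sup>2)\<^sup>2)) has_integral
    1 / (1 + c * 1\<^sup>2) - 0 / (1 + c * 0\<^sup>2)) {0..1}"
  proof (rule fundamental_theorem_of_calculus)
    fix \<tau> :: real assume "\<tau> \<in> {0..1}"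
    then have "1 + c * \<tau>\<^sup>2 \<noteq> 0" using arc_denominator_pos[OF c] by (metis less_irrefl)
    moreover have "((\<lambda>\<tau>. 1 + c * \<tau>\<^sup>2) has_real_derivative 2 * c * \<tau>) (at \<tau> within {0..1})"
      by (auto intro!: derivative_eq_intros)
    moreover have "(1 * d - \<tau> * (2 * c * \<tau>)) / (d * d) = 1 / d - 2 * c * (\<tau>\<^sup>2 / d\<^sup>2)" if "d \<noteq> 0" for d
      using that by (simp add: field_simps power2_eq_square)
    ultimately have "((\<lambda>\<tau>. \<tau> / (1 + c * \<tau>\<^sup>2)) has_real_derivative
      (1 / (1 + c * \<tau>\<^sup>2) - 2 * c * (\<tau>\<^sup>2 / (1 + c * \<tau>\<^sup>2)\<^sup>2))) (at \<tau> within {0..1})"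
      using DERIV_divide[OF DERIV_ident, of "\<lambda>\<tau>. 1 + c * \<tau>\<^sup>2" "2 * c * \<tau>" \<tau> "{0..1}"] by simp
    then show "((\<lambda>\<tau>. \<tau> / (1 + c * \<tau>\<^sup>2)) has_vector_derivative
      (1 / (1 + c * \<tau>\<^sup>2) - 2 * c * (\<tau>\<^sup>2 / (1 + c * \<tau>\<^sup>2)\<^sup>2))) (at \<tau> within {0..1})"
      by (simp add: has_real_derivative_iff_has_vector_derivative)
  qed simp
  have i2: "((\<lambda>\<tau>. 1 / (1 + c * \<tau>\<^sup>2) - 2 * c * (\<tau>\<^sup>2 / (1 + c * \<tau>\<^sup>2)\<^sup>2)) has_integral
    (arc_integral 0 1 c - 2 * c * arc_integral 2 2 c)) {0..1}"
    unfolding arc_integral_def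
    using integrable_integral[OF arc_integrand_integrable[OF c, of 0 1]]
      integrable_integral[OF arc_integrand_integrable[OF c, of 2 2]]
    by (intro has_integral_diff has_integral_mult_right) simp_all
  show ?thesis using has_integral_unique[OF i1 i2] by simp
qed

text \<open>\<open>1 / (1 + c)\<close> is the integral of
  \<open>2 * \<tau> / (1 + c * \<tau>\<^sup>2)\<^sup>2\<close>, and
  \<open>\<tau>\<^sup>2 \<le> \<tau>\<close>. This inequality makes \<open>row_sum\<close>
  positive.\<close>

lemma arc_integral_less:
  assumes c: "-1 < c"
  shows "2 * arc_integral 2 2 c < 1 / (1 + c)"
proof -
  have i1: "((\<lambda>\<tau>. 2 * \<tau> / (1 + c * \<tau>\<^sup>2)\<^sup>2) has_integral 1\<^sup>2 / (1 + c * 1\<^sup>2) - 0\<^sup>2 / (1 + c * 0\<^sup>2)) {0..1}"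
  proof (rule fundamental_theorem_of_calculus)
    fix \<tau> :: real assume "\<tau> \<in> {0..1}"
    then have "1 + c * \<tau>\<^sup>2 \<noteq> 0" using arc_denominator_pos[OF c] by (metis less_irrefl)
    moreover have "((\<lambda>\<tau>. 1 + c * \<tau>\<^sup>2) has_real_derivative 2 * c * \<tau>) (at \<tau> within {0..1})"
      and "((\<lambda>\<tau>. \<tau>\<^sup>2) has_real_derivative 2 * \<tau>) (at \<tau> within {0..1})"
      by (auto intro!: derivative_eq_intros)
    moreover have "2 * \<tau> * (1 + c * \<tau>\<^sup>2) - \<tau>\<^sup>2 * (2 * c * \<tau>) = 2 * \<tau>"
      by (simp add: algebra_simps)
    ultimately have "((\<lambda>\<tau>. \<tau>\<^sup>2 / (1 + c * \<tau>\<^sup>2)) has_real_derivative 2 * \<tau> / (1 + c * \<tau>\<^sup>2)\<^sup>2) (at \<tau> within {0..1})"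
      using DERIV_divide[of "\<lambda>\<tau>. \<tau>\<^sup>2" "2 * \<tau>" \<tau> "{0..1}" "\<lambda>\<tau>. 1 + c * \<tau>\<^sup>2" "2 * c * \<tau>"]
      by (simp add: power2_eq_square)
    then show "((\<lambda>\<tau>. \<tau>\<^sup>2 / (1 + c * \<tau>\<^sup>2)) has_vector_derivative 2 * \<tau> / (1 + c * \<tau>\<^sup>2)\<^sup>2) (at \<tau> within {0..1})"
      by (simp add: has_real_derivative_iff_has_vector_derivative)
  qed simp
  have i2: "((\<lambda>\<tau>. 2 * (\<tau>\<^sup>2 / (1 + c * \<tau>\<^sup>2)\<^sup>2)) has_integral 2 * arc_integral 2 2 c) {0..1}"
    unfolding arc_integral_def
    by (intro has_integral_mult_right integrable_integral arc_integrand_integrable c)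
  \<comment> \<open>\<open>b\<close> bounds the denominator from above; the resulting minorant of
    the difference has the positive integral \<open>1 / 3 / b\<^sup>2\<close>, which makes the
    inequality strict.\<close>
  define b where "b = 1 + \<bar>c\<bar>"
  have b: "0 < b" by (simp add: b_def)
  have "((\<lambda>\<tau>. 2 * (\<tau> - \<tau>\<^sup>2) / b\<^sup>2) has_integral (1\<^sup>2 - 2 * 1 ^ 3 / 3) / b\<^sup>2 - (0\<^sup>2 - 2 * 0 ^ 3 / 3) / b\<^sup>2) {0..1}"
  proof (rule fundamental_theorem_of_calculus)
    fix \<tau> :: real assume "\<tau> \<in> {0..1}"
    have "((\<lambda>\<tau>. (\<tau>\<^sup>2 - 2 * \<tau> ^ 3 / 3) / b\<^sup>2) has_real_derivative 2 * (\<tau> - \<tau>\<^sup>2) / b\<^sup>2) (at \<tau> within {0..1})"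
      using b by (auto intro!: derivative_eq_intros simp: field_simps power2_eq_square)
    then show "((\<lambda>\<tau>. (\<tau>\<^sup>2 - 2 * \<tau> ^ 3 / 3) / b\<^sup>2) has_vector_derivative 2 * (\<tau> - \<tau>\<^sup>2) / b\<^sup>2) (at \<tau> within {0..1})"
      by (simp add: has_real_derivative_iff_has_vector_derivative)
  qed simp
  then have i3: "((\<lambda>\<tau>. 2 * (\<tau> - \<tau>\<^sup>2) / b\<^sup>2) has_integral 1 / 3 / b\<^sup>2) {0..1}" by simp
  have "1 / 3 / b\<^sup>2 \<le> 1\<^sup>2 / (1 + c * 1\<^sup>2) - 0\<^sup>2 / (1 + c * 0\<^sup>2) - 2 * arc_integral 2 2 c"
  proof (rule has_integral_le[OF i3 has_integral_diff[OF i1 i2]])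
    fix \<tau> :: real assume t: "\<tau> \<in> {0..1}"
    have p: "0 < 1 + c * \<tau>\<^sup>2" by (rule arc_denominator_pos[OF c t])
    have t2: "0 \<le> \<tau>\<^sup>2" "\<tau>\<^sup>2 \<le> \<tau>" using t by (auto simp: power2_eq_square mult_left_le)
    then have "\<tau>\<^sup>2 \<le> 1" using t by simp
    have "c * \<tau>\<^sup>2 \<le> \<bar>c\<bar> * \<tau>\<^sup>2" using t2(1) by (rule mult_right_mono[OF abs_ge_self])
    also have "\<dots> \<le> \<bar>c\<bar>" using \<open>\<tau>\<^sup>2 \<le> 1\<close> by (simp add: mult_left_le)
    finally have "1 + c * \<tau>\<^sup>2 \<le> b" by (simp add: b_def)
    then have "(1 + c * \<tau>\<^sup>2)\<^sup>2 \<le> b\<^sup>2" using p by (intro power_mono) auto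
    then have "2 * (\<tau> - \<tau>\<^sup>2) / b\<^sup>2 \<le> 2 * (\<tau> - \<tau>\<^sup>2) / (1 + c * \<tau>\<^sup>2)\<^sup>2"
      using p t2 by (intro divide_left_mono mult_pos_pos) (auto simp: b)
    then show "2 * (\<tau> - \<tau>\<^sup>2) / b\<^sup>2 \<le> 2 * \<tau> / (1 + c * \<tau>\<^sup>2)\<^sup>2 - 2 * (\<tau>\<^sup>2 / (1 + c * \<tau>\<^sup>2)\<^sup>2)"
      by (simp add: diff_divide_distrib right_diff_distrib)
  qed
  then have "1 / 3 / b\<^sup>2 \<le> 1 / (1 + c) - 2 * arc_integral 2 2 c" by simp
  moreover have "0 < 1 / 3 / b\<^sup>2" using b by simp
  ultimately show ?thesis by linarith
qed

lemma arc_integral_nonneg: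
  assumes c: "-1 < c"
  shows "0 \<le> arc_integral m n c"
  unfolding arc_integral_def
proof (rule integral_nonneg[OF arc_integrand_integrable[OF c]])
  fix \<tau> :: real assume t: "\<tau> \<in> {0..1}"
  show "0 \<le> \<tau> ^ m / (1 + c * \<tau>\<^sup>2) ^ n" using arc_denominator_pos[OF c t] t by simp
qed

text \<open>
  The total geodesic curvature of the sub-arc at \<open>i\<close>, and its derivatives with respect to the
  logarithms of the curvatures \<open>k\<close>; \<open>row_sum\<close> is the derivative under scaling of \<open>k\<close>.
\<close>

definition face_curvature :: "'v set \<Rightarrow> ('v \<Rightarrow> real) \<Rightarrow> 'v \<Rightarrow> real" where
  "face_curvature U k i =
     2 * k i / sqrt (dual_sq U k) * arc_integral 0 1 (((k i)\<^sup>2 - 1) / dual_sq U k)"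

definition off_diag :: "'v set \<Rightarrow> ('v \<Rightarrow> real) \<Rightarrow> 'v \<Rightarrow> 'v \<Rightarrow> real" where
  "off_diag U k i j = k i * k j / (sqrt (dual_sq U k) * (k i + k j))"

definition row_sum :: "'v set \<Rightarrow> ('v \<Rightarrow> real) \<Rightarrow> 'v \<Rightarrow> real" where
  "row_sum U k i = 2 * k i / (dual_sq U k * sqrt (dual_sq U k)) *
     (1 / (1 + ((k i)\<^sup>2 - 1) / dual_sq U k) - 2 * arc_integral 2 2 (((k i)\<^sup>2 - 1) / dual_sq U k))"

definition face_jacobian :: "'v set \<Rightarrow> ('v \<Rightarrow> real) \<Rightarrow> 'v \<Rightarrow> 'v \<Rightarrow> real" where
  "face_jacobian U k i j =
     (if i = j then row_sum U k i + (\<Sum>l\<in>U - {i}. off_diag U k i l) else - off_diag U k i j)"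

lemma tripleE:
  assumes "card U = 3" "i \<in> U"
  obtains j l where "U = {i, j, l}" "i \<noteq> j" "i \<noteq> l" "j \<noteq> l"
proof -
  obtain a b c where "U = {a, b, c}" "a \<noteq> b" "a \<noteq> c" "b \<noteq> c"
    using assms(1) by (auto simp: card_Suc_eq numeral_3_eq_3)
  then show ?thesis using that assms(2) by (metis insert_commute insertE singletonD)
qed

lemma dual_sq_ge_1:
  assumes U: "card U = 3" and k: "\<And>v. v \<in> U \<Longrightarrow> 0 < k v"
  shows "1 \<le> dual_sq U k"
proof -
  have "U \<noteq> {}" using U by auto
  then obtain i where i: "i \<in> U" by blast
  obtain j l where U': "U = {i, j, l}" "i \<noteq> j" "i \<noteq> l" "j \<noteq> l" using tripleE[OF U i] .
  have "0 < k i" "0 < k j" "0 < k l" using k U' by auto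
  then show ?thesis unfolding U'(1) dual_sq_triple[OF U'(2-4)] by simp
qed

lemma arc_parameter_gt:
  assumes U: "card U = 3" and k: "\<And>v. v \<in> U \<Longrightarrow> 0 < k v" and i: "i \<in> U"
  shows "-1 < ((k i)\<^sup>2 - 1) / dual_sq U k"
proof -
  have "1 \<le> dual_sq U k" by (rule dual_sq_ge_1[OF U k])
  moreover have "0 < (k i)\<^sup>2" using k[OF i] by simp
  ultimately have "0 < dual_sq U k" "-1 * dual_sq U k < (k i)\<^sup>2 - 1" by linarith+
  then show ?thesis by (simp only: pos_less_divide_eq)
qed

text \<open>The curvatures move with logarithmic velocities, so the coefficients of
  \<open>\<sigma>x\<close>, \<open>\<sigma>y\<close>, \<open>\<sigma>z\<close> are the partial
  derivatives in the logarithms. Stated along curves, the formula serves segments, coordinate lines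
  and flow trajectories alike.\<close>

lemma face_curvature_triple_derivative:
  fixes x y z :: "real \<Rightarrow> real"
  assumes pos: "0 < x t" "0 < y t" "0 < z t"
    and dx: "(x has_real_derivative x t * \<sigma>x) (at t within S)"
    and dy: "(y has_real_derivative y t * \<sigma>y) (at t within S)"
    and dz: "(z has_real_derivative z t * \<sigma>z) (at t within S)"
  defines "P \<equiv> \<lambda>t. 1 + x t * y t + x t * z t + y t * z t"
  defines "q \<equiv> sqrt (P t)" and "c \<equiv> ((x t)\<^sup>2 - 1) / P t"
  shows "((\<lambda>t. 2 * x t / sqrt (P t) * arc_integral 0 1 (((x t)\<^sup>2 - 1) / P t)) has_real_derivative
     (2 * x t / (P t * q) * (1 / (1 + c) - 2 * arc_integral 2 2 c)
        + (x t * y t / (q * (x t + y t)) + x t * z t / (q * (x t + z t)))) * \<sigma>x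
     - x t * y t / (q * (x t + y t)) * \<sigma>y - x t * z t / (q * (x t + z t)) * \<sigma>z) (at t within S)"
proof -
  define p where "p = P t"
  define X where "X = x t" define Y where "Y = y t" define Z where "Z = z t"
  have pos': "0 < X" "0 < Y" "0 < Z" using pos by (auto simp: X_def Y_def Z_def)
  have pe: "p = 1 + X * Y + X * Z + Y * Z" by (simp add: p_def P_def X_def Y_def Z_def)
  have p: "0 < p" unfolding pe using pos' by (simp add: add_pos_pos)
  have q: "0 < q" "q * q = p" using p by (auto simp: q_def p_def)
  define E where "E = (X + Y) * (X + Z)"
  have E: "0 < E" using pos' by (simp add: E_def)
  \<comment> \<open>Through \<open>1 + c = E / p\<close> this factorization is the source of the
    denominators \<open>X + Y\<close> and \<open>X + Z\<close> in the off-diagonal entries.\<close>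
  have EP: "E = p + X\<^sup>2 - 1" by (simp add: E_def pe power2_eq_square algebra_simps)
  have c1: "1 + c = E / p" unfolding c_def EP using p by (simp add: p_def[symmetric] X_def[symmetric] field_simps)
  have c: "-1 < c" using c1 E p by (smt (verit) divide_pos_pos)
  define p' where "p' = X * \<sigma>x * (Y + Z) + Y * \<sigma>y * (X + Z) + Z * \<sigma>z * (X + Y)"
  have dP: "(P has_real_derivative p') (at t within S)"
    unfolding P_def p'_def X_def Y_def Z_def
    by (rule derivative_eq_intros dx dy dz refl)+ (simp add: algebra_simps)
  have dq: "((\<lambda>t. sqrt (P t)) has_real_derivative p' / (2 * q)) (at t within S)"
    using DERIV_chain2[OF DERIV_real_sqrt dP] p by (simp add: p_def q_def field_simps)
  define c' where "c' = 2 * X\<^sup>2 * \<sigma>x / p - (X\<^sup>2 - 1) * p' / p\<^sup>2"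
  have dc: "((\<lambda>t. ((x t)\<^sup>2 - 1) / P t) has_real_derivative c') (at t within S)"
  proof -
    have "((\<lambda>t. (x t)\<^sup>2 - 1) has_real_derivative 2 * X\<^sup>2 * \<sigma>x) (at t within S)"
      by (auto intro!: derivative_eq_intros dx simp: X_def power2_eq_square)
    from DERIV_divide[OF this dP] p
    have "((\<lambda>t. ((x t)\<^sup>2 - 1) / P t) has_real_derivative (2 * X\<^sup>2 * \<sigma>x * p - (X\<^sup>2 - 1) * p') / (p * p)) (at t within S)"
      by (simp add: X_def p_def)
    moreover have "(2 * X\<^sup>2 * \<sigma>x * p - (X\<^sup>2 - 1) * p') / (p * p) = c'"
      unfolding c'_def using p by (simp add: diff_divide_distrib power2_eq_square)
    ultimately show ?thesis by simp
  qed
  define A where "A = arc_integral 0 1 c" define B where "B = arc_integral 2 2 c"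
  have "((\<lambda>t. arc_integral 0 1 (((x t)\<^sup>2 - 1) / P t)) has_real_derivative - real 1 * arc_integral (0 + 2) (1 + 1) c * c') (at t within S)"
    by (rule DERIV_chain2[OF _ dc]) (use arc_integral_has_derivative[OF c, of 0 1] in \<open>simp add: c_def\<close>)
  then have dA: "((\<lambda>t. arc_integral 0 1 (((x t)\<^sup>2 - 1) / P t)) has_real_derivative - B * c') (at t within S)"
    by (simp add: B_def numeral_2_eq_2)
  have raw: "((\<lambda>t. 2 * x t / sqrt (P t) * arc_integral 0 1 (((x t)\<^sup>2 - 1) / P t)) has_real_derivative
     (2 * (X * \<sigma>x) * q - 2 * X * (p' / (2 * q))) / (q * q) * A + 2 * X / q * (- B * c')) (at t within S)"
  proof -
    have "((\<lambda>t. 2 * x t / sqrt (P t)) has_real_derivative (2 * (X * \<sigma>x) * q - 2 * X * (p' / (2 * q))) / (q * q)) (at t within S)"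
      using DERIV_divide[OF DERIV_cmult[OF dx, of 2] dq] q by (simp add: X_def q_def)
    from DERIV_mult[OF this dA] show ?thesis by (simp add: A_def X_def q_def c_def ac_simps)
  qed
  have e1: "(2 * (X * \<sigma>x) * q - 2 * X * (p' / (2 * q))) / (q * q) * A + 2 * X / q * (- B * c')
    = 2 * X / q * (\<sigma>x * A - p' / (2 * p) * A - B * c')"
    unfolding q(2)[symmetric] using q(1) by (simp add: field_simps)
  \<comment> \<open>Once the recurrence is inserted, the two terms with \<open>B * p'\<close>
    cancel, so \<open>B\<close> survives only next to \<open>\<sigma>x\<close>.\<close>
  have e2: "\<sigma>x * A - p' / (2 * p) * A - B * c'
    = \<sigma>x * (p / E) - 2 * \<sigma>x * B / p - p' / (2 * E)"
  proof -
    have A: "A = p / E + 2 * ((X\<^sup>2 - 1) / p) * B"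
      unfolding A_def arc_integral_recurrence[OF c] B_def[symmetric] c1
      by (simp add: c_def X_def p_def)
    show ?thesis unfolding A c'_def using p E by (simp add: field_simps power2_eq_square)
  qed
  \<comment> \<open>\<open>p - 1\<close> is homogeneous of degree 2, so
    \<open>2 * \<sigma>x * p - p'\<close> splits into a scaling term and differences of velocities.
    The differences become the off-diagonal entries, the scaling term goes into the row sum.\<close>
  have e3: "\<sigma>x * (p / E) - 2 * \<sigma>x * B / p - p' / (2 * E)
    = (1 / p) * (p / E - 2 * B) * \<sigma>x + (Y * (X + Z) * (\<sigma>x - \<sigma>y) + Z * (X + Y) * (\<sigma>x - \<sigma>z)) / (2 * E)"
  proof -
    have "2 * \<sigma>x * p - p' = 2 * \<sigma>x + (Y * (X + Z) * (\<sigma>x - \<sigma>y) + Z * (X + Y) * (\<sigma>x - \<sigma>z))"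
      by (simp add: pe p'_def algebra_simps)
    then have "(2 * \<sigma>x * p - p') / (2 * E) = \<sigma>x / E + (Y * (X + Z) * (\<sigma>x - \<sigma>y) + Z * (X + Y) * (\<sigma>x - \<sigma>z)) / (2 * E)"
      by (simp add: add_divide_distrib)
    moreover have "(2 * \<sigma>x * p - p') / (2 * E) = \<sigma>x * (p / E) - p' / (2 * E)"
      by (simp add: diff_divide_distrib)
    moreover have "(1 / p) * (p / E - 2 * B) * \<sigma>x = \<sigma>x / E - 2 * \<sigma>x * B / p"
      using p by (simp add: field_simps)
    ultimately show ?thesis by linarith
  qed
  have e4: "2 * X / q * ((1 / p) * (p / E - 2 * B) * \<sigma>x
      + (Y * (X + Z) * (\<sigma>x - \<sigma>y) + Z * (X + Y) * (\<sigma>x - \<sigma>z)) / (2 * E))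
    = (2 * X / (p * q) * (p / E - 2 * B) + (X * Y / (q * (X + Y)) + X * Z / (q * (X + Z)))) * \<sigma>x
     - X * Y / (q * (X + Y)) * \<sigma>y - X * Z / (q * (X + Z)) * \<sigma>z"
  proof -
    have nz: "X + Y \<noteq> 0" "X + Z \<noteq> 0" "q \<noteq> 0" using pos' q by auto
    have "2 * X / q * ((Y * (X + Z) * (\<sigma>x - \<sigma>y) + Z * (X + Y) * (\<sigma>x - \<sigma>z)) / (2 * E))
      = X * Y / (q * (X + Y)) * (\<sigma>x - \<sigma>y) + X * Z / (q * (X + Z)) * (\<sigma>x - \<sigma>z)"
      unfolding E_def using nz by (simp add: divide_simps) (simp add: algebra_simps)
    moreover have "2 * X / q * ((1 / p) * (p / E - 2 * B) * \<sigma>x + V)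
      = 2 * X / (p * q) * (p / E - 2 * B) * \<sigma>x + 2 * X / q * V" for V
      by (simp add: distrib_left ac_simps)
    moreover have "r * \<sigma>x + (a * (\<sigma>x - \<sigma>y) + b * (\<sigma>x - \<sigma>z)) = (r + (a + b)) * \<sigma>x - a * \<sigma>y - b * \<sigma>z" for r a b
      by (simp add: algebra_simps)
    ultimately show ?thesis by (simp only:)
  qed
  note D = DERIV_cong[OF raw trans[OF e1 trans[OF arg_cong[OF trans[OF e2 e3], of "\<lambda>v. 2 * X / q * v"] e4]]]
  have eq: "1 / (1 + c) = p / E" using c1 by simp
  show ?thesis using D unfolding eq unfolding X_def Y_def Z_def p_def B_def .
qed

lemma face_curvature_has_derivative:
  assumes U: "card U = 3" and i: "i \<in> U"
    and pos: "\<And>v. v \<in> U \<Longrightarrow> 0 < K t v"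
    and d: "\<And>v. v \<in> U \<Longrightarrow> ((\<lambda>t. K t v) has_real_derivative K t v * \<sigma> v) (at t within S)"
  shows "((\<lambda>t. face_curvature U (K t) i) has_real_derivative
    (\<Sum>j\<in>U. face_jacobian U (K t) i j * \<sigma> j)) (at t within S)"
proof -
  obtain j l where U': "U = {i, j, l}" "i \<noteq> j" "i \<noteq> l" "j \<noteq> l" using tripleE[OF U i] .
  have D: "{i, j, l} - {i} = {j, l}" using U' by auto
  have P: "dual_sq U k = 1 + k i * k j + k i * k l + k j * k l" for k
    unfolding U'(1) by (rule dual_sq_triple[OF U'(2-4)])
  have m: "i \<in> U" "j \<in> U" "l \<in> U" using U' by auto
  have J: "face_jacobian U k i i = row_sum U k i + (off_diag U k i j + off_diag U k i l)"
    "face_jacobian U k i j = - off_diag U k i j" "face_jacobian U k i l = - off_diag U k i l" for k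
    using U'(2-4) by (auto simp: face_jacobian_def U'(1) D)
  have sum3: "sum f U = f i + (f j + f l)" for f :: "'a \<Rightarrow> real"
    using U'(2-4) by (simp add: U'(1))
  show ?thesis
    unfolding face_curvature_def P sum3 J off_diag_def row_sum_def
    by (rule DERIV_cong[OF face_curvature_triple_derivative[OF pos[OF m(1)] pos[OF m(2)] pos[OF m(3)]
      d[OF m(1)] d[OF m(2)] d[OF m(3)]]]) (simp add: algebra_simps)
qed

lemma off_diag_sym: "off_diag U k i j = off_diag U k j i"
  by (simp add: off_diag_def ac_simps)

lemma face_jacobian_sym: "face_jacobian U k i j = face_jacobian U k j i"
proof (cases "i = j")
  case False
  then show ?thesis unfolding face_jacobian_def using off_diag_sym[of U k i j] by auto
qed simp

lemma off_diag_pos: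
  assumes U: "card U = 3" and k: "\<And>v. v \<in> U \<Longrightarrow> 0 < k v" and ij: "i \<in> U" "j \<in> U"
  shows "0 < off_diag U k i j"
proof -
  have P: "1 \<le> dual_sq U k" by (rule dual_sq_ge_1[OF U k])
  show ?thesis unfolding off_diag_def using P k[OF ij(1)] k[OF ij(2)]
    by (intro divide_pos_pos mult_pos_pos add_pos_pos) simp_all
qed

lemma row_sum_pos:
  assumes U: "card U = 3" and k: "\<And>v. v \<in> U \<Longrightarrow> 0 < k v" and i: "i \<in> U"
  shows "0 < row_sum U k i"
proof -
  have P: "0 < dual_sq U k" by (rule less_le_trans[OF zero_less_one dual_sq_ge_1[OF U k]])
  have c: "-1 < ((k i)\<^sup>2 - 1) / dual_sq U k" by (rule arc_parameter_gt[OF U k i])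
  show ?thesis unfolding row_sum_def
  proof (intro mult_pos_pos divide_pos_pos)
    show "0 < 1 / (1 + ((k i)\<^sup>2 - 1) / dual_sq U k) - 2 * arc_integral 2 2 (((k i)\<^sup>2 - 1) / dual_sq U k)"
      using arc_integral_less[OF c] by linarith
  qed (use P k[OF i] in simp_all)
qed

text \<open>The form is a weighted graph Laplacian with weights \<open>off_diag\<close>, plus the
  diagonal \<open>row_sum\<close>; the weighted squared differences are dropped.\<close>

lemma face_jacobian_quadratic:
  assumes U: "card U = 3" and k: "\<And>v. v \<in> U \<Longrightarrow> 0 < k v"
  shows "(\<Sum>i\<in>U. row_sum U k i * (x i)\<^sup>2) \<le> (\<Sum>i\<in>U. \<Sum>j\<in>U. face_jacobian U k i j * x i * x j)"
proof -
  have "U \<noteq> {}" using U by auto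
  then obtain i where i: "i \<in> U" by blast
  obtain j l where U': "U = {i, j, l}" "i \<noteq> j" "i \<noteq> l" "j \<noteq> l" using tripleE[OF U i] .
  have D: "{i, j, l} - {i} = {j, l}" "{i, j, l} - {j} = {i, l}" "{i, j, l} - {l} = {i, j}" using U' by auto
  have mem: "i \<in> U" "j \<in> U" "l \<in> U" using U' by auto
  have pos: "0 < off_diag U k v w" if "v \<in> U" "w \<in> U" for v w by (rule off_diag_pos[OF U _ that]) (rule k)
  let ?o = "off_diag U k" and ?J = "face_jacobian U k" and ?r = "row_sum U k"
  have J: "?J i i = ?r i + (?o i j + ?o i l)" "?J j j = ?r j + (?o i j + ?o j l)"
    "?J l l = ?r l + (?o i l + ?o j l)" "?J i j = - ?o i j" "?J j i = - ?o i j"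
    "?J i l = - ?o i l" "?J l i = - ?o i l" "?J j l = - ?o j l" "?J l j = - ?o j l"
    using U'(2-4) off_diag_sym[of U k j i] off_diag_sym[of U k l i] off_diag_sym[of U k l j]
    by (auto simp: face_jacobian_def U'(1) D)
  have sum3: "sum f U = f i + (f j + f l)" for f :: "'a \<Rightarrow> real"
    using U'(2-4) by (simp add: U'(1))
  have "(\<Sum>i\<in>U. \<Sum>j\<in>U. ?J i j * x i * x j) =
    (\<Sum>i\<in>U. ?r i * (x i)\<^sup>2) + ?o i j * (x i - x j)\<^sup>2 + ?o i l * (x i - x l)\<^sup>2 + ?o j l * (x j - x l)\<^sup>2"
    unfolding sum3 J by (simp add: power2_eq_square algebra_simps)
  moreover have "0 \<le> ?o i j * (x i - x j)\<^sup>2" "0 \<le> ?o i l * (x i - x l)\<^sup>2" "0 \<le> ?o j l * (x j - x l)\<^sup>2"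
    using pos[OF mem(1,2)] pos[OF mem(1,3)] pos[OF mem(2,3)] by auto
  ultimately show ?thesis by linarith
qed

section \<open>Potential of a triangle\<close>

lemma continuous_on_dual_sq [continuous_intros]:
  assumes "\<And>v. v \<in> U \<Longrightarrow> continuous_on X (\<lambda>x. K x v)"
  shows "continuous_on X (\<lambda>x. dual_sq U (K x))"
  unfolding dual_sq_def by (intro continuous_intros assms) simp_all

lemma
  assumes U: "card U = 3" and i: "i \<in> U"
    and pos: "\<And>x v. x \<in> X \<Longrightarrow> v \<in> U \<Longrightarrow> 0 < K x v"
    and K: "\<And>v. v \<in> U \<Longrightarrow> continuous_on X (\<lambda>x. K x v)"
  shows continuous_on_face_curvature: "continuous_on X (\<lambda>x. face_curvature U (K x) i)"
    and continuous_on_face_jacobian: "j \<in> U \<Longrightarrow> continuous_on X (\<lambda>x. face_jacobian U (K x) i j)"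
proof -
  have P: "0 < dual_sq U (K x)" if "x \<in> X" for x
    by (rule less_le_trans[OF zero_less_one dual_sq_ge_1[OF U]]) (rule pos[OF that])
  have c: "-1 < ((K x i)\<^sup>2 - 1) / dual_sq U (K x)" if "x \<in> X" for x
    by (rule arc_parameter_gt[OF U _ i]) (rule pos[OF that])
  have Pnz: "\<forall>x\<in>X. dual_sq U (K x) \<noteq> 0" "\<forall>x\<in>X. sqrt (dual_sq U (K x)) \<noteq> 0"
    "\<forall>x\<in>X. dual_sq U (K x) * sqrt (dual_sq U (K x)) \<noteq> 0"
    "\<forall>x\<in>X. 1 + ((K x i)\<^sup>2 - 1) / dual_sq U (K x) \<noteq> 0"
  proof -
    show "\<forall>x\<in>X. dual_sq U (K x) \<noteq> 0" using P by fastforce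
    then show "\<forall>x\<in>X. sqrt (dual_sq U (K x)) \<noteq> 0"
      "\<forall>x\<in>X. dual_sq U (K x) * sqrt (dual_sq U (K x)) \<noteq> 0" by auto
    show "\<forall>x\<in>X. 1 + ((K x i)\<^sup>2 - 1) / dual_sq U (K x) \<noteq> 0"
    proof
      fix x assume "x \<in> X"
      then show "1 + ((K x i)\<^sup>2 - 1) / dual_sq U (K x) \<noteq> 0" using c[of x] by linarith
    qed
  qed
  have Pc: "continuous_on X (\<lambda>x. dual_sq U (K x))" by (rule continuous_on_dual_sq[OF K])
  have cc: "continuous_on X (\<lambda>x. ((K x i)\<^sup>2 - 1) / dual_sq U (K x))"
    by (rule continuous_on_divide[OF _ Pc Pnz(1)]) (intro continuous_intros K i)
  have ac: "continuous_on X (\<lambda>x. arc_integral m n (((K x i)\<^sup>2 - 1) / dual_sq U (K x)))" for m n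
    by (rule continuous_on_arc_integral_compose[OF cc c])
  show "continuous_on X (\<lambda>x. face_curvature U (K x) i)"
    unfolding face_curvature_def
    by (rule continuous_on_mult[OF continuous_on_divide[OF _ continuous_on_real_sqrt[OF Pc] Pnz(2)] ac])
      (intro continuous_intros K i)
  have R: "continuous_on X (\<lambda>x. row_sum U (K x) i)"
    unfolding row_sum_def
  proof (rule continuous_on_mult)
    show "continuous_on X (\<lambda>x. 2 * K x i / (dual_sq U (K x) * sqrt (dual_sq U (K x))))"
      by (rule continuous_on_divide[OF _ continuous_on_mult[OF Pc continuous_on_real_sqrt[OF Pc]] Pnz(3)])
        (intro continuous_intros K i)
    show "continuous_on X (\<lambda>x. 1 / (1 + ((K x i)\<^sup>2 - 1) / dual_sq U (K x))
        - 2 * arc_integral 2 2 (((K x i)\<^sup>2 - 1) / dual_sq U (K x)))"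
      by (rule continuous_on_diff[OF continuous_on_divide[OF continuous_on_const
        continuous_on_add[OF continuous_on_const cc] Pnz(4)] continuous_on_mult[OF continuous_on_const ac]])
  qed
  have O: "continuous_on X (\<lambda>x. off_diag U (K x) i j)" if "j \<in> U" for j
    unfolding off_diag_def
  proof (rule continuous_on_divide)
    show "\<forall>x\<in>X. sqrt (dual_sq U (K x)) * (K x i + K x j) \<noteq> 0"
    proof
      fix x assume x: "x \<in> X"
      show "sqrt (dual_sq U (K x)) * (K x i + K x j) \<noteq> 0"
        using Pnz(2) x add_pos_pos[OF pos[OF x i] pos[OF x that]] by simp
    qed
  qed (intro continuous_intros K i that Pc)+
  show "continuous_on X (\<lambda>x. face_jacobian U (K x) i j)" if "j \<in> U"
  proof (cases "i = j")
    case True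
    show ?thesis unfolding face_jacobian_def if_P[OF True]
      by (intro continuous_on_add R continuous_on_sum O) simp
  next
    case False
    show ?thesis unfolding face_jacobian_def if_not_P[OF False]
      by (intro continuous_on_minus O that)
  qed
qed


lemma face_quadratic_nonneg:
  assumes U: "card U = 3" and k: "\<And>v. v \<in> U \<Longrightarrow> 0 < k v"
  shows "0 \<le> (\<Sum>i\<in>U. \<Sum>j\<in>U. face_jacobian U k i j * x i * x j)"
proof -
  have "0 \<le> (\<Sum>i\<in>U. row_sum U k i * (x i)\<^sup>2)"
    by (intro sum_nonneg mult_nonneg_nonneg less_imp_le[OF row_sum_pos[OF U k]]) auto
  also have "\<dots> \<le> (\<Sum>i\<in>U. \<Sum>j\<in>U. face_jacobian U k i j * x i * x j)"
    by (rule face_jacobian_quadratic[OF U k])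
  finally show ?thesis .
qed

text \<open>
  The Jacobian is symmetric, so the line integral of the total geodesic curvatures from the origin
  is a potential for them, as a function of the logarithms \<open>s\<close> of the curvatures.
\<close>

definition face_potential :: "'v set \<Rightarrow> ('v \<Rightarrow> real) \<Rightarrow> real" where
  "face_potential U s = integral {0..1} (\<lambda>\<tau>. \<Sum>i\<in>U. s i * face_curvature U (\<lambda>v. exp (\<tau> * s v)) i)"

text \<open>Poincare lemma along a curve: after differentiation under the integral sign, the
  integrand \<open>G t0\<close> is the \<open>\<tau>\<close>-derivative of \<open>\<tau>\<close>
  times the pairing of \<open>\<sigma> t0\<close> with the curvatures at
  \<open>\<tau> * s t0\<close>.\<close>

lemma face_potential_has_derivative:
  fixes s \<sigma> :: "real \<Rightarrow> 'v \<Rightarrow> real"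
  assumes U: "card U = 3" and t0: "t0 \<in> {a..b}"
    and s: "\<And>v t. v \<in> U \<Longrightarrow> t \<in> {a..b} \<Longrightarrow> ((\<lambda>t. s t v) has_real_derivative \<sigma> t v) (at t within {a..b})"
    and \<sigma>: "\<And>v. v \<in> U \<Longrightarrow> continuous_on {a..b} (\<lambda>t. \<sigma> t v)"
  shows "((\<lambda>t. face_potential U (s t)) has_real_derivative
    (\<Sum>i\<in>U. \<sigma> t0 i * face_curvature U (\<lambda>v. exp (s t0 v)) i)) (at t0 within {a..b})"
proof -
  define F where "F = (\<lambda>t \<tau>. \<Sum>i\<in>U. s t i * face_curvature U (\<lambda>v. exp (\<tau> * s t v)) i)"
  define G where "G = (\<lambda>t \<tau>. \<Sum>i\<in>U. \<sigma> t i * face_curvature U (\<lambda>v. exp (\<tau> * s t v)) i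
    + s t i * (\<Sum>j\<in>U. face_jacobian U (\<lambda>v. exp (\<tau> * s t v)) i j * (\<tau> * \<sigma> t j)))"
  have fin: "finite U" using U by (simp add: card_ge_0_finite)
  have sc: "continuous_on {a..b} (\<lambda>t. s t v)" if "v \<in> U" for v
    using s[OF that] by (meson DERIV_continuous_on)
  have sc1: "continuous_on ({a..b} \<times> {0..1}) (\<lambda>x. s (fst x) v)"
    and sc2: "continuous_on ({a..b} \<times> {0..1}) (\<lambda>x. \<sigma> (fst x) v)" if "v \<in> U" for v
    by (rule continuous_on_compose2[OF sc[OF that] continuous_on_fst[OF continuous_on_id]], force)
       (rule continuous_on_compose2[OF \<sigma>[OF that] continuous_on_fst[OF continuous_on_id]], force)
  have ec: "continuous_on ({a..b} \<times> {0..1}) (\<lambda>x. exp (snd x * s (fst x) v))" if "v \<in> U" for v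
    by (intro continuous_intros sc1 that)
  have "((\<lambda>t. integral (cbox 0 1) (F t)) has_field_derivative integral (cbox 0 1) (G t0)) (at t0 within {a..b})"
  proof (rule leibniz_rule_field_derivative)
    fix t \<tau> :: real assume t: "t \<in> {a..b}"
    have e: "((\<lambda>t. exp (\<tau> * s t v)) has_real_derivative exp (\<tau> * s t v) * (\<tau> * \<sigma> t v)) (at t within {a..b})"
      if "v \<in> U" for v
      by (auto intro!: derivative_eq_intros s[OF that t])
    show "((\<lambda>t. F t \<tau>) has_field_derivative G t \<tau>) (at t within {a..b})"
      unfolding F_def G_def
    proof (rule DERIV_sum)
      fix i assume i: "i \<in> U"
      have f: "((\<lambda>t. face_curvature U (\<lambda>v. exp (\<tau> * s t v)) i) has_real_derivative
        (\<Sum>j\<in>U. face_jacobian U (\<lambda>v. exp (\<tau> * s t v)) i j * (\<tau> * \<sigma> t j))) (at t within {a..b})"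
        by (rule face_curvature_has_derivative[OF U i]) (use e in auto)
      show "((\<lambda>t. s t i * face_curvature U (\<lambda>v. exp (\<tau> * s t v)) i) has_real_derivative
        \<sigma> t i * face_curvature U (\<lambda>v. exp (\<tau> * s t v)) i
        + s t i * (\<Sum>j\<in>U. face_jacobian U (\<lambda>v. exp (\<tau> * s t v)) i j * (\<tau> * \<sigma> t j))) (at t within {a..b})"
        using DERIV_mult[OF s[OF i t] f] by (simp add: ac_simps)
    qed
  next
    fix t assume t: "t \<in> {a..b}"
    show "F t integrable_on cbox 0 1"
      unfolding F_def cbox_interval
      by (intro integrable_continuous_real continuous_intros continuous_on_face_curvature U) auto
  next
    show "continuous_on ({a..b} \<times> cbox 0 1) (\<lambda>(t, \<tau>). G t \<tau>)"
      unfolding G_def split_def cbox_interval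
      by (intro continuous_intros continuous_on_face_curvature continuous_on_face_jacobian U sc1 sc2 ec) auto
  qed (use t0 in auto)
  moreover have "integral (cbox 0 1) (G t0) = (\<Sum>i\<in>U. \<sigma> t0 i * face_curvature U (\<lambda>v. exp (s t0 v)) i)"
  proof (rule integral_unique)
    let ?H = "\<lambda>\<tau>. \<tau> * (\<Sum>i\<in>U. \<sigma> t0 i * face_curvature U (\<lambda>v. exp (\<tau> * s t0 v)) i)"
    have "(G t0 has_integral ?H 1 - ?H 0) {0..1}"
    proof (rule fundamental_theorem_of_calculus)
      fix \<tau> :: real
      let ?J = "face_jacobian U (\<lambda>v. exp (\<tau> * s t0 v))"
      have e: "((\<lambda>\<tau>. exp (\<tau> * s t0 v)) has_real_derivative exp (\<tau> * s t0 v) * s t0 v) (at \<tau> within {0..1})" for v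
        by (auto intro!: derivative_eq_intros)
      have f: "((\<lambda>\<tau>. face_curvature U (\<lambda>v. exp (\<tau> * s t0 v)) i) has_real_derivative
        (\<Sum>j\<in>U. ?J i j * s t0 j)) (at \<tau> within {0..1})" if i: "i \<in> U" for i
        by (rule face_curvature_has_derivative[OF U i]) (use e in auto)
      have "(?H has_real_derivative 1 * (\<Sum>i\<in>U. \<sigma> t0 i * face_curvature U (\<lambda>v. exp (\<tau> * s t0 v)) i)
        + (\<Sum>i\<in>U. \<sigma> t0 i * (\<Sum>j\<in>U. ?J i j * s t0 j)) * \<tau>) (at \<tau> within {0..1})"
        by (intro DERIV_mult DERIV_ident DERIV_sum DERIV_cmult f)
      moreover have "1 * (\<Sum>i\<in>U. \<sigma> t0 i * face_curvature U (\<lambda>v. exp (\<tau> * s t0 v)) i)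
        + (\<Sum>i\<in>U. \<sigma> t0 i * (\<Sum>j\<in>U. ?J i j * s t0 j)) * \<tau> = G t0 \<tau>"
      proof -
        \<comment> \<open>Symmetry of the Jacobian enters here, exchanging the roles of
          \<open>\<sigma>\<close> and \<open>s\<close>.\<close>
        have "(\<Sum>i\<in>U. \<sigma> t0 i * (\<Sum>j\<in>U. ?J i j * s t0 j)) * \<tau>
          = (\<Sum>i\<in>U. \<Sum>j\<in>U. s t0 j * (?J j i * (\<tau> * \<sigma> t0 i)))"
          unfolding sum_distrib_left sum_distrib_right
          by (intro sum.cong refl) (simp add: face_jacobian_sym ac_simps)
        also have "\<dots> = (\<Sum>j\<in>U. \<Sum>i\<in>U. s t0 j * (?J j i * (\<tau> * \<sigma> t0 i)))" by (rule sum.swap)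
        finally show ?thesis by (simp add: G_def sum.distrib sum_distrib_left)
      qed
      ultimately show "(?H has_vector_derivative G t0 \<tau>) (at \<tau> within {0..1})"
        by (simp add: has_real_derivative_iff_has_vector_derivative)
    qed simp
    then show "(G t0 has_integral (\<Sum>i\<in>U. \<sigma> t0 i * face_curvature U (\<lambda>v. exp (s t0 v)) i)) (cbox 0 1)" by simp
  qed
  ultimately show ?thesis by (simp add: face_potential_def F_def)
qed

text \<open>Convexity as a gradient inequality: the mean value theorem produces
  \<open>\<psi> x\<close> for some \<open>x\<close> between 0 and 1, and \<open>\<psi>\<close> is
  nondecreasing because the Jacobian is positive semidefinite.\<close>

lemma face_potential_tangent:
  assumes U: "card U = 3"
  shows "face_potential U s + (\<Sum>i\<in>U. (s' i - s i) * face_curvature U (\<lambda>v. exp (s v)) i) \<le> face_potential U s'"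
proof -
  define d where "d = (\<lambda>v. s' v - s v)"
  define r where "r = (\<lambda>\<tau> v. s v + \<tau> * d v)"
  define \<psi> where "\<psi> = (\<lambda>\<tau>. \<Sum>i\<in>U. d i * face_curvature U (\<lambda>v. exp (r \<tau> v)) i)"
  have r: "((\<lambda>\<tau>. r \<tau> v) has_real_derivative d v) (at \<tau> within X)" for v \<tau> X
    unfolding r_def by (auto intro!: derivative_eq_intros)
  have mono: "\<psi> 0 \<le> \<psi> \<tau>" if "0 \<le> \<tau>" for \<tau>
  proof (rule DERIV_nonneg_imp_nondecreasing[OF that])
    fix x :: real
    let ?J = "face_jacobian U (\<lambda>v. exp (r x v))"
    have e: "((\<lambda>\<tau>. exp (r \<tau> v)) has_real_derivative exp (r x v) * d v) (at x)" for v
      by (auto intro!: derivative_eq_intros r)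
    have "(\<psi> has_real_derivative (\<Sum>i\<in>U. d i * (\<Sum>j\<in>U. ?J i j * d j))) (at x)"
      unfolding \<psi>_def
      by (intro DERIV_sum DERIV_cmult face_curvature_has_derivative[OF U]) (use e in auto)
    moreover have "(\<Sum>i\<in>U. d i * (\<Sum>j\<in>U. ?J i j * d j)) = (\<Sum>i\<in>U. \<Sum>j\<in>U. ?J i j * d i * d j)"
      by (simp add: sum_distrib_left ac_simps)
    moreover have "0 \<le> (\<Sum>i\<in>U. \<Sum>j\<in>U. ?J i j * d i * d j)"
      by (rule face_quadratic_nonneg[OF U]) simp
    ultimately show "\<exists>y. (\<psi> has_real_derivative y) (at x) \<and> 0 \<le> y" by metis
  qed
  have "((\<lambda>\<tau>. face_potential U (r \<tau>)) has_real_derivative \<psi> x) (at x within {0..1})" if "x \<in> {0..1}" for x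
    unfolding \<psi>_def by (rule face_potential_has_derivative[OF U that]) (auto intro: r)
  then have "\<exists>x\<in>{0<..<1}. face_potential U (r 1) - face_potential U (r 0) = \<psi> x * (1 - 0)"
    by (intro mvt_simple) (auto simp: has_field_derivative_def)
  then obtain x where "0 < x" "face_potential U (r 1) - face_potential U (r 0) = \<psi> x" by auto
  moreover have "r 0 = s" "r 1 = s'" by (auto simp: r_def d_def)
  ultimately show ?thesis using mono[of x] by (simp add: \<psi>_def r_def d_def)
qed

section \<open>Limiting values of the curvatures and lower bounds for the potential\<close>

lemma arc_integral_arctan:
  assumes c: "0 < c"
  shows "arc_integral 0 1 c = arctan (sqrt c) / sqrt c"
proof -
  have "((\<lambda>\<tau>. \<tau> ^ 0 / (1 + c * \<tau>\<^sup>2) ^ 1) has_integral arctan (sqrt c * 1) / sqrt c - arctan (sqrt c * 0) / sqrt c) {0..1}"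
  proof (rule fundamental_theorem_of_calculus)
    fix \<tau> :: real
    have "((\<lambda>\<tau>. arctan (sqrt c * \<tau>)) has_real_derivative inverse (1 + (sqrt c * \<tau>)\<^sup>2) * (sqrt c * 1)) (at \<tau> within {0..1})"
      by (rule DERIV_chain2[OF DERIV_arctan DERIV_cmult[OF DERIV_ident]])
    then have "((\<lambda>\<tau>. arctan (sqrt c * \<tau>) / sqrt c) has_real_derivative \<tau> ^ 0 / (1 + c * \<tau>\<^sup>2) ^ 1) (at \<tau> within {0..1})"
      by (rule DERIV_cong[OF DERIV_cdivide]) (use c in \<open>simp add: power_mult_distrib divide_inverse\<close>)
    then show "((\<lambda>\<tau>. arctan (sqrt c * \<tau>) / sqrt c) has_vector_derivative \<tau> ^ 0 / (1 + c * \<tau>\<^sup>2) ^ 1) (at \<tau> within {0..1})"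
      by (simp only: has_real_derivative_iff_has_vector_derivative)
  qed simp
  then show ?thesis unfolding arc_integral_def by (simp add: integral_unique)
qed

lemma arc_integral_at_0: "arc_integral 0 1 0 = 1"
  by (simp add: arc_integral_def)

text \<open>For negative \<open>c\<close> the denominator \<open>1 + c * \<tau>\<^sup>2\<close> is
  at least \<open>1 + c * \<tau>\<close>. Crude, but it limits the growth as \<open>c\<close> tends
  to \<open>-1\<close> to a logarithm.\<close>

lemma arc_integral_le_ln:
  assumes c: "-1 < c" "c < 0"
  shows "arc_integral 0 1 c \<le> ln (1 + c) / c"
proof -
  have "((\<lambda>\<tau>. 1 / (1 + c * \<tau>)) has_integral ln (1 + c * 1) / c - ln (1 + c * 0) / c) {0..1}"
  proof (rule fundamental_theorem_of_calculus)
    fix \<tau> :: real assume t: "\<tau> \<in> {0..1}"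
    have "-1 < c * \<tau>"
    proof -
      have "c * 1 \<le> c * \<tau>" using c t by (intro mult_left_mono_neg) auto
      then show ?thesis using c by linarith
    qed
    then have p: "0 < 1 + c * \<tau>" by simp
    have "((\<lambda>\<tau>. 1 + c * \<tau>) has_real_derivative c) (at \<tau> within {0..1})"
      by (auto intro!: derivative_eq_intros)
    from DERIV_cdivide[OF DERIV_chain2[OF DERIV_ln[OF p] this], of c]
    have "((\<lambda>\<tau>. ln (1 + c * \<tau>) / c) has_real_derivative 1 / (1 + c * \<tau>)) (at \<tau> within {0..1})"
      by (rule DERIV_cong) (use c in \<open>simp add: divide_inverse\<close>)
    then show "((\<lambda>\<tau>. ln (1 + c * \<tau>) / c) has_vector_derivative 1 / (1 + c * \<tau>)) (at \<tau> within {0..1})"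
      by (simp only: has_real_derivative_iff_has_vector_derivative)
  qed simp
  then have i: "((\<lambda>\<tau>. 1 / (1 + c * \<tau>)) has_integral ln (1 + c) / c) {0..1}" by simp
  show ?thesis unfolding arc_integral_def
  proof (rule has_integral_le[OF integrable_integral[OF arc_integrand_integrable[OF c(1)]] i])
    fix \<tau> :: real assume t: "\<tau> \<in> {0..1}"
    have "-1 < c * \<tau>"
    proof -
      have "c * 1 \<le> c * \<tau>" using c t by (intro mult_left_mono_neg) auto
      then show ?thesis using c by linarith
    qed
    then have p: "0 < 1 + c * \<tau>" by simp
    have "\<tau>\<^sup>2 \<le> \<tau>" using t by (simp add: power2_eq_square mult_left_le)
    then have "c * \<tau> \<le> c * \<tau>\<^sup>2" using c by (intro mult_left_mono_neg) auto
    then show "\<tau> ^ 0 / (1 + c * \<tau>\<^sup>2) ^ 1 \<le> 1 / (1 + c * \<tau>)" using p by (simp add: frac_le)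
  qed
qed

text \<open>
  The witness has curvature \<open>K\<close> at \<open>i\<close> and 1 elsewhere, with \<open>K\<close> tending to infinity; the choice
  \<open>K = 2 * m\<^sup>2 + 1\<close> makes the parameter \<open>c\<close> of the arc integral equal to \<open>m\<^sup>2\<close>.
\<close>

lemma face_curvature_corner:
  assumes U: "card U = 3" and i: "i \<in> U" and e: "0 < e"
  obtains s where "\<bar>face_curvature U (\<lambda>v. exp (s v)) i - pi\<bar> < e"
    "\<And>j. j \<in> U \<Longrightarrow> j \<noteq> i \<Longrightarrow> \<bar>face_curvature U (\<lambda>v. exp (s v)) j\<bar> < e"
proof -
  have 1: "((\<lambda>m. (2 * m\<^sup>2 + 1) / sqrt (m\<^sup>2 + 1) * (arctan m / m)) \<longlongrightarrow> pi) at_top"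
    by real_asymp
  have 2: "((\<lambda>m. 1 / sqrt (m\<^sup>2 + 1)) \<longlongrightarrow> (0::real)) at_top"
    by real_asymp
  from tendstoD[OF 1 e] tendstoD[OF 2 e] eventually_gt_at_top[of "0::real"]
  have "\<forall>\<^sub>F m in at_top. dist ((2 * m\<^sup>2 + 1) / sqrt (m\<^sup>2 + 1) * (arctan m / m)) pi < e
    \<and> dist (1 / sqrt (m\<^sup>2 + 1)) 0 < e \<and> 0 < m"
    by eventually_elim blast
  then obtain m :: real where m: "\<bar>(2 * m\<^sup>2 + 1) / sqrt (m\<^sup>2 + 1) * (arctan m / m) - pi\<bar> < e"
    "\<bar>1 / sqrt (m\<^sup>2 + 1)\<bar> < e" "0 < m"
    unfolding dist_real_def eventually_at_top_linorder by auto
  define K where "K = 2 * m\<^sup>2 + 1"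
  have K: "0 < K" by (simp add: K_def add_nonneg_pos)
  define s where "s = (\<lambda>v. if v = i then ln K else 0)"
  have ex: "(\<lambda>v. exp (s v)) = (\<lambda>v. if v = i then K else 1)" using K by (auto simp: s_def)
  obtain j l where U': "U = {i, j, l}" "i \<noteq> j" "i \<noteq> l" "j \<noteq> l" using tripleE[OF U i] .
  have P: "dual_sq U (\<lambda>v. if v = i then K else 1) = (2::real)\<^sup>2 * (m\<^sup>2 + 1)"
    unfolding U'(1) dual_sq_triple[OF U'(2-4)] using U'(2-4) by (simp add: K_def)
  have q: "sqrt ((2::real)\<^sup>2 * (m\<^sup>2 + 1)) = 2 * sqrt (m\<^sup>2 + 1)"
    by (simp only: real_sqrt_mult real_sqrt_abs abs_numeral)
  have "m\<^sup>2 + 1 \<noteq> 0" using zero_le_power2[of m] by linarith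
  moreover have "K\<^sup>2 - 1 = m\<^sup>2 * ((2::real)\<^sup>2 * (m\<^sup>2 + 1))" by (simp add: K_def power2_eq_square algebra_simps)
  ultimately have c: "(K\<^sup>2 - 1) / ((2::real)\<^sup>2 * (m\<^sup>2 + 1)) = m\<^sup>2" by simp
  have h: "2 * K / (2 * sqrt (m\<^sup>2 + 1)) = K / sqrt (m\<^sup>2 + 1)" by simp
  have "face_curvature U (\<lambda>v. exp (s v)) i = (2 * m\<^sup>2 + 1) / sqrt (m\<^sup>2 + 1) * (arctan m / m)"
    unfolding ex face_curvature_def if_P[OF refl] unfolding P q c
      arc_integral_arctan[OF zero_less_power[OF m(3)]] h real_sqrt_abs abs_of_pos[OF m(3)]
    by (simp only: K_def)
  \<comment> \<open>The other two curvatures are 1, so their parameter is 0 and their arc integral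
    1.\<close>
  moreover have "face_curvature U (\<lambda>v. exp (s v)) j = 1 / sqrt (m\<^sup>2 + 1)" if "j \<noteq> i" for j
    unfolding ex face_curvature_def if_not_P[OF that] unfolding P q by (simp add: arc_integral_at_0[unfolded One_nat_def])
  ultimately show ?thesis using m that[of s] by simp
qed

text \<open>All three curvatures are set to a small \<open>d\<close>. Then
  \<open>1 + c d = 4 * d\<^sup>2 / (1 + 3 * d\<^sup>2)\<close>, and the factor \<open>d\<close>
  beats the logarithm from \<open>arc_integral_le_ln\<close>.\<close>

lemma face_curvature_origin:
  assumes U: "card U = 3" and e: "0 < e"
  obtains s where "\<And>j. j \<in> U \<Longrightarrow> \<bar>face_curvature U (\<lambda>v. exp (s v)) j\<bar> < e"
proof -
  define c where "c = (\<lambda>d::real. (d\<^sup>2 - 1) / (1 + 3 * d\<^sup>2))"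
  have "((\<lambda>d. 2 * d * (ln (1 + c d) / c d)) \<longlongrightarrow> 0) (at_right 0)"
    unfolding c_def by real_asymp
  from tendstoD[OF this e]
  have "\<forall>\<^sub>F d in at_right 0. dist (2 * d * (ln (1 + c d) / c d)) 0 < e" .
  moreover have "\<forall>\<^sub>F d in at_right 0. d < (1::real)" "\<forall>\<^sub>F d in at_right 0. 0 < (d::real)"
    by (rule eventually_at_rightI[of 0 1]; simp)+
  ultimately have "\<forall>\<^sub>F d in at_right 0. \<bar>2 * d * (ln (1 + c d) / c d)\<bar> < e \<and> d < 1 \<and> 0 < d"
    by eventually_elim simp
  then obtain d where d: "\<bar>2 * d * (ln (1 + c d) / c d)\<bar> < e" "d < 1" "0 < d"
    using eventually_happens'[OF trivial_limit_at_right_real] by blast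
  have d2: "d\<^sup>2 < 1" using d by (simp add: power_less_one_iff abs_square_less_1)
  obtain i where i: "i \<in> U" using U by (metis card.empty ex_in_conv zero_neq_numeral)
  obtain j l where U': "U = {i, j, l}" "i \<noteq> j" "i \<noteq> l" "j \<noteq> l" using tripleE[OF U i] .
  have P: "dual_sq U (\<lambda>v. d) = 1 + 3 * d\<^sup>2"
    unfolding U'(1) dual_sq_triple[OF U'(2-4)] by (simp add: power2_eq_square)
  have c: "-1 < c d" "c d < 0"
    using arc_parameter_gt[OF U _ i, of "\<lambda>v. d"] d P d2 by (auto simp: c_def divide_neg_pos add_pos_pos)
  have "\<bar>face_curvature U (\<lambda>v. exp (ln d)) j\<bar> < e" if "j \<in> U" for j
  proof -
    have A: "0 \<le> arc_integral 0 1 (c d)" "arc_integral 0 1 (c d) \<le> ln (1 + c d) / c d"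
      using arc_integral_nonneg arc_integral_le_ln c by auto
    have "1 \<le> sqrt (1 + 3 * d\<^sup>2)" by simp
    then have "2 * d / sqrt (1 + 3 * d\<^sup>2) \<le> 2 * d / 1"
      using d by (intro divide_left_mono) (auto simp: add_pos_nonneg)
    then have "2 * d / sqrt (1 + 3 * d\<^sup>2) \<le> 2 * d" by simp
    then have "2 * d / sqrt (1 + 3 * d\<^sup>2) * arc_integral 0 1 (c d) \<le> 2 * d * (ln (1 + c d) / c d)"
      using A d by (intro mult_mono) auto
    moreover have "0 \<le> 2 * d / sqrt (1 + 3 * d\<^sup>2) * arc_integral 0 1 (c d)" using A d by simp
    moreover have "face_curvature U (\<lambda>v. exp (ln d)) j = 2 * d / sqrt (1 + 3 * d\<^sup>2) * arc_integral 0 1 (c d)"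
      using d P by (simp add: face_curvature_def c_def)
    ultimately show ?thesis using d(1) by linarith
  qed
  then show ?thesis by (rule that[of "\<lambda>v. ln d"])
qed

text \<open>The tangent plane at \<open>s0\<close> has slopes within \<open>e\<close> of
  \<open>b\<close>; replacing them by \<open>b\<close> costs \<open>e\<close> times the sum of the
  \<open>\<bar>s j\<bar>\<close>, and the values at the base point go into \<open>C\<close>.\<close>

lemma face_potential_affine_bound:
  assumes U: "card U = 3" and b: "\<And>j. j \<in> U \<Longrightarrow> \<bar>face_curvature U (\<lambda>v. exp (s0 v)) j - b j\<bar> < e"
  shows "\<exists>C. \<forall>s. (\<Sum>j\<in>U. b j * s j) - e * (\<Sum>j\<in>U. \<bar>s j\<bar>) - C \<le> face_potential U s"
proof (intro exI allI)
  fix s :: "'a \<Rightarrow> real"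
  let ?T = "face_curvature U (\<lambda>v. exp (s0 v))"
  have "b j * s j - e * \<bar>s j\<bar> \<le> ?T j * s j" if "j \<in> U" for j
  proof -
    have "\<bar>(?T j - b j) * s j\<bar> \<le> e * \<bar>s j\<bar>"
      unfolding abs_mult using b[OF that] by (intro mult_right_mono) auto
    moreover have "(?T j - b j) * s j = ?T j * s j - b j * s j" by (rule left_diff_distrib)
    ultimately show ?thesis by linarith
  qed
  then have "(\<Sum>j\<in>U. b j * s j - e * \<bar>s j\<bar>) \<le> (\<Sum>j\<in>U. ?T j * s j)" by (rule sum_mono)
  moreover have "(\<Sum>i\<in>U. (s i - s0 i) * ?T i) = (\<Sum>j\<in>U. ?T j * s j) - (\<Sum>j\<in>U. ?T j * s0 j)"
    by (simp add: algebra_simps sum_subtractf)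
  ultimately show "(\<Sum>j\<in>U. b j * s j) - e * (\<Sum>j\<in>U. \<bar>s j\<bar>)
    - ((\<Sum>j\<in>U. ?T j * s0 j) - face_potential U s0) \<le> face_potential U s"
    using face_potential_tangent[OF U, of s0 s] by (simp add: sum_subtractf sum_distrib_left)
qed

text \<open>Four tangent planes, one with slopes near 0 and one for each corner, are merged under
  the largest of their four constants.\<close>

lemma face_potential_lower_bound:
  assumes U: "card U = 3" and e: "0 < e"
  obtains C where "\<And>s. - e * (\<Sum>j\<in>U. \<bar>s j\<bar>) - C \<le> face_potential U s"
    "\<And>s i. i \<in> U \<Longrightarrow> pi * s i - e * (\<Sum>j\<in>U. \<bar>s j\<bar>) - C \<le> face_potential U s"
proof -
  have fin: "finite U" using U by (simp add: card_ge_0_finite)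
  obtain s0 where "\<And>j. j \<in> U \<Longrightarrow> \<bar>face_curvature U (\<lambda>v. exp (s0 v)) j - 0\<bar> < e"
    using face_curvature_origin[OF U e] by (metis diff_zero)
  then obtain C0 where C0: "\<And>s. (\<Sum>j\<in>U. 0 * s j) - e * (\<Sum>j\<in>U. \<bar>s j\<bar>) - C0 \<le> face_potential U s"
    using face_potential_affine_bound[OF U, of s0 "\<lambda>j. 0" e] by blast
  have "\<exists>C. \<forall>s. pi * s i - e * (\<Sum>j\<in>U. \<bar>s j\<bar>) - C \<le> face_potential U s" if i: "i \<in> U" for i
  proof -
    obtain s1 where s1: "\<bar>face_curvature U (\<lambda>v. exp (s1 v)) i - pi\<bar> < e"
      "\<And>j. j \<in> U \<Longrightarrow> j \<noteq> i \<Longrightarrow> \<bar>face_curvature U (\<lambda>v. exp (s1 v)) j\<bar> < e"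
      using face_curvature_corner[OF U i e] by blast
    have bd: "\<bar>face_curvature U (\<lambda>v. exp (s1 v)) j - (if j = i then pi else 0)\<bar> < e" if "j \<in> U" for j
      using s1 that by auto
    obtain C where C: "\<And>s. (\<Sum>j\<in>U. (if j = i then pi else 0) * s j) - e * (\<Sum>j\<in>U. \<bar>s j\<bar>) - C \<le> face_potential U s"
      using face_potential_affine_bound[OF U, of s1 "\<lambda>j. if j = i then pi else 0" e] bd by blast
    have S: "(\<Sum>j\<in>U. (if j = i then pi else 0) * s j) = pi * s i" for s :: "'a \<Rightarrow> real"
    proof -
      have "(\<Sum>j\<in>U. (if j = i then pi else 0) * s j) = (\<Sum>j\<in>U. if j = i then pi * s i else 0)"
        by (rule sum.cong) auto
      then show ?thesis using i fin by simp
    qed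
    show ?thesis using C unfolding S by blast
  qed
  then obtain C1 where C1: "\<And>i s. i \<in> U \<Longrightarrow> pi * s i - e * (\<Sum>j\<in>U. \<bar>s j\<bar>) - C1 i \<le> face_potential U s"
    by metis
  define C where "C = Max (insert C0 (C1 ` U))"
  have "C0 \<le> C" "\<And>i. i \<in> U \<Longrightarrow> C1 i \<le> C" unfolding C_def using fin by auto
  note le = this
  show ?thesis
  proof (rule that[of C])
    show "- e * (\<Sum>j\<in>U. \<bar>s j\<bar>) - C \<le> face_potential U s" for s
      using C0[of s] le(1) by simp
    show "pi * s i - e * (\<Sum>j\<in>U. \<bar>s j\<bar>) - C \<le> face_potential U s" if "i \<in> U" for s i
      using C1[OF that, of s] le(2)[OF that] by linarith
  qed
qed

section \<open>Ordinary differential equations\<close>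

text \<open>Successive approximation. The Lipschitz bound, which also says that only the coordinates
  in \<open>I\<close> influence the components in \<open>I\<close>, is global; so the iterates
  converge uniformly on every \<open>{0..r}\<close> and no continuation of local solutions is
  needed.\<close>

lemma picard_global_solution:
  fixes F :: "('v \<Rightarrow> real) \<Rightarrow> 'v \<Rightarrow> real" and x0 :: "'v \<Rightarrow> real"
  assumes fin: "finite I" and L0: "0 \<le> L"
    and L: "\<And>x y i. i \<in> I \<Longrightarrow> \<bar>F x i - F y i\<bar> \<le> L * (\<Sum>j\<in>I. \<bar>x j - y j\<bar>)"
  obtains x where "\<And>i. x 0 i = x0 i"
    "\<And>t i. 0 \<le> t \<Longrightarrow> i \<in> I \<Longrightarrow> ((\<lambda>t. x t i) has_real_derivative F (x t) i) (at t within {0..})"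
proof -
  define X :: "nat \<Rightarrow> real \<Rightarrow> 'v \<Rightarrow> real"
    where "X = rec_nat (\<lambda>t. x0) (\<lambda>n xn t i. x0 i + integral {0..t} (\<lambda>\<tau>. F (xn \<tau>) i))"
  have X0: "X 0 = (\<lambda>t. x0)" and XS: "X (Suc n) = (\<lambda>t i. x0 i + integral {0..t} (\<lambda>\<tau>. F (X n \<tau>) i))" for n
    by (simp_all add: X_def)
  have Fcont: "continuous_on S (\<lambda>t. F (x t) i)"
    if i: "i \<in> I" and c: "\<And>j. j \<in> I \<Longrightarrow> continuous_on S (\<lambda>t. x t j)" for S :: "real set" and x i
  proof (rule continuous_on_eq[of S "\<lambda>t. F (x t) i"], unfold continuous_on_def, intro ballI)
    fix t assume t: "t \<in> S"
    have "((\<lambda>\<tau>. L * (\<Sum>j\<in>I. \<bar>x \<tau> j - x t j\<bar>)) \<longlongrightarrow> L * (\<Sum>j\<in>I. \<bar>x t j - x t j\<bar>)) (at t within S)"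
      using c t unfolding continuous_on_def by (intro tendsto_intros) auto
    then have z: "((\<lambda>\<tau>. L * (\<Sum>j\<in>I. \<bar>x \<tau> j - x t j\<bar>)) \<longlongrightarrow> 0) (at t within S)" by simp
    have "((\<lambda>\<tau>. F (x \<tau>) i - F (x t) i) \<longlongrightarrow> 0) (at t within S)"
      by (rule Lim_null_comparison[OF _ z]) (use L[OF i] in \<open>auto simp: eventually_at_filter\<close>)
    then show "((\<lambda>\<tau>. F (x \<tau>) i) \<longlongrightarrow> F (x t) i) (at t within S)" by (rule LIM_zero_cancel)
  qed simp
  have Xc: "continuous_on {0..r} (\<lambda>t. X n t i)" if "i \<in> I" for n i r
    using that
  proof (induction n arbitrary: i)
    case (Suc n)
    have "(\<lambda>\<tau>. F (X n \<tau>) i) integrable_on {0..r}"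
      by (rule integrable_continuous_real, rule Fcont[where x = "X n", OF Suc.prems Suc.IH])
    then show ?case unfolding XS
      by (intro continuous_on_add continuous_on_const indefinite_integral_continuous_1)
  qed (simp add: X0)
  have XFc: "continuous_on {0..r} (\<lambda>t. F (X n t) i)" if "i \<in> I" for n i r
    by (rule Fcont[OF that]) (rule Xc)
  define N where "N = real (card I)"
  define B where "B = (\<Sum>i\<in>I. \<bar>F x0 i\<bar>)"
  have B: "0 \<le> B" by (simp add: B_def sum_nonneg)
  have N: "0 \<le> N" by (simp add: N_def)
  \<comment> \<open>The usual factorial estimate; \<open>N * L\<close> replaces \<open>L\<close>
    because the Lipschitz bound sums over the \<open>N\<close> coordinates.\<close>
  have step: "\<bar>X (Suc n) t i - X n t i\<bar> \<le> B * (N * L) ^ n * t ^ Suc n / fact (Suc n)"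
    if "0 \<le> t" "i \<in> I" for n t i
    using that
  proof (induction n arbitrary: t i)
    case 0
    have "\<bar>F x0 i\<bar> \<le> B" unfolding B_def by (rule member_le_sum[OF 0(2)]) (use fin in auto)
    then have "\<bar>F x0 i\<bar> * t \<le> B * t" using 0(1) by (rule mult_right_mono)
    then show ?case using 0 by (simp add: XS X0 abs_mult mult.commute)
  next
    case (Suc n)
    have int: "(\<lambda>\<tau>. F (X m \<tau>) i) integrable_on {0..t}" for m
      by (rule integrable_continuous_real, rule XFc[OF Suc(3)])
    have "X (Suc (Suc n)) t i = x0 i + integral {0..t} (\<lambda>\<tau>. F (X (Suc n) \<tau>) i)"
      "X (Suc n) t i = x0 i + integral {0..t} (\<lambda>\<tau>. F (X n \<tau>) i)" by (subst XS, rule refl)+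
    then have d: "X (Suc (Suc n)) t i - X (Suc n) t i = integral {0..t} (\<lambda>\<tau>. F (X (Suc n) \<tau>) i - F (X n \<tau>) i)"
      unfolding integral_diff[OF int int] by linarith
    let ?c = "B * (N * L) ^ Suc n / fact (Suc n)"
    have hi: "((\<lambda>\<tau>. ?c * \<tau> ^ Suc n) has_integral ?c * (t ^ Suc (Suc n) / Suc (Suc n)) - ?c * (0 ^ Suc (Suc n) / Suc (Suc n))) {0..t}"
    proof (rule fundamental_theorem_of_calculus)
      fix \<tau> :: real
      have D: "((\<lambda>\<tau>. \<tau> ^ Suc (Suc n)) has_real_derivative (1 + real (Suc n)) * (1 * \<tau> ^ Suc n)) (at \<tau> within {0..t})"
        by (rule DERIV_power_Suc[OF DERIV_ident])
      have cancel: "c * ((1 + (1 + real n)) * (1 * y) / (1 + (1 + real n))) = c * y" for c y :: real by simp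
      from DERIV_cmult[OF DERIV_cdivide[OF D, of "real (Suc (Suc n))"], of ?c]
      show "((\<lambda>\<tau>. ?c * (\<tau> ^ Suc (Suc n) / Suc (Suc n))) has_vector_derivative ?c * \<tau> ^ Suc n) (at \<tau> within {0..t})"
        unfolding has_real_derivative_iff_has_vector_derivative[symmetric]
        by (rule DERIV_cong) (simp only: cancel of_nat_Suc)
    qed (use Suc in simp)
    have "\<bar>integral {0..t} (\<lambda>\<tau>. F (X (Suc n) \<tau>) i - F (X n \<tau>) i)\<bar> \<le> integral {0..t} (\<lambda>\<tau>. ?c * \<tau> ^ Suc n)"
      unfolding real_norm_def[symmetric]
    proof (rule integral_norm_bound_integral)
      show "(\<lambda>\<tau>. F (X (Suc n) \<tau>) i - F (X n \<tau>) i) integrable_on {0..t}"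
        by (intro integrable_continuous_real continuous_on_diff XFc Suc(3))
      show "(\<lambda>\<tau>. ?c * \<tau> ^ Suc n) integrable_on {0..t}" using hi by blast
      fix \<tau> assume t: "\<tau> \<in> {0..t}"
      have "\<bar>F (X (Suc n) \<tau>) i - F (X n \<tau>) i\<bar> \<le> L * (\<Sum>j\<in>I. \<bar>X (Suc n) \<tau> j - X n \<tau> j\<bar>)"
        by (rule L[OF Suc(3)])
      also have "\<dots> \<le> L * (\<Sum>j\<in>I. B * (N * L) ^ n * \<tau> ^ Suc n / fact (Suc n))"
        using t by (intro mult_left_mono[OF _ L0] sum_mono Suc.IH) auto
      also have "\<dots> = ?c * \<tau> ^ Suc n" by (simp add: N_def)
      finally show "norm (F (X (Suc n) \<tau>) i - F (X n \<tau>) i) \<le> ?c * \<tau> ^ Suc n" by simp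
    qed
    also have "\<dots> = B * (N * L) ^ Suc n * t ^ Suc (Suc n) / fact (Suc (Suc n))"
      using integral_unique[OF hi] by (simp add: ac_simps)
    finally show ?case unfolding d .
  qed
  define M where "M = (\<lambda>r n. B * (N * L) ^ n * r ^ Suc n / fact (Suc n))"
  have Msum: "summable (M r)" for r
  proof -
    have le: "norm (M r n) \<le> norm (B * r * (inverse (fact n) * (N * L * r) ^ n))" for n
    proof -
      have "M r n = B * r * (inverse (fact n) * (N * L * r) ^ n) * inverse (real (Suc n))"
        by (simp add: M_def power_mult_distrib divide_inverse)
      then have "norm (M r n) = norm (B * r * (inverse (fact n) * (N * L * r) ^ n)) * inverse (real (Suc n))"
        by (simp only: norm_mult) simp
      also have "\<dots> \<le> norm (B * r * (inverse (fact n) * (N * L * r) ^ n))"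
        by (intro mult_left_le) (auto simp: inverse_le_1_iff)
      finally show ?thesis .
    qed
    have "summable (\<lambda>n. norm (B * r * (inverse (fact n) * (N * L * r) ^ n)))"
    proof -
      have "summable (\<lambda>n. norm (B * r) * (inverse (fact n) * norm (N * L * r) ^ n))"
        by (intro summable_mult summable_exp)
      then show ?thesis by (simp only: norm_mult norm_power norm_inverse norm_fact)
    qed
    then show ?thesis by (rule summable_comparison_test'[where N = 0]) (rule le)
  qed
  define x where "x = (\<lambda>t i. x0 i + (\<Sum>n. X (Suc n) t i - X n t i))"
  have tele: "X n t i = x0 i + (\<Sum>m<n. X (Suc m) t i - X m t i)" for n t i
    by (induction n) (simp_all add: X0)
  have unif: "uniform_limit {0..r} (\<lambda>n t. X n t i) (\<lambda>t. x t i) sequentially" if i: "i \<in> I" for i r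
  proof -
    have "uniform_limit {0..r} (\<lambda>n t. \<Sum>m<n. X (Suc m) t i - X m t i) (\<lambda>t. \<Sum>m. X (Suc m) t i - X m t i) sequentially"
    proof (rule Weierstrass_m_test[OF _ Msum[of r]])
      fix n t assume t: "t \<in> {0..r}"
      have "\<bar>X (Suc n) t i - X n t i\<bar> \<le> B * (N * L) ^ n * t ^ Suc n / fact (Suc n)"
        by (rule step) (use t i in auto)
      also have "\<dots> \<le> M r n" unfolding M_def
        using t B N L0 by (intro divide_right_mono mult_left_mono power_mono mult_nonneg_nonneg zero_le_power) auto
      finally show "norm (X (Suc n) t i - X n t i) \<le> M r n" by simp
    qed
    then have "uniform_limit {0..r} (\<lambda>n t. x0 i + (\<Sum>m<n. X (Suc m) t i - X m t i)) (\<lambda>t. x t i) sequentially"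
      unfolding x_def by (intro uniform_limit_add uniform_limit_const)
    then show ?thesis by (subst tele)
  qed
  have xc: "continuous_on {0..r} (\<lambda>t. x t i)" if "i \<in> I" for i r
    by (rule uniform_limit_theorem[OF _ unif[OF that]]) (simp_all add: Xc that)
  have xFc: "continuous_on {0..r} (\<lambda>t. F (x t) i)" if "i \<in> I" for i r
    by (rule Fcont[OF that]) (rule xc)
  have lim: "(\<lambda>n. X n t i) \<longlonglongrightarrow> x t i" if "i \<in> I" "0 \<le> t" for i t
    by (rule tendsto_uniform_limitI[OF unif[OF that(1), of t]]) (use that in auto)
  \<comment> \<open>The integral equation passes to the limit because the Lipschitz bound carries
    the uniform convergence of the iterates over to \<open>F\<close>.\<close>
  have fix_eq: "x t i = x0 i + integral {0..t} (\<lambda>\<tau>. F (x \<tau>) i)" if i: "i \<in> I" and t: "0 \<le> t" for i t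
  proof -
    have one: "uniform_limit {0..t} (\<lambda>n \<tau>. \<bar>X n \<tau> j - x \<tau> j\<bar>) (\<lambda>\<tau>. 0) sequentially" if "j \<in> I" for j
      using unif[OF that, of t] by (auto simp: uniform_limit_iff dist_real_def)
    have u: "uniform_limit {0..t} (\<lambda>n \<tau>. \<Sum>j\<in>I'. \<bar>X n \<tau> j - x \<tau> j\<bar>) (\<lambda>\<tau>. 0) sequentially"
      if "finite I'" "I' \<subseteq> I" for I'
      using that
    proof (induction I')
      case (insert j I')
      then have "uniform_limit {0..t} (\<lambda>n \<tau>. \<bar>X n \<tau> j - x \<tau> j\<bar> + (\<Sum>j\<in>I'. \<bar>X n \<tau> j - x \<tau> j\<bar>)) (\<lambda>\<tau>. 0 + 0) sequentially"
        by (intro uniform_limit_add one) auto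
      then show ?case using insert.hyps by simp
    qed (simp add: uniform_limit_const)
    have uF: "uniform_limit {0..t} (\<lambda>n \<tau>. F (X n \<tau>) i) (\<lambda>\<tau>. F (x \<tau>) i) sequentially"
      unfolding uniform_limit_iff
    proof (intro allI impI)
      fix e :: real assume e: "0 < e"
      have "0 < e / (L + 1)" using e L0 by simp
      from uniform_limitD[OF u[OF fin order_refl] this]
      have "\<forall>\<^sub>F n in sequentially. \<forall>\<tau>\<in>{0..t}. (\<Sum>j\<in>I. \<bar>X n \<tau> j - x \<tau> j\<bar>) < e / (L + 1)"
        by (simp add: dist_real_def)
      then show "\<forall>\<^sub>F n in sequentially. \<forall>\<tau>\<in>{0..t}. dist (F (X n \<tau>) i) (F (x \<tau>) i) < e"
      proof eventually_elim
        case (elim n)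
        show ?case
        proof
          fix \<tau> assume "\<tau> \<in> {0..t}"
          then have s: "(\<Sum>j\<in>I. \<bar>X n \<tau> j - x \<tau> j\<bar>) < e / (L + 1)" using elim by blast
          have "\<bar>F (X n \<tau>) i - F (x \<tau>) i\<bar> \<le> L * (\<Sum>j\<in>I. \<bar>X n \<tau> j - x \<tau> j\<bar>)" by (rule L[OF i])
          also have "\<dots> \<le> L * (e / (L + 1))" using s L0 by (intro mult_left_mono) auto
          also have "\<dots> < e" using e L0 by (simp add: field_simps)
          finally show "dist (F (X n \<tau>) i) (F (x \<tau>) i) < e" by (simp add: dist_real_def)
        qed
      qed
    qed
    obtain Q J where Q: "\<And>n. ((\<lambda>\<tau>. F (X n \<tau>) i) has_integral Q n) {0..t}"
      and J: "((\<lambda>\<tau>. F (x \<tau>) i) has_integral J) {0..t}" and QJ: "Q \<longlonglongrightarrow> J"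
      by (rule uniform_limit_integral[OF uF XFc[OF i] sequentially_bot]) auto
    have "X (Suc n) t i = x0 i + Q n" for n
      by (subst XS) (simp add: integral_unique[OF Q])
    then have "(\<lambda>n. X (Suc n) t i) \<longlonglongrightarrow> x0 i + J" using tendsto_add[OF tendsto_const QJ, of "x0 i"] by simp
    then have "x t i = x0 i + J" by (rule LIMSEQ_unique[OF LIMSEQ_Suc[OF lim[OF i t]]])
    then show ?thesis by (simp only: integral_unique[OF J])
  qed
  have x0: "x 0 i = x0 i" for i
  proof -
    have "X (Suc n) 0 i - X n 0 i = 0" for n by (cases n) (simp_all add: X0 XS)
    then show ?thesis by (simp add: x_def)
  qed
  have "((\<lambda>t. x t i) has_real_derivative F (x t) i) (at t within {0..})" if t: "0 \<le> t" and i: "i \<in> I" for t i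
  proof -
    have "((\<lambda>u. integral {0..u} (\<lambda>\<tau>. F (x \<tau>) i)) has_real_derivative F (x t) i) (at t within {0..t + 1})"
      by (rule integral_has_real_derivative[OF xFc[OF i]]) (use t in auto)
    then have "((\<lambda>u. x0 i + integral {0..u} (\<lambda>\<tau>. F (x \<tau>) i)) has_real_derivative F (x t) i) (at t within {0..t + 1})"
      using DERIV_add[OF DERIV_const, of _ "F (x t) i"] by fastforce
    then have "((\<lambda>t. x t i) has_real_derivative F (x t) i) (at t within {0..t + 1})"
      unfolding has_field_derivative_def
      by (rule has_derivative_transform[rotated 2]) (use t fix_eq[OF i] in auto)
    moreover have "at t within {0..t + 1} = at t within {0..}"
      by (rule at_within_nhd[of _ "{..<t + 1}"]) (use t in auto)
    ultimately show ?thesis by simp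
  qed
  with x0 show ?thesis by (rule that)
qed

lemma nonpos_derivative_imp_le:
  fixes f f' :: "real \<Rightarrow> real"
  assumes ab: "a \<le> b" and d: "\<And>x. x \<in> {a..b} \<Longrightarrow> (f has_real_derivative f' x) (at x within {a..b})"
    and le: "\<And>x. x \<in> {a..b} \<Longrightarrow> f' x \<le> 0"
  shows "f b \<le> f a"
proof (cases "a = b")
  case False
  then have "a < b" using ab by simp
  then have "\<exists>x\<in>{a<..<b}. f b - f a = f' x * (b - a)"
    using d by (intro mvt_simple) (auto simp: has_field_derivative_def)
  then obtain x where x: "x \<in> {a<..<b}" "f b - f a = f' x * (b - a)" by blast
  have "f' x * (b - a) \<le> 0" using le[of x] x ab by (intro mult_nonpos_nonneg) auto
  then show ?thesis using x by simp
qed simp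

text \<open>Integrating factor \<open>exp (- C * t)\<close>. It is meant for the squared distance of
  two solutions.\<close>

lemma gronwall_zero:
  fixes u u' :: "real \<Rightarrow> real"
  assumes "0 \<le> b" and d: "\<And>t. t \<in> {0..b} \<Longrightarrow> (u has_real_derivative u' t) (at t within {0..b})"
    and le: "\<And>t. t \<in> {0..b} \<Longrightarrow> u' t \<le> C * u t" and u0: "u 0 = 0" and t: "t \<in> {0..b}"
  shows "u t \<le> 0"
proof -
  define w where "w = (\<lambda>t. exp (- C * t) * u t)"
  have "((\<lambda>t. exp (- C * t)) has_real_derivative exp (- C * x) * - C) (at x within {0..b})" for x
    by (auto intro!: derivative_eq_intros)
  then have w: "(w has_real_derivative exp (- C * x) * - C * u x + u' x * exp (- C * x)) (at x within {0..b})"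
    if "x \<in> {0..b}" for x
    unfolding w_def by (rule DERIV_mult[OF _ d[OF that]])
  have "w t \<le> w 0"
  proof (rule nonpos_derivative_imp_le[where f = w and a = 0 and b = t and f' = "\<lambda>x. exp (- C * x) * - C * u x + u' x * exp (- C * x)"])
    fix x assume x: "x \<in> {0..t}"
    then have x': "x \<in> {0..b}" using t by auto
    show "(w has_real_derivative exp (- C * x) * - C * u x + u' x * exp (- C * x)) (at x within {0..t})"
      by (rule has_field_derivative_subset[OF w[OF x']]) (use t in auto)
    have "exp (- C * x) * - C * u x + u' x * exp (- C * x) = exp (- C * x) * (u' x - C * u x)"
      by (simp add: algebra_simps)
    also have "\<dots> \<le> 0" using le[OF x'] by (simp add: mult_le_0_iff)
    finally show "exp (- C * x) * - C * u x + u' x * exp (- C * x) \<le> 0" .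
  qed (use t in auto)
  then show ?thesis by (simp add: w_def u0 mult_le_0_iff)
qed

section \<open>Bounded Lipschitz functions of finitely many coordinates\<close>

text \<open>The two properties are paired because the Lipschitz estimate of a product uses bounds
  for both factors, and because a bound supplies the compact range needed for composition.\<close>

definition lip_bounded :: "'v set \<Rightarrow> (('v \<Rightarrow> real) \<Rightarrow> real) \<Rightarrow> bool" where
  "lip_bounded I G \<longleftrightarrow> (\<exists>B. \<forall>s. \<bar>G s\<bar> \<le> B) \<and>
     (\<exists>L. \<forall>s s'. \<bar>G s - G s'\<bar> \<le> L * (\<Sum>j\<in>I. \<bar>s j - s' j\<bar>))"

lemma lip_boundedE:
  assumes "lip_bounded I G"
  obtains B L where "0 \<le> B" "0 \<le> L" "\<And>s. \<bar>G s\<bar> \<le> B"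
    "\<And>s s'. \<bar>G s - G s'\<bar> \<le> L * (\<Sum>j\<in>I. \<bar>s j - s' j\<bar>)"
proof -
  obtain B L where B: "\<And>s. \<bar>G s\<bar> \<le> B" and L: "\<And>s s'. \<bar>G s - G s'\<bar> \<le> L * (\<Sum>j\<in>I. \<bar>s j - s' j\<bar>)"
    using assms unfolding lip_bounded_def by blast
  show ?thesis
  proof (rule that[of B "\<bar>L\<bar>"])
    show "0 \<le> B" using B[of undefined] by linarith
    fix s s' :: "'a \<Rightarrow> real"
    have "L * (\<Sum>j\<in>I. \<bar>s j - s' j\<bar>) \<le> \<bar>L\<bar> * (\<Sum>j\<in>I. \<bar>s j - s' j\<bar>)"
      by (intro mult_right_mono sum_nonneg) auto
    then show "\<bar>G s - G s'\<bar> \<le> \<bar>L\<bar> * (\<Sum>j\<in>I. \<bar>s j - s' j\<bar>)" using L[of s s'] by linarith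
  qed (use B in auto)
qed

lemma lip_boundedI:
  assumes "\<And>s. \<bar>G s\<bar> \<le> B" "\<And>s s'. \<bar>G s - G s'\<bar> \<le> L * (\<Sum>j\<in>I. \<bar>s j - s' j\<bar>)"
  shows "lip_bounded I G"
  unfolding lip_bounded_def using assms by blast

lemma lip_bounded_const: "lip_bounded I (\<lambda>s. c)"
  by (rule lip_boundedI[of _ "\<bar>c\<bar>" 0]) auto

lemma lip_bounded_add:
  assumes "lip_bounded I G" "lip_bounded I H"
  shows "lip_bounded I (\<lambda>s. G s + H s)"
proof -
  obtain B L where G: "\<And>s. \<bar>G s\<bar> \<le> B" "\<And>s s'. \<bar>G s - G s'\<bar> \<le> L * (\<Sum>j\<in>I. \<bar>s j - s' j\<bar>)"
    using lip_boundedE[OF assms(1)] by metis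
  obtain B' L' where H: "\<And>s. \<bar>H s\<bar> \<le> B'" "\<And>s s'. \<bar>H s - H s'\<bar> \<le> L' * (\<Sum>j\<in>I. \<bar>s j - s' j\<bar>)"
    using lip_boundedE[OF assms(2)] by metis
  show ?thesis
  proof (rule lip_boundedI)
    show "\<bar>G s + H s\<bar> \<le> B + B'" for s using G(1)[of s] H(1)[of s] by linarith
    show "\<bar>(G s + H s) - (G s' + H s')\<bar> \<le> (L + L') * (\<Sum>j\<in>I. \<bar>s j - s' j\<bar>)" for s s'
      using G(2)[of s s'] H(2)[of s s'] unfolding distrib_right by linarith
  qed
qed

lemma lip_bounded_mult:
  assumes "lip_bounded I G" "lip_bounded I H"
  shows "lip_bounded I (\<lambda>s. G s * H s)"
proof -
  obtain B L where G: "0 \<le> B" "\<And>s. \<bar>G s\<bar> \<le> B" "\<And>s s'. \<bar>G s - G s'\<bar> \<le> L * (\<Sum>j\<in>I. \<bar>s j - s' j\<bar>)"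
    using lip_boundedE[OF assms(1)] by metis
  obtain B' L' where H: "0 \<le> B'" "\<And>s. \<bar>H s\<bar> \<le> B'" "\<And>s s'. \<bar>H s - H s'\<bar> \<le> L' * (\<Sum>j\<in>I. \<bar>s j - s' j\<bar>)"
    using lip_boundedE[OF assms(2)] by metis
  show ?thesis
  proof (rule lip_boundedI)
    show "\<bar>G s * H s\<bar> \<le> B * B'" for s
      unfolding abs_mult using G H by (intro mult_mono) auto
    fix s s' :: "'a \<Rightarrow> real"
    let ?d = "\<Sum>j\<in>I. \<bar>s j - s' j\<bar>"
    have "G s * H s - G s' * H s' = G s * (H s - H s') + (G s - G s') * H s'" by (simp add: algebra_simps)
    then have "\<bar>G s * H s - G s' * H s'\<bar> \<le> \<bar>G s\<bar> * \<bar>H s - H s'\<bar> + \<bar>G s - G s'\<bar> * \<bar>H s'\<bar>"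
      by (metis abs_mult abs_triangle_ineq)
    also have "\<dots> \<le> B * (L' * ?d) + (L * ?d) * B'"
      using G H by (intro add_mono mult_mono) (auto intro: order_trans[OF abs_ge_zero])
    finally show "\<bar>G s * H s - G s' * H s'\<bar> \<le> (B * L' + L * B') * ?d" by (simp add: algebra_simps)
  qed
qed

lemma lip_bounded_cmult: "lip_bounded I G \<Longrightarrow> lip_bounded I (\<lambda>s. c * G s)"
  by (rule lip_bounded_mult[OF lip_bounded_const])

lemma lip_bounded_minus: "lip_bounded I G \<Longrightarrow> lip_bounded I (\<lambda>s. - G s)"
  using lip_bounded_cmult[of I G "-1"] by simp

lemma lip_bounded_diff: "lip_bounded I G \<Longrightarrow> lip_bounded I H \<Longrightarrow> lip_bounded I (\<lambda>s. G s - H s)"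
  using lip_bounded_add[OF _ lip_bounded_minus, of I G H] by simp

lemma lip_bounded_sum: "(\<And>a. a \<in> A \<Longrightarrow> lip_bounded I (G a)) \<Longrightarrow> lip_bounded I (\<lambda>s. \<Sum>a\<in>A. G a s)"
  by (induction A rule: infinite_finite_induct) (simp_all add: lip_bounded_const lip_bounded_add)

lemma lip_bounded_power: "lip_bounded I G \<Longrightarrow> lip_bounded I (\<lambda>s. G s ^ n)"
  by (induction n) (simp_all add: lip_bounded_const lip_bounded_mult)

text \<open>On the compact range \<open>{a..b}\<close> the derivative of \<open>h\<close> is
  bounded, so \<open>h\<close> is Lipschitz there by the mean value inequality.\<close>

lemma lip_bounded_compose:
  fixes h h' :: "real \<Rightarrow> real"
  assumes G: "lip_bounded I G" and r: "\<And>s. a \<le> G s" "\<And>s. G s \<le> b"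
    and d: "\<And>x. x \<in> {a..b} \<Longrightarrow> (h has_real_derivative h' x) (at x)"
    and c: "continuous_on {a..b} h'"
  shows "lip_bounded I (\<lambda>s. h (G s))"
proof -
  obtain B L where L: "0 \<le> L" "\<And>s s'. \<bar>G s - G s'\<bar> \<le> L * (\<Sum>j\<in>I. \<bar>s j - s' j\<bar>)"
    using lip_boundedE[OF G] by metis
  have "continuous_on {a..b} h"
    using d by (meson DERIV_isCont continuous_at_imp_continuous_on)
  then have "bounded (h ` {a..b})" "bounded (h' ` {a..b})"
    using c by (auto intro!: compact_imp_bounded compact_continuous_image)
  then obtain B0 B1 where "\<forall>y\<in>h ` {a..b}. \<bar>y\<bar> \<le> B0" "\<forall>y\<in>h' ` {a..b}. \<bar>y\<bar> \<le> B1"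
    unfolding bounded_iff real_norm_def by blast
  then have B: "\<And>x. x \<in> {a..b} \<Longrightarrow> \<bar>h x\<bar> \<le> B0" "\<And>x. x \<in> {a..b} \<Longrightarrow> \<bar>h' x\<bar> \<le> B1"
    by blast+
  have lip: "\<bar>h x - h y\<bar> \<le> B1 * \<bar>x - y\<bar>" if "x \<in> {a..b}" "y \<in> {a..b}" for x y
    using field_differentiable_bound[of "{a..b}" h h' B1 x y] d B(2) that
    by (auto intro: has_field_derivative_at_within)
  show ?thesis
  proof (rule lip_boundedI)
    show "\<bar>h (G s)\<bar> \<le> B0" for s using B(1) r by auto
    fix s s' :: "'a \<Rightarrow> real"
    have B1: "0 \<le> B1" using B(2)[of "G s"] r[of s] by fastforce
    have "\<bar>h (G s) - h (G s')\<bar> \<le> B1 * \<bar>G s - G s'\<bar>" using lip r by auto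
    also have "\<dots> \<le> B1 * (L * (\<Sum>j\<in>I. \<bar>s j - s' j\<bar>))" by (rule mult_left_mono[OF L(2) B1])
    finally show "\<bar>h (G s) - h (G s')\<bar> \<le> (B1 * L) * (\<Sum>j\<in>I. \<bar>s j - s' j\<bar>)" by (simp add: mult.assoc)
  qed
qed

lemma lip_bounded_upper:
  assumes "lip_bounded I G"
  obtains B where "\<And>s. G s \<le> B" "\<And>s. - B \<le> G s"
  using lip_boundedE[OF assms] by (metis abs_le_D1 abs_le_D2 minus_le_iff)

lemma lip_bounded_inverse:
  assumes G: "lip_bounded I G" and a: "0 < a" "\<And>s. a \<le> G s"
  shows "lip_bounded I (\<lambda>s. inverse (G s))"
proof -
  obtain B where B: "\<And>s. G s \<le> B" using lip_bounded_upper[OF G] by metis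
  show ?thesis
  proof (rule lip_bounded_compose[OF G a(2) B])
    show "(inverse has_real_derivative - (inverse x ^ Suc (Suc 0))) (at x)" if "x \<in> {a..B}" for x
      by (rule DERIV_inverse) (use that a in auto)
    show "continuous_on {a..B} (\<lambda>x. - (inverse x ^ Suc (Suc 0)))"
      by (intro continuous_intros) (use a in auto)
  qed
qed

lemma lip_bounded_sqrt:
  assumes G: "lip_bounded I G" and a: "0 < a" "\<And>s. a \<le> G s"
  shows "lip_bounded I (\<lambda>s. sqrt (G s))"
proof -
  obtain B where B: "\<And>s. G s \<le> B" using lip_bounded_upper[OF G] by metis
  show ?thesis
  proof (rule lip_bounded_compose[OF G a(2) B])
    show "(sqrt has_real_derivative inverse (sqrt x) / 2) (at x)" if "x \<in> {a..B}" for x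
      by (rule DERIV_real_sqrt) (use that a in auto)
    show "continuous_on {a..B} (\<lambda>x. inverse (sqrt x) / 2)"
      by (intro continuous_intros) (use a in auto)
  qed
qed

lemma lip_bounded_exp: "lip_bounded I G \<Longrightarrow> lip_bounded I (\<lambda>s. exp (G s))"
proof -
  assume G: "lip_bounded I G"
  obtain B where B: "\<And>s. G s \<le> B" "\<And>s. - B \<le> G s" using lip_bounded_upper[OF G] by metis
  show ?thesis
    by (rule lip_bounded_compose[OF G B(2) B(1), of exp exp]) (auto intro: continuous_intros DERIV_exp)
qed

lemma lip_bounded_arc_integral:
  assumes G: "lip_bounded I G" and a: "-1 < a" "\<And>s. a \<le> G s"
  shows "lip_bounded I (\<lambda>s. arc_integral m n (G s))"
proof -
  obtain B where B: "\<And>s. G s \<le> B" using lip_bounded_upper[OF G] by metis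
  show ?thesis
  proof (rule lip_bounded_compose[OF G a(2) B])
    show "(arc_integral m n has_real_derivative - real n * arc_integral (m + 2) (n + 1) x) (at x)" if "x \<in> {a..B}" for x
      by (rule arc_integral_has_derivative) (use that a in auto)
    show "continuous_on {a..B} (\<lambda>x. - real n * arc_integral (m + 2) (n + 1) x)"
      by (intro continuous_on_mult continuous_on_const continuous_on_arc_integral_compose continuous_on_id) (use a in auto)
  qed
qed

text \<open>Projection onto a box. Composition with it makes the expressions below bounded and
  globally Lipschitz, and changes nothing inside the box.\<close>

definition clamp_coords :: "real \<Rightarrow> ('v \<Rightarrow> real) \<Rightarrow> 'v \<Rightarrow> real" where
  "clamp_coords R s v = max (- R) (min R (s v))"

lemma lip_bounded_clamp_coords:
  assumes "finite I" "j \<in> I" "0 \<le> R"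
  shows "lip_bounded I (\<lambda>s. clamp_coords R s j)"
proof (rule lip_boundedI)
  show "\<bar>clamp_coords R s j\<bar> \<le> R" for s using assms by (simp add: clamp_coords_def abs_le_iff)
  fix s s' :: "'a \<Rightarrow> real"
  have "\<bar>clamp_coords R s j - clamp_coords R s' j\<bar> \<le> \<bar>s j - s' j\<bar>" by (simp add: clamp_coords_def max_def min_def)
  also have "\<dots> \<le> (\<Sum>j\<in>I. \<bar>s j - s' j\<bar>)" by (rule member_le_sum[OF assms(2)]) (use assms in auto)
  finally show "\<bar>clamp_coords R s j - clamp_coords R s' j\<bar> \<le> 1 * (\<Sum>j\<in>I. \<bar>s j - s' j\<bar>)" by simp
qed

lemma clamp_coords_id: "\<bar>s v\<bar> \<le> R \<Longrightarrow> clamp_coords R s v = s v"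
  by (auto simp: clamp_coords_def)

section \<open>Uniform bounds for one triangle with parameter-dependent curvatures\<close>

context
  fixes I :: "'v set" and U :: "'v set" and K :: "('v \<Rightarrow> real) \<Rightarrow> 'v \<Rightarrow> real" and lo :: real
  assumes U: "card U = 3" and lo: "0 < lo" and K_ge: "\<And>s v. v \<in> U \<Longrightarrow> lo \<le> K s v"
    and K: "\<And>v. v \<in> U \<Longrightarrow> lip_bounded I (\<lambda>s. K s v)"
begin

lemma K_pos: "v \<in> U \<Longrightarrow> 0 < K s v"
  by (rule less_le_trans[OF lo K_ge])

lemma lip_bounded_dual_sq: "lip_bounded I (\<lambda>s. dual_sq U (K s))"
  unfolding dual_sq_def divide_inverse
  by (intro lip_bounded_add lip_bounded_const lip_bounded_mult lip_bounded_diff lip_bounded_power lip_bounded_sum K)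

lemma dual_sq_K_ge: "1 \<le> dual_sq U (K s)"
  by (rule dual_sq_ge_1[OF U K_pos])

lemma lip_bounded_inverse_sqrt: "lip_bounded I (\<lambda>s. inverse (sqrt (dual_sq U (K s))))"
  by (rule lip_bounded_inverse[OF lip_bounded_sqrt[OF lip_bounded_dual_sq zero_less_one dual_sq_K_ge] zero_less_one])
    (use dual_sq_K_ge in simp)

lemma lip_bounded_inverse_dual_sq: "lip_bounded I (\<lambda>s. inverse (dual_sq U (K s)))"
  by (rule lip_bounded_inverse[OF lip_bounded_dual_sq zero_less_one dual_sq_K_ge])

lemma lip_bounded_parameter: "i \<in> U \<Longrightarrow> lip_bounded I (\<lambda>s. ((K s i)\<^sup>2 - 1) / dual_sq U (K s))"
  unfolding divide_inverse
  by (intro lip_bounded_mult lip_bounded_diff lip_bounded_const lip_bounded_power K lip_bounded_inverse_dual_sq)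

text \<open>The arc integrals are controlled only for parameters above \<open>-1\<close>, so a
  uniform distance from \<open>-1\<close> is required. It is \<open>lo\<^sup>2 / B\<close>, since
  the dual square lies between 1 and \<open>B\<close>.\<close>

lemma parameter_lower_bound:
  assumes i: "i \<in> U"
  obtains a where "-1 < a" "\<And>s. a \<le> ((K s i)\<^sup>2 - 1) / dual_sq U (K s)"
proof -
  obtain B where B: "\<And>s. dual_sq U (K s) \<le> B" using lip_bounded_upper[OF lip_bounded_dual_sq] by metis
  have B1: "1 \<le> B" using order_trans[OF dual_sq_K_ge B] .
  show ?thesis
  proof (rule that[of "lo\<^sup>2 / B - 1"])
    show "-1 < lo\<^sup>2 / B - 1" using lo B1 by simp
    fix s
    let ?P = "dual_sq U (K s)"
    have P: "1 \<le> ?P" by (rule dual_sq_K_ge)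
    have "lo\<^sup>2 / B \<le> (K s i)\<^sup>2 / ?P"
      using lo K_ge[OF i, of s] P B[of s] by (intro frac_le power_mono) auto
    also have "\<dots> \<le> ((K s i)\<^sup>2 - 1) / ?P + 1"
      using P by (simp add: diff_divide_distrib)
    finally show "lo\<^sup>2 / B - 1 \<le> ((K s i)\<^sup>2 - 1) / ?P" by simp
  qed
qed

lemma lip_bounded_face_curvature: "i \<in> U \<Longrightarrow> lip_bounded I (\<lambda>s. face_curvature U (K s) i)"
proof -
  assume i: "i \<in> U"
  obtain a where a: "-1 < a" "\<And>s. a \<le> ((K s i)\<^sup>2 - 1) / dual_sq U (K s)"
    using parameter_lower_bound[OF i] by metis
  have "lip_bounded I (\<lambda>s. 2 * K s i * inverse (sqrt (dual_sq U (K s))) * arc_integral 0 1 (((K s i)\<^sup>2 - 1) / dual_sq U (K s)))"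
    by (intro lip_bounded_mult lip_bounded_const K i lip_bounded_inverse_sqrt
      lip_bounded_arc_integral[OF lip_bounded_parameter[OF i] a])
  then show ?thesis unfolding face_curvature_def by (simp only: divide_inverse)
qed

lemma lip_bounded_row_sum: "i \<in> U \<Longrightarrow> lip_bounded I (\<lambda>s. row_sum U (K s) i)"
proof -
  assume i: "i \<in> U"
  obtain a where a: "-1 < a" "\<And>s. a \<le> ((K s i)\<^sup>2 - 1) / dual_sq U (K s)"
    using parameter_lower_bound[OF i] by metis
  have "lip_bounded I (\<lambda>s. inverse (1 + ((K s i)\<^sup>2 - 1) / dual_sq U (K s)))"
    by (rule lip_bounded_inverse[OF lip_bounded_add[OF lip_bounded_const lip_bounded_parameter[OF i]], of "1 + a"])
      (use a in auto)
  then have "lip_bounded I (\<lambda>s. 2 * K s i * (inverse (dual_sq U (K s)) * inverse (sqrt (dual_sq U (K s)))) *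
     (inverse (1 + ((K s i)\<^sup>2 - 1) / dual_sq U (K s)) - 2 * arc_integral 2 2 (((K s i)\<^sup>2 - 1) / dual_sq U (K s))))"
    by (intro lip_bounded_mult lip_bounded_diff lip_bounded_const K i lip_bounded_inverse_sqrt lip_bounded_inverse_dual_sq
      lip_bounded_arc_integral[OF lip_bounded_parameter[OF i] a])
  then show ?thesis unfolding row_sum_def by (simp add: divide_inverse)
qed

lemma lip_bounded_off_diag: "i \<in> U \<Longrightarrow> j \<in> U \<Longrightarrow> lip_bounded I (\<lambda>s. off_diag U (K s) i j)"
proof -
  assume i: "i \<in> U" and j: "j \<in> U"
  have "lip_bounded I (\<lambda>s. inverse (K s i + K s j))"
    by (rule lip_bounded_inverse[OF lip_bounded_add[OF K[OF i] K[OF j]], of "lo + lo"])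
      (use lo add_mono[OF K_ge[OF i] K_ge[OF j]] in simp_all)
  then have "lip_bounded I (\<lambda>s. K s i * K s j * (inverse (sqrt (dual_sq U (K s))) * inverse (K s i + K s j)))"
    by (intro lip_bounded_mult K i j lip_bounded_inverse_sqrt)
  then show ?thesis unfolding off_diag_def by (simp add: divide_inverse)
qed

lemma lip_bounded_face_jacobian: "i \<in> U \<Longrightarrow> j \<in> U \<Longrightarrow> lip_bounded I (\<lambda>s. face_jacobian U (K s) i j)"
proof -
  assume i: "i \<in> U" and j: "j \<in> U"
  show ?thesis
  proof (cases "i = j")
    case True
    show ?thesis unfolding face_jacobian_def if_P[OF True]
      by (intro lip_bounded_add lip_bounded_row_sum lip_bounded_sum lip_bounded_off_diag i) simp
  next
    case False
    show ?thesis unfolding face_jacobian_def if_not_P[OF False]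
      by (intro lip_bounded_minus lip_bounded_off_diag i j)
  qed
qed

text \<open>The parameter stays in a compact interval \<open>{a..b}\<close> above \<open>-1\<close>,
  on which the continuous positive function \<open>q\<close> has a positive minimum.\<close>

lemma row_sum_lower_bound:
  assumes i: "i \<in> U"
  obtains \<delta> where "0 < \<delta>" "\<And>s. \<delta> \<le> row_sum U (K s) i"
proof -
  obtain a where a: "-1 < a" "\<And>s. a \<le> ((K s i)\<^sup>2 - 1) / dual_sq U (K s)"
    using parameter_lower_bound[OF i] by metis
  obtain b where b: "\<And>s. ((K s i)\<^sup>2 - 1) / dual_sq U (K s) \<le> b"
    using lip_bounded_upper[OF lip_bounded_parameter[OF i]] by metis
  obtain B where B: "\<And>s. dual_sq U (K s) \<le> B" using lip_bounded_upper[OF lip_bounded_dual_sq] by metis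
  have B1: "1 \<le> B" using order_trans[OF dual_sq_K_ge B] .
  define q where "q = (\<lambda>c. 1 / (1 + c) - 2 * arc_integral 2 2 c)"
  have ne: "{a..b} \<noteq> {}" using order_trans[OF a(2) b] by simp
  have "continuous_on {a..b} q" unfolding q_def
    by (intro continuous_intros) (use a in auto)
  then obtain c where c: "c \<in> {a..b}" "\<And>x. x \<in> {a..b} \<Longrightarrow> q c \<le> q x"
    using continuous_attains_inf[OF compact_Icc ne] by metis
  have qc: "0 < q c" using arc_integral_less[of c] a c by (simp add: q_def)
  show ?thesis
  proof (rule that[of "2 * lo / (B * sqrt B) * q c"])
    show "0 < 2 * lo / (B * sqrt B) * q c" using lo B1 qc by simp
    fix s
    let ?P = "dual_sq U (K s)" and ?c = "((K s i)\<^sup>2 - 1) / dual_sq U (K s)"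
    have P: "1 \<le> ?P" "?P \<le> B" by (rule dual_sq_K_ge, rule B)
    have "2 * lo / (B * sqrt B) \<le> 2 * K s i / (?P * sqrt ?P)"
      using K_ge[OF i, of s] lo P by (intro frac_le mult_mono mult_pos_pos) auto
    moreover have "q c \<le> q ?c" using c(2)[of ?c] a(2)[of s] b[of s] by simp
    ultimately have "2 * lo / (B * sqrt B) * q c \<le> 2 * K s i / (?P * sqrt ?P) * q ?c"
      using qc K_pos[OF i, of s] P by (intro mult_mono) auto
    then show "2 * lo / (B * sqrt B) * q c \<le> row_sum U (K s) i" by (simp only: row_sum_def q_def)
  qed
qed

end

section \<open>The flow in logarithmic coordinates\<close>

text \<open>Both sides are sums over \<open>A \<inter> B\<close>. This converts sums over interior
  vertices into sums over the vertices of a face and back.\<close>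

lemma sum_if_mem_swap:
  assumes "finite A" "finite B"
  shows "(\<Sum>i\<in>A. if i \<in> B then g i else (0::real)) = (\<Sum>i\<in>B. if i \<in> A then g i else 0)"
  using sum.inter_restrict[OF assms(1), of g B] sum.inter_restrict[OF assms(2), of g A] by (simp add: Int_commute)

text \<open>\<open>e\<close> is the tail integral of the bound, so \<open>f + e\<close> and
  \<open>- f + e\<close> are nonincreasing and \<open>\<bar>f t - f s\<bar> \<le> e s\<close>. The
  limit is taken along the integers first and then compared with all times.\<close>

lemma exp_decay_imp_convergent:
  fixes f f' :: "real \<Rightarrow> real"
  assumes \<mu>: "0 < \<mu>" and d: "\<And>t. 0 \<le> t \<Longrightarrow> (f has_real_derivative f' t) (at t within {0..})"
    and b: "\<And>t. 0 \<le> t \<Longrightarrow> \<bar>f' t\<bar> \<le> C * exp (- \<mu> * t)"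
  shows "\<exists>l. (f \<longlongrightarrow> l) at_top"
proof -
  define e where "e = (\<lambda>t. C / \<mu> * exp (- \<mu> * t))"
  have e: "(e has_real_derivative - (C * exp (- \<mu> * t))) (at t within X)" for t X
    unfolding e_def using \<mu> by (auto intro!: derivative_eq_intros)
  have C0: "0 \<le> C" using order_trans[OF abs_ge_zero b[of 0]] by simp
  have e0: "0 \<le> e t" for t unfolding e_def using C0 \<mu> by simp
  have diff: "\<bar>f t - f s\<bar> \<le> e s" if st: "0 \<le> s" "s \<le> t" for s t
  proof -
    have d': "(f has_real_derivative f' x) (at x within {s..t})" if "x \<in> {s..t}" for x
      by (rule has_field_derivative_subset[OF d]) (use that st in auto)
    have b': "\<bar>f' x\<bar> \<le> C * exp (- \<mu> * x)" if "x \<in> {s..t}" for x using b[of x] that st by auto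
    have "f t + e t \<le> f s + e s"
      by (rule nonpos_derivative_imp_le[where f = "\<lambda>x. f x + e x" and a = s and b = t, OF st(2) DERIV_add[OF d' e]])
        (use b' in force)+
    moreover have "- f t + e t \<le> - f s + e s"
      by (rule nonpos_derivative_imp_le[where f = "\<lambda>x. - f x + e x" and a = s and b = t, OF st(2) DERIV_add[OF DERIV_minus[OF d'] e]])
        (use b' in force)+
    ultimately show ?thesis using e0[of t] by linarith
  qed
  have elim: "(e \<longlongrightarrow> 0) at_top" unfolding e_def using \<mu> by real_asymp
  have "Cauchy (\<lambda>n. f (real n))"
  proof (rule metric_CauchyI)
    fix \<epsilon> :: real assume "0 < \<epsilon>"
    then have "\<forall>\<^sub>F t in at_top. e t < \<epsilon> / 2"
      by (intro order_tendstoD(2)[OF elim]) (rule half_gt_zero)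
    then obtain T where T: "\<And>t. T \<le> t \<Longrightarrow> e t < \<epsilon> / 2" unfolding eventually_at_top_linorder by blast
    obtain N :: nat where N: "T \<le> real N" using real_arch_simple by blast
    have "\<bar>f (real m) - f (real N)\<bar> < \<epsilon> / 2" if "N \<le> m" for m
      using diff[of "real N" "real m"] T[OF N] that by fastforce
    then show "\<exists>M. \<forall>m\<ge>M. \<forall>n\<ge>M. dist (f (real m)) (f (real n)) < \<epsilon>"
      unfolding dist_real_def by (smt (verit) field_sum_of_halves)
  qed
  then obtain l where l: "(\<lambda>n. f (real n)) \<longlonglongrightarrow> l" using Cauchy_convergent convergentD by blast
  have near: "\<bar>f t - l\<bar> \<le> e t" if "0 \<le> t" for t
  proof (rule tendsto_upperbound)
    show "(\<lambda>n. \<bar>f t - f (real n)\<bar>) \<longlonglongrightarrow> \<bar>f t - l\<bar>" by (intro tendsto_intros l)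
    obtain N :: nat where "t \<le> real N" using real_arch_simple by blast
    then have "\<bar>f t - f (real n)\<bar> \<le> e t" if "N \<le> n" for n
      using diff[OF \<open>0 \<le> t\<close>, of "real n"] that by (simp add: abs_minus_commute)
    then show "\<forall>\<^sub>F n in sequentially. \<bar>f t - f (real n)\<bar> \<le> e t"
      by (rule eventually_sequentiallyI)
  qed simp
  have "\<forall>\<^sub>F t in at_top. norm (f t - l) \<le> e t"
    using near by (intro eventually_at_top_linorderI[of 0]) simp
  then have "((\<lambda>t. f t - l) \<longlongrightarrow> 0) at_top" by (rule Lim_null_comparison[OF _ elim])
  then show ?thesis using LIM_zero_cancel by blast
qed

text \<open>Separates the analysis from the geometry: what remains of the surface are the vertex
  sets of its faces, the interior vertices \<open>I\<close> and the inequalities of admissibility.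
  \<open>b\<close> stands for the logarithms of the prescribed boundary curvatures.\<close>

locale face_system =
  fixes Fc :: "'f set" and fv :: "'f \<Rightarrow> 'v set" and I :: "'v set" and b That :: "'v \<Rightarrow> real"
  assumes finF: "finite Fc" and finI: "finite I"
    and card_fv: "\<And>f. f \<in> Fc \<Longrightarrow> card (fv f) = 3"
    and cover: "\<And>i. i \<in> I \<Longrightarrow> \<exists>f\<in>Fc. i \<in> fv f"
    and That_pos: "\<And>i. i \<in> I \<Longrightarrow> 0 < That i"
    and That_sum: "\<And>J. J \<noteq> {} \<Longrightarrow> J \<subseteq> I \<Longrightarrow> (\<Sum>v\<in>J. That v) < pi * real (card {f \<in> Fc. \<exists>v\<in>J. v \<in> fv f})"
begin

definition log_curv :: "('v \<Rightarrow> real) \<Rightarrow> 'v \<Rightarrow> real" where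
  "log_curv s v = (if v \<in> I then s v else b v)"

definition T :: "('v \<Rightarrow> real) \<Rightarrow> 'v \<Rightarrow> real" where
  "T s i = (\<Sum>f\<in>Fc. if i \<in> fv f then face_curvature (fv f) (\<lambda>v. exp (log_curv s v)) i else 0)"

definition M :: "('v \<Rightarrow> real) \<Rightarrow> 'v \<Rightarrow> 'v \<Rightarrow> real" where
  "M s i j = (\<Sum>f\<in>Fc. if i \<in> fv f \<and> j \<in> fv f then face_jacobian (fv f) (\<lambda>v. exp (log_curv s v)) i j else 0)"

definition W :: "('v \<Rightarrow> real) \<Rightarrow> real" where
  "W s = (\<Sum>f\<in>Fc. face_potential (fv f) (log_curv s)) - (\<Sum>i\<in>I. That i * s i)"

definition flow_field :: "('v \<Rightarrow> real) \<Rightarrow> 'v \<Rightarrow> real" where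
  "flow_field s i = - (\<Sum>j\<in>I. M s j i * (T s j - That j))"

lemma fin_fv: "f \<in> Fc \<Longrightarrow> finite (fv f)"
  using card_fv by (metis card.infinite zero_neq_numeral)

lemma log_curv_cong: "(\<And>i. i \<in> I \<Longrightarrow> s i = s' i) \<Longrightarrow> log_curv s = log_curv s'"
  by (rule HOL.ext) (simp add: log_curv_def)

lemma T_cong: "(\<And>i. i \<in> I \<Longrightarrow> s i = s' i) \<Longrightarrow> T s = T s'"
  and M_cong: "(\<And>i. i \<in> I \<Longrightarrow> s i = s' i) \<Longrightarrow> M s = M s'"
  and flow_field_cong: "(\<And>i. i \<in> I \<Longrightarrow> s i = s' i) \<Longrightarrow> flow_field s = flow_field s'"
proof -
  assume "\<And>i. i \<in> I \<Longrightarrow> s i = s' i"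
  then have e: "log_curv s = log_curv s'" by (rule log_curv_cong)
  show T: "T s = T s'" and M: "M s = M s'" unfolding T_def M_def e by (rule refl)+
  show "flow_field s = flow_field s'" unfolding flow_field_def T M ..
qed

lemma M_sym: "M s i j = M s j i"
  unfolding M_def by (intro sum.cong refl if_cong) (auto simp: face_jacobian_sym)

lemma log_curv_has_derivative:
  assumes "\<And>j. j \<in> I \<Longrightarrow> ((\<lambda>t. s t j) has_real_derivative \<sigma> j) (at t within X)"
  shows "((\<lambda>t. log_curv (s t) v) has_real_derivative (if v \<in> I then \<sigma> v else 0)) (at t within X)"
  using assms by (cases "v \<in> I") (simp_all add: log_curv_def)

lemma T_has_derivative:
  assumes d: "\<And>j. j \<in> I \<Longrightarrow> ((\<lambda>t. s t j) has_real_derivative \<sigma> j) (at t within X)"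
  shows "((\<lambda>t. T (s t) i) has_real_derivative (\<Sum>j\<in>I. M (s t) i j * \<sigma> j)) (at t within X)"
proof -
  let ?s = "\<lambda>j. if j \<in> I then \<sigma> j else 0"
  let ?J = "\<lambda>f. face_jacobian (fv f) (\<lambda>v. exp (log_curv (s t) v)) i"
  have "((\<lambda>t. T (s t) i) has_real_derivative (\<Sum>f\<in>Fc. if i \<in> fv f then (\<Sum>j\<in>fv f. ?J f j * ?s j) else 0)) (at t within X)"
    unfolding T_def
  proof (rule DERIV_sum)
    fix f assume f: "f \<in> Fc"
    show "((\<lambda>t. if i \<in> fv f then face_curvature (fv f) (\<lambda>v. exp (log_curv (s t) v)) i else 0) has_real_derivative
      (if i \<in> fv f then (\<Sum>j\<in>fv f. ?J f j * ?s j) else 0)) (at t within X)"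
    proof (cases "i \<in> fv f")
      case True
      have "((\<lambda>t. face_curvature (fv f) ((\<lambda>t v. exp (log_curv (s t) v)) t) i) has_real_derivative (\<Sum>j\<in>fv f. ?J f j * ?s j)) (at t within X)"
      proof (rule face_curvature_has_derivative[OF card_fv[OF f] True])
        show "((\<lambda>t. exp (log_curv (s t) v)) has_real_derivative exp (log_curv (s t) v) * ?s v) (at t within X)" for v
          by (rule DERIV_chain2[OF DERIV_exp log_curv_has_derivative[OF d]])
      qed simp
      then show ?thesis using True by simp
    qed simp
  qed
  moreover have "(\<Sum>f\<in>Fc. if i \<in> fv f then (\<Sum>j\<in>fv f. ?J f j * ?s j) else 0) = (\<Sum>j\<in>I. M (s t) i j * \<sigma> j)"
  proof -
    have "(\<Sum>j\<in>I. M (s t) i j * \<sigma> j) = (\<Sum>f\<in>Fc. \<Sum>j\<in>I. (if i \<in> fv f \<and> j \<in> fv f then ?J f j else 0) * \<sigma> j)"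
      unfolding M_def sum_distrib_right by (rule sum.swap)
    also have "\<dots> = (\<Sum>f\<in>Fc. if i \<in> fv f then (\<Sum>j\<in>fv f. ?J f j * ?s j) else 0)"
    proof (rule sum.cong[OF refl])
      fix f assume f: "f \<in> Fc"
      have "(\<Sum>j\<in>I. if j \<in> fv f then ?J f j * \<sigma> j else 0) = (\<Sum>j\<in>fv f. if j \<in> I then ?J f j * \<sigma> j else 0)"
        by (rule sum_if_mem_swap[OF finI fin_fv[OF f]])
      then show "(\<Sum>j\<in>I. (if i \<in> fv f \<and> j \<in> fv f then ?J f j else 0) * \<sigma> j) = (if i \<in> fv f then (\<Sum>j\<in>fv f. ?J f j * ?s j) else 0)"
        by (simp add: if_distrib[of "\<lambda>x. x * _"] if_distrib[of "\<lambda>x. _ * x"] cong: if_cong)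
    qed
    finally show ?thesis ..
  qed
  ultimately show ?thesis by simp
qed

text \<open>\<open>x\<close> is extended by 0 to the boundary vertices, whose curvatures are frozen;
  the estimate of each face then applies to all three of its vertices, and the rest is reordering of
  sums.\<close>

lemma M_quadratic:
  "(\<Sum>i\<in>I. (\<Sum>f\<in>Fc. if i \<in> fv f then row_sum (fv f) (\<lambda>v. exp (log_curv s v)) i else 0) * (x i)\<^sup>2)
    \<le> (\<Sum>i\<in>I. \<Sum>j\<in>I. M s i j * x i * x j)"
proof -
  let ?y = "\<lambda>j. if j \<in> I then x j else 0"
  let ?J = "\<lambda>f. face_jacobian (fv f) (\<lambda>v. exp (log_curv s v))"
  let ?r = "\<lambda>f. row_sum (fv f) (\<lambda>v. exp (log_curv s v))"
  have "(\<Sum>i\<in>I. (\<Sum>f\<in>Fc. if i \<in> fv f then ?r f i else 0) * (x i)\<^sup>2)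
    = (\<Sum>f\<in>Fc. \<Sum>i\<in>I. (if i \<in> fv f then ?r f i else 0) * (x i)\<^sup>2)"
    unfolding sum_distrib_right by (rule sum.swap)
  also have "\<dots> = (\<Sum>f\<in>Fc. \<Sum>i\<in>fv f. ?r f i * (?y i)\<^sup>2)"
  proof (rule sum.cong[OF refl])
    fix f assume f: "f \<in> Fc"
    have "(\<Sum>i\<in>I. (if i \<in> fv f then ?r f i else 0) * (x i)\<^sup>2) = (\<Sum>i\<in>I. if i \<in> fv f then ?r f i * (x i)\<^sup>2 else 0)"
      by (rule sum.cong) auto
    also have "\<dots> = (\<Sum>i\<in>fv f. if i \<in> I then ?r f i * (x i)\<^sup>2 else 0)"
      by (rule sum_if_mem_swap[OF finI fin_fv[OF f]])
    also have "\<dots> = (\<Sum>i\<in>fv f. ?r f i * (?y i)\<^sup>2)" by (rule sum.cong) auto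
    finally show "(\<Sum>i\<in>I. (if i \<in> fv f then ?r f i else 0) * (x i)\<^sup>2) = (\<Sum>i\<in>fv f. ?r f i * (?y i)\<^sup>2)" .
  qed
  also have "\<dots> \<le> (\<Sum>f\<in>Fc. \<Sum>i\<in>fv f. \<Sum>j\<in>fv f. ?J f i j * ?y i * ?y j)"
    by (intro sum_mono face_jacobian_quadratic card_fv) simp_all
  also have "\<dots> = (\<Sum>f\<in>Fc. \<Sum>i\<in>I. \<Sum>j\<in>I. (if i \<in> fv f \<and> j \<in> fv f then ?J f i j else 0) * x i * x j)"
  proof (rule sum.cong[OF refl])
    fix f assume f: "f \<in> Fc"
    have "(\<Sum>j\<in>fv f. ?J f i j * ?y i * ?y j) = (\<Sum>j\<in>I. if j \<in> fv f then ?J f i j * ?y i * x j else 0)" for i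
      using sum_if_mem_swap[OF fin_fv[OF f] finI, of "\<lambda>j. ?J f i j * ?y i * x j"]
      by (simp add: if_distrib[of "\<lambda>x. _ * x"] cong: if_cong)
    then have "(\<Sum>i\<in>fv f. \<Sum>j\<in>fv f. ?J f i j * ?y i * ?y j)
      = (\<Sum>i\<in>fv f. if i \<in> I then (\<Sum>j\<in>I. if j \<in> fv f then ?J f i j * x i * x j else 0) else 0)"
      by (intro sum.cong refl) (auto intro!: sum.neutral)
    also have "\<dots> = (\<Sum>i\<in>I. if i \<in> fv f then (\<Sum>j\<in>I. if j \<in> fv f then ?J f i j * x i * x j else 0) else 0)"
      by (rule sum_if_mem_swap[OF fin_fv[OF f] finI])
    also have "\<dots> = (\<Sum>i\<in>I. \<Sum>j\<in>I. (if i \<in> fv f \<and> j \<in> fv f then ?J f i j else 0) * x i * x j)"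
      by (intro sum.cong refl) (auto intro!: sum.cong)
    finally show "(\<Sum>i\<in>fv f. \<Sum>j\<in>fv f. ?J f i j * ?y i * ?y j)
      = (\<Sum>i\<in>I. \<Sum>j\<in>I. (if i \<in> fv f \<and> j \<in> fv f then ?J f i j else 0) * x i * x j)" .
  qed
  also have "\<dots> = (\<Sum>i\<in>I. \<Sum>j\<in>I. M s i j * x i * x j)"
    unfolding M_def sum_distrib_right
    by (subst sum.swap, rule sum.cong[OF refl], rule sum.swap)
  finally show ?thesis .
qed

text \<open>The vertex \<open>i\<close> lies in some face, whose row sum there is positive; all
  other contributions are nonnegative.\<close>

lemma M_pos_definite:
  assumes "i \<in> I" "x i \<noteq> 0"
  shows "0 < (\<Sum>i\<in>I. \<Sum>j\<in>I. M s i j * x i * x j)"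
proof -
  let ?r = "\<lambda>i. \<Sum>f\<in>Fc. if i \<in> fv f then row_sum (fv f) (\<lambda>v. exp (log_curv s v)) i else 0"
  have nn: "0 \<le> (if i \<in> fv f then row_sum (fv f) (\<lambda>v. exp (log_curv s v)) i else 0)" if "f \<in> Fc" for f i
    using row_sum_pos[OF card_fv[OF that], of "\<lambda>v. exp (log_curv s v)" i] by auto
  have r0: "0 \<le> ?r i" for i by (intro sum_nonneg nn)
  obtain f where f: "f \<in> Fc" "i \<in> fv f" using cover assms(1) by blast
  have "0 < row_sum (fv f) (\<lambda>v. exp (log_curv s v)) i" by (rule row_sum_pos[OF card_fv[OF f(1)] _ f(2)]) simp
  then have "0 < ?r i"
    by (intro sum_pos2[OF finF f(1)]) (use f nn in auto)
  then have "0 < ?r i * (x i)\<^sup>2" using assms by simp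
  then have "0 < (\<Sum>i\<in>I. ?r i * (x i)\<^sup>2)"
    by (intro sum_pos2[OF finI assms(1)]) (use r0 in \<open>auto intro!: mult_nonneg_nonneg\<close>)
  also have "\<dots> \<le> (\<Sum>i\<in>I. \<Sum>j\<in>I. M s i j * x i * x j)" by (rule M_quadratic)
  finally show ?thesis .
qed

text \<open>Along the segment from \<open>s\<close> to \<open>s'\<close> the pairing of
  \<open>T\<close> with the direction \<open>d\<close> has as derivative the quadratic form of
  \<open>M\<close> at \<open>d\<close>, so it increases strictly unless \<open>d\<close> vanishes on
  \<open>I\<close>.\<close>

lemma T_injective:
  assumes eq: "\<And>i. i \<in> I \<Longrightarrow> T s i = T s' i" and i: "i \<in> I"
  shows "s i = s' i"
proof (rule ccontr)
  assume ne: "s i \<noteq> s' i"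
  define d where "d = (\<lambda>v. s' v - s v)"
  define r where "r = (\<lambda>\<tau> v. s v + \<tau> * d v)"
  define \<psi> where "\<psi> = (\<lambda>\<tau>. \<Sum>i\<in>I. d i * T (r \<tau>) i)"
  have r: "((\<lambda>\<tau>. r \<tau> v) has_real_derivative d v) (at \<tau> within X)" for v \<tau> X
    unfolding r_def by (auto intro!: derivative_eq_intros)
  have "\<psi> 0 < \<psi> 1"
  proof (rule DERIV_pos_imp_increasing[where f = \<psi>])
    fix x :: real
    have "(\<psi> has_real_derivative (\<Sum>i\<in>I. d i * (\<Sum>j\<in>I. M (r x) i j * d j))) (at x)"
      unfolding \<psi>_def by (intro DERIV_sum DERIV_cmult T_has_derivative r)
    moreover have "(\<Sum>i\<in>I. d i * (\<Sum>j\<in>I. M (r x) i j * d j)) = (\<Sum>i\<in>I. \<Sum>j\<in>I. M (r x) i j * d i * d j)"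
      by (simp add: sum_distrib_left ac_simps)
    moreover have "0 < (\<Sum>i\<in>I. \<Sum>j\<in>I. M (r x) i j * d i * d j)"
      by (rule M_pos_definite[OF i]) (use ne in \<open>simp add: d_def\<close>)
    ultimately show "\<exists>y. (\<psi> has_real_derivative y) (at x) \<and> 0 < y" by metis
  qed simp
  moreover have "r 0 = s" "r 1 = s'" by (auto simp: r_def d_def)
  ultimately show False using eq by (simp add: \<psi>_def)
qed

lemma W_has_derivative:
  assumes t0: "t0 \<in> {a..c}"
    and s: "\<And>v t. v \<in> I \<Longrightarrow> t \<in> {a..c} \<Longrightarrow> ((\<lambda>t. s t v) has_real_derivative \<sigma> t v) (at t within {a..c})"
    and \<sigma>: "\<And>v. v \<in> I \<Longrightarrow> continuous_on {a..c} (\<lambda>t. \<sigma> t v)"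
  shows "((\<lambda>t. W (s t)) has_real_derivative (\<Sum>i\<in>I. (T (s t0) i - That i) * \<sigma> t0 i)) (at t0 within {a..c})"
proof -
  let ?s = "\<lambda>t v. if v \<in> I then \<sigma> t v else 0"
  let ?c = "\<lambda>f i. face_curvature (fv f) (\<lambda>v. exp (log_curv (s t0) v)) i"
  have P: "((\<lambda>t. face_potential (fv f) (log_curv (s t))) has_real_derivative (\<Sum>i\<in>fv f. ?s t0 i * ?c f i)) (at t0 within {a..c})"
    if f: "f \<in> Fc" for f
  proof (rule face_potential_has_derivative[OF card_fv[OF f] t0, where \<sigma> = ?s])
    show "((\<lambda>t. log_curv (s t) v) has_real_derivative (if v \<in> I then \<sigma> t v else 0)) (at t within {a..c})" if "t \<in> {a..c}" for v t
      by (rule log_curv_has_derivative) (rule s[OF _ that])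
    show "continuous_on {a..c} (\<lambda>t. if v \<in> I then \<sigma> t v else 0)" for v
      using \<sigma> by (cases "v \<in> I") auto
  qed
  have "((\<lambda>t. W (s t)) has_real_derivative (\<Sum>f\<in>Fc. \<Sum>i\<in>fv f. ?s t0 i * ?c f i) - (\<Sum>i\<in>I. That i * \<sigma> t0 i)) (at t0 within {a..c})"
    unfolding W_def by (intro DERIV_diff DERIV_sum DERIV_cmult P s t0)
  moreover have "(\<Sum>f\<in>Fc. \<Sum>i\<in>fv f. ?s t0 i * ?c f i) = (\<Sum>i\<in>I. T (s t0) i * \<sigma> t0 i)"
  proof -
    have "(\<Sum>i\<in>I. T (s t0) i * \<sigma> t0 i) = (\<Sum>f\<in>Fc. \<Sum>i\<in>I. (if i \<in> fv f then ?c f i else 0) * \<sigma> t0 i)"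
      unfolding T_def sum_distrib_right by (rule sum.swap)
    also have "\<dots> = (\<Sum>f\<in>Fc. \<Sum>i\<in>fv f. ?s t0 i * ?c f i)"
    proof (rule sum.cong[OF refl])
      fix f assume f: "f \<in> Fc"
      have "(\<Sum>i\<in>I. if i \<in> fv f then \<sigma> t0 i * ?c f i else 0) = (\<Sum>i\<in>fv f. if i \<in> I then \<sigma> t0 i * ?c f i else 0)"
        by (rule sum_if_mem_swap[OF finI fin_fv[OF f]])
      moreover have "(\<Sum>i\<in>I. (if i \<in> fv f then ?c f i else 0) * \<sigma> t0 i) = (\<Sum>i\<in>I. if i \<in> fv f then \<sigma> t0 i * ?c f i else 0)"
        by (intro sum.cong) auto
      moreover have "(\<Sum>i\<in>fv f. ?s t0 i * ?c f i) = (\<Sum>i\<in>fv f. if i \<in> I then \<sigma> t0 i * ?c f i else 0)"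
        by (intro sum.cong) auto
      ultimately show "(\<Sum>i\<in>I. (if i \<in> fv f then ?c f i else 0) * \<sigma> t0 i) = (\<Sum>i\<in>fv f. ?s t0 i * ?c f i)" by simp
    qed
    finally show ?thesis ..
  qed
  ultimately show ?thesis by (simp add: left_diff_distrib sum_subtractf)
qed

end

section \<open>Admissibility and coercivity of the potential\<close>

context face_system
begin

text \<open>
  Induction on the support of \<open>y\<close>: the admissibility inequality of the support accounts for
  subtracting the smallest positive value of \<open>y\<close> there.
\<close>

lemma admissible_gap:
  obtains \<delta> where "0 < \<delta>"
    "\<And>y Y i. (\<And>i. i \<in> I \<Longrightarrow> 0 \<le> y i) \<Longrightarrow> (\<And>f. f \<in> Fc \<Longrightarrow> 0 \<le> Y f) \<Longrightarrow>
      (\<And>f i. f \<in> Fc \<Longrightarrow> i \<in> fv f \<Longrightarrow> i \<in> I \<Longrightarrow> y i \<le> Y f) \<Longrightarrow> i \<in> I \<Longrightarrow>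
      \<delta> * y i \<le> pi * (\<Sum>f\<in>Fc. Y f) - (\<Sum>i\<in>I. That i * y i)"
proof -
  define gap where "gap = (\<lambda>J. pi * real (card {f \<in> Fc. \<exists>v\<in>J. v \<in> fv f}) - (\<Sum>v\<in>J. That v))"
  \<comment> \<open>The smallest gap over all nonempty sets of interior vertices; the inserted 1
    keeps \<open>Min\<close> meaningful if \<open>I\<close> is empty.\<close>
  define \<delta> where "\<delta> = Min (insert 1 (gap ` (Pow I - {{}})))"
  have fin: "finite (insert 1 (gap ` (Pow I - {{}})))" using finI by simp
  have "0 < \<delta>" unfolding \<delta>_def using fin That_sum by (auto simp: gap_def)
  have \<delta>: "\<delta> \<le> gap J" if "J \<subseteq> I" "J \<noteq> {}" for J
    unfolding \<delta>_def by (rule Min_le[OF fin]) (use that in auto)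
  have main: "\<delta> * y i \<le> pi * (\<Sum>f\<in>Fc. Y f) - (\<Sum>i\<in>I. That i * y i)"
    if "\<And>i. i \<in> I \<Longrightarrow> 0 \<le> y i" "\<And>f. f \<in> Fc \<Longrightarrow> 0 \<le> Y f"
      "\<And>f i. f \<in> Fc \<Longrightarrow> i \<in> fv f \<Longrightarrow> i \<in> I \<Longrightarrow> y i \<le> Y f" "i \<in> I" for y Y i
    using that
  proof (induction "card {i \<in> I. 0 < y i}" arbitrary: y Y i rule: less_induct)
    case less
    note y0 = less.prems(1) and Y0 = less.prems(2) and yY = less.prems(3) and i = less.prems(4)
    define J where "J = {i \<in> I. 0 < y i}"
    have finJ: "finite J" "J \<subseteq> I" using finI by (auto simp: J_def)
    have yJ: "y j = 0" if "j \<in> I" "j \<notin> J" for j using y0[OF that(1)] that by (simp add: J_def)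
    show ?case
    proof (cases "J = {}")
      case True
      then have "(\<Sum>i\<in>I. That i * y i) = 0" using yJ by (intro sum.neutral) auto
      moreover have "0 \<le> (\<Sum>f\<in>Fc. Y f)" by (intro sum_nonneg Y0)
      ultimately show ?thesis using yJ[OF i] True by simp
    next
      case False
      define m where "m = Min (y ` J)"
      have mle: "m \<le> y j" if "j \<in> J" for j unfolding m_def using finJ that by (intro Min_le) auto
      have "m \<in> y ` J" unfolding m_def using finJ False by (intro Min_in) auto
      then obtain j0 where j0: "j0 \<in> J" "y j0 = m" by blast
      have m0: "0 < m" using j0 by (auto simp: J_def)
      define y' where "y' = (\<lambda>j. if j \<in> J then y j - m else y j)"
      \<comment> \<open>Only the faces that meet the support \<open>J\<close> lose \<open>m\<close>;
        each of them has a vertex with \<open>y v \<ge> m\<close>, so \<open>Y'\<close> stays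
        nonnegative. The right-hand side of the claim drops by exactly
        \<open>m * gap J\<close>.\<close>
      define Y' where "Y' = (\<lambda>f. if \<exists>v\<in>J. v \<in> fv f then Y f - m else Y f)"
      have "{i \<in> I. 0 < y' i} \<subset> {i \<in> I. 0 < y i}"
      proof (rule psubsetI)
        show "{i \<in> I. 0 < y' i} \<subseteq> {i \<in> I. 0 < y i}" using m0 by (auto simp: y'_def split: if_splits)
        show "{i \<in> I. 0 < y' i} \<noteq> {i \<in> I. 0 < y i}"
          using j0 m0 finJ by (auto simp: y'_def J_def set_eq_iff intro!: exI[of _ j0])
      qed
      then have "card {i \<in> I. 0 < y' i} < card {i \<in> I. 0 < y i}" using finI by (intro psubset_card_mono) auto
      moreover have y'0: "0 \<le> y' j" if "j \<in> I" for j using mle y0[OF that] by (simp add: y'_def)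
      moreover have "0 \<le> Y' f" if f: "f \<in> Fc" for f
      proof (cases "\<exists>v\<in>J. v \<in> fv f")
        case True
        then obtain v where v: "v \<in> J" "v \<in> fv f" by blast
        have "m \<le> y v" "y v \<le> Y f" using mle[OF v(1)] yY[OF f v(2)] v finJ by auto
        then show ?thesis using v by (auto simp: Y'_def)
      qed (simp add: Y'_def Y0[OF f])
      moreover have "y' j \<le> Y' f" if f: "f \<in> Fc" and j: "j \<in> fv f" "j \<in> I" for f j
      proof (cases "j \<in> J")
        case True
        then show ?thesis using yY[OF f j] j by (auto simp: y'_def Y'_def)
      next
        case False
        then show ?thesis using yJ[OF j(2)] \<open>\<And>f. f \<in> Fc \<Longrightarrow> 0 \<le> Y' f\<close>[OF f] by (simp add: y'_def)
      qed
      ultimately have IH: "\<delta> * y' i \<le> pi * (\<Sum>f\<in>Fc. Y' f) - (\<Sum>i\<in>I. That i * y' i)"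
        by (intro less.hyps i)
      have "(\<Sum>f\<in>Fc. Y f) = (\<Sum>f\<in>Fc. Y' f + (if \<exists>v\<in>J. v \<in> fv f then m else 0))"
        by (rule sum.cong) (auto simp: Y'_def)
      also have "\<dots> = (\<Sum>f\<in>Fc. Y' f) + m * real (card {f \<in> Fc. \<exists>v\<in>J. v \<in> fv f})"
        using finF by (simp add: sum.distrib sum.If_cases Int_def)
      finally have SY: "(\<Sum>f\<in>Fc. Y f) = (\<Sum>f\<in>Fc. Y' f) + m * real (card {f \<in> Fc. \<exists>v\<in>J. v \<in> fv f})" .
      have "(\<Sum>i\<in>I. That i * y i) = (\<Sum>i\<in>I. That i * y' i + (if i \<in> J then m * That i else 0))"
        by (rule sum.cong) (auto simp: y'_def algebra_simps)
      also have "\<dots> = (\<Sum>i\<in>I. That i * y' i) + m * (\<Sum>i\<in>J. That i)"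
        using finI finJ by (simp add: sum.distrib sum.If_cases Int_absorb1 sum_distrib_left)
      finally have Sy: "(\<Sum>i\<in>I. That i * y i) = (\<Sum>i\<in>I. That i * y' i) + m * (\<Sum>i\<in>J. That i)" .
      have "m * \<delta> \<le> m * gap J" using \<delta>[OF finJ(2) False] m0 by simp
      moreover have "\<delta> * y i \<le> \<delta> * (y' i + m)" using \<open>0 < \<delta>\<close> m0 by (intro mult_left_mono) (auto simp: y'_def)
      ultimately show ?thesis using IH unfolding SY Sy gap_def by (simp add: algebra_simps)
    qed
  qed
  show ?thesis by (rule that[OF \<open>0 < \<delta>\<close> main])
qed

text \<open>The boundary logarithms are constants, so their share \<open>e * B\<close> of the error
  moves into \<open>C\<close>. The alternatives for \<open>Y\<close> are those produced by a maximum
  of 0 and the interior coordinates of the face.\<close>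

lemma face_potential_log_curv_bound:
  assumes f: "f \<in> Fc" and e: "0 < e"
  obtains C where "\<And>s Y. Y = 0 \<or> (\<exists>i\<in>fv f \<inter> I. Y = s i) \<Longrightarrow>
    pi * Y - e * (\<Sum>j\<in>I. \<bar>s j\<bar>) - C \<le> face_potential (fv f) (log_curv s)"
proof -
  obtain C where C: "\<And>s. - e * (\<Sum>j\<in>fv f. \<bar>s j\<bar>) - C \<le> face_potential (fv f) s"
    "\<And>s i. i \<in> fv f \<Longrightarrow> pi * s i - e * (\<Sum>j\<in>fv f. \<bar>s j\<bar>) - C \<le> face_potential (fv f) s"
    using face_potential_lower_bound[OF card_fv[OF f] e] by metis
  define B where "B = (\<Sum>j\<in>fv f. \<bar>b j\<bar>)"
  show ?thesis
  proof (rule that[of "C + e * B"])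
    fix s :: "'v \<Rightarrow> real" and Y assume Y: "Y = 0 \<or> (\<exists>i\<in>fv f \<inter> I. Y = s i)"
    have "(\<Sum>j\<in>fv f. \<bar>log_curv s j\<bar>) \<le> (\<Sum>j\<in>fv f. (if j \<in> I then \<bar>s j\<bar> else 0) + \<bar>b j\<bar>)"
      by (intro sum_mono) (simp add: log_curv_def)
    also have "\<dots> = (\<Sum>j\<in>I. if j \<in> fv f then \<bar>s j\<bar> else 0) + B"
      by (simp add: sum.distrib B_def sum_if_mem_swap[OF fin_fv[OF f] finI])
    also have "\<dots> \<le> (\<Sum>j\<in>I. \<bar>s j\<bar>) + B"
      by (intro add_right_mono sum_mono) simp
    finally have "e * (\<Sum>j\<in>fv f. \<bar>log_curv s j\<bar>) \<le> e * ((\<Sum>j\<in>I. \<bar>s j\<bar>) + B)"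
      using e by (intro mult_left_mono) auto
    moreover have "pi * Y - e * (\<Sum>j\<in>fv f. \<bar>log_curv s j\<bar>) - C \<le> face_potential (fv f) (log_curv s)"
      using Y
    proof
      assume "Y = 0"
      then show ?thesis using C(1)[of "log_curv s"] by simp
    next
      assume "\<exists>i\<in>fv f \<inter> I. Y = s i"
      then obtain i where i: "i \<in> fv f" "i \<in> I" "Y = s i" by blast
      then have "log_curv s i = Y" by (simp add: log_curv_def)
      then show ?thesis using C(2)[OF i(1), of "log_curv s"] by simp
    qed
    ultimately show "pi * Y - e * (\<Sum>j\<in>I. \<bar>s j\<bar>) - (C + e * B) \<le> face_potential (fv f) (log_curv s)"
      by (simp add: distrib_left)
  qed
qed

text \<open>Let \<open>y\<close> and \<open>z\<close> be the positive and negative parts of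
  \<open>s\<close>, and \<open>Y f\<close> the maximum of 0 and the interior coordinates of
  \<open>f\<close>. The leading part of the lower bound for \<open>W\<close> is
  \<open>Q + Z\<close>: the gap inequality controls \<open>y\<close> by \<open>Q\<close>, and
  positivity of \<open>That\<close> controls \<open>z\<close> by \<open>Z\<close>.\<close>

lemma W_coercive:
  obtains \<delta> C where "0 < \<delta>" "\<And>s i. i \<in> I \<Longrightarrow> \<delta> * \<bar>s i\<bar> - C \<le> W s"
proof (cases "I = {}")
  case True
  then show ?thesis using that[of 1 0] by simp
next
  case False
  obtain \<delta>1 where \<delta>1: "0 < \<delta>1"
    and gap: "\<And>y Y i. (\<And>i. i \<in> I \<Longrightarrow> 0 \<le> y i) \<Longrightarrow> (\<And>f. f \<in> Fc \<Longrightarrow> 0 \<le> Y f) \<Longrightarrow>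
      (\<And>f i. f \<in> Fc \<Longrightarrow> i \<in> fv f \<Longrightarrow> i \<in> I \<Longrightarrow> y i \<le> Y f) \<Longrightarrow> i \<in> I \<Longrightarrow>
      \<delta>1 * y i \<le> pi * (\<Sum>f\<in>Fc. Y f) - (\<Sum>i\<in>I. That i * y i)"
    using admissible_gap by blast
  define \<delta> where "\<delta> = Min (insert \<delta>1 (That ` I))"
  have \<delta>: "0 < \<delta>" "\<delta> \<le> \<delta>1" "\<And>i. i \<in> I \<Longrightarrow> \<delta> \<le> That i"
    unfolding \<delta>_def using finI \<delta>1 That_pos by auto
  define n where "n = real (card Fc)" define N where "N = real (card I)"
  have N: "1 \<le> N" using False finI by (simp add: N_def Suc_le_eq card_gt_0_iff)
  have n: "0 \<le> n" by (simp add: n_def)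
  \<comment> \<open>Each of the \<open>n\<close> faces costs the error \<open>e * S\<close>, where
    \<open>\<delta> * S \<le> N * (Q + Z)\<close>; with this \<open>e\<close> the total error is at
    most half of \<open>Q + Z\<close>. The summand 1 guards against \<open>n = 0\<close>.\<close>
  define e where "e = \<delta> / (2 * N * (n + 1))"
  have e: "0 < e" using \<delta> N n by (simp add: e_def)
  have "\<forall>f\<in>Fc. \<exists>C. \<forall>s Y. Y = 0 \<or> (\<exists>i\<in>fv f \<inter> I. Y = s i) \<longrightarrow>
    pi * Y - e * (\<Sum>j\<in>I. \<bar>s j\<bar>) - C \<le> face_potential (fv f) (log_curv s)"
    using face_potential_log_curv_bound[OF _ e] by metis
  then obtain C where C: "\<And>f s Y. f \<in> Fc \<Longrightarrow> Y = 0 \<or> (\<exists>i\<in>fv f \<inter> I. Y = s i) \<Longrightarrow>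
    pi * Y - e * (\<Sum>j\<in>I. \<bar>s j\<bar>) - C f \<le> face_potential (fv f) (log_curv s)"
    by metis
  show ?thesis
  proof (rule that[of "\<delta> / 2" "\<Sum>f\<in>Fc. C f"])
    show "0 < \<delta> / 2" using \<delta> by simp
    fix s :: "'v \<Rightarrow> real" and i assume i: "i \<in> I"
    define S where "S = (\<Sum>j\<in>I. \<bar>s j\<bar>)"
    define y where "y = (\<lambda>j. max 0 (s j))"
    define z where "z = (\<lambda>j. max 0 (- s j))"
    define Y where "Y = (\<lambda>f. Max (insert 0 (s ` (fv f \<inter> I))))"
    have finY: "finite (insert 0 (s ` (fv f \<inter> I)))" for f using finI by simp
    have Y0: "0 \<le> Y f" and Ys: "j \<in> fv f \<Longrightarrow> j \<in> I \<Longrightarrow> s j \<le> Y f" for f j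
      unfolding Y_def using finY by (auto intro!: Max_ge)
    have Yin: "Y f = 0 \<or> (\<exists>i\<in>fv f \<inter> I. Y f = s i)" for f
      using Max_in[OF finY[of f]] unfolding Y_def by auto
    define Q where "Q = pi * (\<Sum>f\<in>Fc. Y f) - (\<Sum>j\<in>I. That j * y j)"
    define Z where "Z = (\<Sum>j\<in>I. That j * z j)"
    have Q: "\<delta>1 * y j \<le> Q" if "j \<in> I" for j
      unfolding Q_def by (rule gap) (use Y0 Ys that in \<open>auto simp: y_def\<close>)
    have y0: "0 \<le> y j" and z0: "0 \<le> z j" for j by (auto simp: y_def z_def)
    have Z: "\<delta> * z j \<le> Z" if "j \<in> I" for j
    proof -
      have "\<delta> * z j \<le> That j * z j" using \<delta>(3)[OF that] z0 by (intro mult_right_mono) auto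
      also have "\<dots> \<le> Z" unfolding Z_def
        by (rule member_le_sum[OF that]) (use finI That_pos z0 in \<open>auto intro!: mult_nonneg_nonneg simp: less_imp_le\<close>)
      finally show ?thesis .
    qed
    have QZ: "\<delta> * \<bar>s j\<bar> \<le> Q + Z" if j: "j \<in> I" for j
    proof -
      have "\<delta> * y j \<le> \<delta>1 * y j" using \<delta>(2) y0 by (rule mult_right_mono)
      then have "\<delta> * y j \<le> Q" "\<delta> * z j \<le> Z" using Q[OF j] Z[OF j] by auto
      moreover have "\<bar>s j\<bar> = y j + z j" by (simp add: y_def z_def)
      ultimately show ?thesis by (simp add: distrib_left)
    qed
    have "\<delta> * S = (\<Sum>j\<in>I. \<delta> * \<bar>s j\<bar>)" by (simp add: S_def sum_distrib_left)
    also have "\<dots> \<le> N * (Q + Z)" unfolding N_def by (rule sum_bounded_above[OF QZ])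
    finally have "\<delta> * S / (2 * N) \<le> (Q + Z) / 2" using N by (simp add: field_simps)
    moreover have "n * (e * S) \<le> \<delta> * S / (2 * N)"
    proof -
      have S0: "0 \<le> S" by (simp add: S_def sum_nonneg)
      have "n * (e * S) = (n / (n + 1)) * (\<delta> * S / (2 * N))" using N n by (simp add: e_def)
      also have "\<dots> \<le> 1 * (\<delta> * S / (2 * N))" using \<delta> N n S0 by (intro mult_right_mono) auto
      finally show ?thesis by simp
    qed
    ultimately have eS: "n * (e * S) \<le> (Q + Z) / 2" by linarith
    have "pi * (\<Sum>f\<in>Fc. Y f) - n * (e * S) - (\<Sum>f\<in>Fc. C f) = (\<Sum>f\<in>Fc. pi * Y f - e * S - C f)"
      by (simp add: sum_subtractf sum_distrib_left n_def)
    also have "\<dots> \<le> (\<Sum>f\<in>Fc. face_potential (fv f) (log_curv s))"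
      unfolding S_def by (intro sum_mono C Yin)
    finally have "pi * (\<Sum>f\<in>Fc. Y f) - n * (e * S) - (\<Sum>f\<in>Fc. C f) - (\<Sum>j\<in>I. That j * s j) \<le> W s"
      by (simp add: W_def)
    moreover have "(\<Sum>j\<in>I. That j * s j) = (\<Sum>j\<in>I. That j * y j) - Z"
      unfolding Z_def sum_subtractf[symmetric] by (rule sum.cong) (auto simp: y_def z_def max_def)
    ultimately have "Q + Z - n * (e * S) - (\<Sum>f\<in>Fc. C f) \<le> W s" by (simp add: Q_def)
    then show "\<delta> / 2 * \<bar>s i\<bar> - (\<Sum>f\<in>Fc. C f) \<le> W s" using eS QZ[OF i] by simp
  qed
qed

section \<open>Lipschitz bounds and uniform positive definiteness on a box\<close>

lemma clamped_curvatures: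
  assumes R: "0 \<le> R" and f: "f \<in> Fc"
  obtains lo where "0 < lo" "\<And>s v. v \<in> fv f \<Longrightarrow> lo \<le> exp (log_curv (clamp_coords R s) v)"
    "\<And>v. v \<in> fv f \<Longrightarrow> lip_bounded I (\<lambda>s. exp (log_curv (clamp_coords R s) v))"
proof -
  define r where "r = R + (\<Sum>v\<in>fv f. \<bar>b v\<bar>)"
  show ?thesis
  proof (rule that[of "exp (- r)"])
    fix s :: "'v \<Rightarrow> real" and v assume v: "v \<in> fv f"
    have "\<bar>b v\<bar> \<le> (\<Sum>v\<in>fv f. \<bar>b v\<bar>)" by (rule member_le_sum[OF v]) (use fin_fv[OF f] in auto)
    moreover have "- R \<le> clamp_coords R s v" by (simp add: clamp_coords_def)
    ultimately have "- r \<le> log_curv (clamp_coords R s) v" using R by (auto simp: log_curv_def r_def)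
    then show "exp (- r) \<le> exp (log_curv (clamp_coords R s) v)" by simp
  next
    fix v
    show "lip_bounded I (\<lambda>s. exp (log_curv (clamp_coords R s) v))"
    proof (cases "v \<in> I")
      case True
      then show ?thesis unfolding log_curv_def using lip_bounded_exp[OF lip_bounded_clamp_coords[OF finI True R]] by simp
    next
      case False
      then show ?thesis unfolding log_curv_def by (simp add: lip_bounded_const)
    qed
  qed simp
qed

lemma lip_bounded_T: "0 \<le> R \<Longrightarrow> lip_bounded I (\<lambda>s. T (clamp_coords R s) i)"
  and lip_bounded_M: "0 \<le> R \<Longrightarrow> lip_bounded I (\<lambda>s. M (clamp_coords R s) i j)"
proof -
  assume R: "0 \<le> R"
  show "lip_bounded I (\<lambda>s. T (clamp_coords R s) i)"
    unfolding T_def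
  proof (rule lip_bounded_sum)
    fix f assume f: "f \<in> Fc"
    obtain lo where lo: "0 < lo" "\<And>s v. v \<in> fv f \<Longrightarrow> lo \<le> exp (log_curv (clamp_coords R s) v)"
      "\<And>v. v \<in> fv f \<Longrightarrow> lip_bounded I (\<lambda>s. exp (log_curv (clamp_coords R s) v))"
      using clamped_curvatures[OF R f] by metis
    show "lip_bounded I (\<lambda>s. if i \<in> fv f then face_curvature (fv f) (\<lambda>v. exp (log_curv (clamp_coords R s) v)) i else 0)"
    proof (cases "i \<in> fv f")
      case True
      show ?thesis unfolding if_P[OF True]
        by (rule lip_bounded_face_curvature[where K = "\<lambda>s v. exp (log_curv (clamp_coords R s) v)", OF card_fv[OF f] lo True])
    next
      case False
      show ?thesis unfolding if_not_P[OF False] by (rule lip_bounded_const)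
    qed
  qed
  show "lip_bounded I (\<lambda>s. M (clamp_coords R s) i j)"
    unfolding M_def
  proof (rule lip_bounded_sum)
    fix f assume f: "f \<in> Fc"
    obtain lo where lo: "0 < lo" "\<And>s v. v \<in> fv f \<Longrightarrow> lo \<le> exp (log_curv (clamp_coords R s) v)"
      "\<And>v. v \<in> fv f \<Longrightarrow> lip_bounded I (\<lambda>s. exp (log_curv (clamp_coords R s) v))"
      using clamped_curvatures[OF R f] by metis
    show "lip_bounded I (\<lambda>s. if i \<in> fv f \<and> j \<in> fv f then face_jacobian (fv f) (\<lambda>v. exp (log_curv (clamp_coords R s) v)) i j else 0)"
    proof (cases "i \<in> fv f \<and> j \<in> fv f")
      case True
      show ?thesis unfolding if_P[OF True]
        by (rule lip_bounded_face_jacobian[where K = "\<lambda>s v. exp (log_curv (clamp_coords R s) v)", OF card_fv[OF f] lo])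
          (use True in auto)
    next
      case False
      show ?thesis unfolding if_not_P[OF False] by (rule lip_bounded_const)
    qed
  qed
qed

lemma lip_bounded_flow_field: "0 \<le> R \<Longrightarrow> lip_bounded I (\<lambda>s. flow_field (clamp_coords R s) i)"
  unfolding flow_field_def
  by (intro lip_bounded_minus lip_bounded_sum lip_bounded_mult lip_bounded_diff lip_bounded_const
    lip_bounded_T lip_bounded_M)

text \<open>For each \<open>i\<close> a single face at \<open>i\<close> already has a row sum
  bounded below uniformly in \<open>s\<close>; the minimum over the finite set \<open>I\<close>
  serves for all, with 1 inserted for empty \<open>I\<close>.\<close>

lemma M_coercive:
  assumes R: "0 \<le> R"
  obtains \<delta> where "0 < \<delta>"
    "\<And>s x. \<delta> * (\<Sum>i\<in>I. (x i)\<^sup>2) \<le> (\<Sum>i\<in>I. \<Sum>j\<in>I. M (clamp_coords R s) i j * x i * x j)"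
proof -
  let ?r = "\<lambda>s f i. row_sum (fv f) (\<lambda>v. exp (log_curv (clamp_coords R s) v)) i"
  have "\<exists>d>0. \<forall>s. d \<le> (\<Sum>f\<in>Fc. if i \<in> fv f then ?r s f i else 0)" if i: "i \<in> I" for i
  proof -
    obtain f where f: "f \<in> Fc" "i \<in> fv f" using cover[OF i] by blast
    obtain lo where lo: "0 < lo" "\<And>s v. v \<in> fv f \<Longrightarrow> lo \<le> exp (log_curv (clamp_coords R s) v)"
      "\<And>v. v \<in> fv f \<Longrightarrow> lip_bounded I (\<lambda>s. exp (log_curv (clamp_coords R s) v))"
      using clamped_curvatures[OF R f(1)] by metis
    obtain d where d: "0 < d" "\<And>s. d \<le> ?r s f i"
      using row_sum_lower_bound[where K = "\<lambda>s v. exp (log_curv (clamp_coords R s) v)", OF card_fv[OF f(1)] lo f(2)] by metis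
    have "?r s f i \<le> (\<Sum>f\<in>Fc. if i \<in> fv f then ?r s f i else 0)" for s
    proof -
      have nn: "0 \<le> (if i \<in> fv f' then ?r s f' i else 0)" if "f' \<in> Fc" for f'
      proof (cases "i \<in> fv f'")
        case True
        show ?thesis using row_sum_pos[OF card_fv[OF that] _ True, of "\<lambda>v. exp (log_curv (clamp_coords R s) v)"] True by simp
      qed simp
      have "?r s f i = (if i \<in> fv f then ?r s f i else 0)" using f by simp
      also have "\<dots> \<le> (\<Sum>f\<in>Fc. if i \<in> fv f then ?r s f i else 0)"
        by (rule member_le_sum[OF f(1)]) (use nn finF in auto)
      finally show ?thesis .
    qed
    then show ?thesis using d by (meson order_trans)
  qed
  then obtain d where d: "\<And>i. i \<in> I \<Longrightarrow> 0 < d i" "\<And>i s. i \<in> I \<Longrightarrow> d i \<le> (\<Sum>f\<in>Fc. if i \<in> fv f then ?r s f i else 0)"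
    by metis
  define \<delta> where "\<delta> = Min (insert 1 (d ` I))"
  have \<delta>: "0 < \<delta>" "\<And>i. i \<in> I \<Longrightarrow> \<delta> \<le> d i" unfolding \<delta>_def using finI d(1) by auto
  show ?thesis
  proof (rule that[OF \<delta>(1)])
    fix s x :: "'v \<Rightarrow> real"
    have "\<delta> * (\<Sum>i\<in>I. (x i)\<^sup>2) \<le> (\<Sum>i\<in>I. (\<Sum>f\<in>Fc. if i \<in> fv f then ?r s f i else 0) * (x i)\<^sup>2)"
      unfolding sum_distrib_left
      by (intro sum_mono mult_right_mono) (use \<delta>(2) d(2) in \<open>auto intro: order_trans\<close>)
    also have "\<dots> \<le> (\<Sum>i\<in>I. \<Sum>j\<in>I. M (clamp_coords R s) i j * x i * x j)" by (rule M_quadratic)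
    finally show "\<delta> * (\<Sum>i\<in>I. (x i)\<^sup>2) \<le> (\<Sum>i\<in>I. \<Sum>j\<in>I. M (clamp_coords R s) i j * x i * x j)" .
  qed
qed

end

lemma lip_bounded_tendsto:
  assumes G: "lip_bounded I G" and x: "\<And>j. j \<in> I \<Longrightarrow> ((\<lambda>t. x t j) \<longlongrightarrow> l j) F"
  shows "((\<lambda>t. G (x t)) \<longlongrightarrow> G l) F"
proof -
  obtain B L where L: "\<And>s s'. \<bar>G s - G s'\<bar> \<le> L * (\<Sum>j\<in>I. \<bar>s j - s' j\<bar>)"
    using lip_boundedE[OF G] by metis
  have "((\<lambda>t. L * (\<Sum>j\<in>I. \<bar>x t j - l j\<bar>)) \<longlongrightarrow> L * (\<Sum>j\<in>I. \<bar>l j - l j\<bar>)) F"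
    by (intro tendsto_intros x)
  then have z: "((\<lambda>t. L * (\<Sum>j\<in>I. \<bar>x t j - l j\<bar>)) \<longlongrightarrow> 0) F" by simp
  have "((\<lambda>t. G (x t) - G l) \<longlongrightarrow> 0) F"
    by (rule Lim_null_comparison[OF _ z]) (use L in simp)
  then show ?thesis by (rule LIM_zero_cancel)
qed

lemma lip_bounded_continuous_on:
  assumes G: "lip_bounded I G" and x: "\<And>j. j \<in> I \<Longrightarrow> continuous_on S (\<lambda>t. x t j)"
  shows "continuous_on S (\<lambda>t. G (x t))"
  unfolding continuous_on_def
  by (intro ballI lip_bounded_tendsto[OF G]) (use x in \<open>auto simp: continuous_on_def\<close>)

lemma lip_bounded_common:
  assumes fin: "finite I" and G: "\<And>i. i \<in> I \<Longrightarrow> lip_bounded I (\<lambda>s. G s i)"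
  obtains L where "0 \<le> L" "\<And>i s s'. i \<in> I \<Longrightarrow> \<bar>G s i - G s' i\<bar> \<le> L * (\<Sum>j\<in>I. \<bar>s j - s' j\<bar>)"
proof -
  have "\<forall>i\<in>I. \<exists>L\<ge>0. \<forall>s s'. \<bar>G s i - G s' i\<bar> \<le> L * (\<Sum>j\<in>I. \<bar>s j - s' j\<bar>)"
    using lip_boundedE[OF G] by metis
  then obtain L where L0: "\<And>i. i \<in> I \<Longrightarrow> 0 \<le> L i"
    and L: "\<And>i s s'. i \<in> I \<Longrightarrow> \<bar>G s i - G s' i\<bar> \<le> L i * (\<Sum>j\<in>I. \<bar>s j - s' j\<bar>)"
    by metis
  show ?thesis
  proof (rule that[of "sum L I"])
    show "0 \<le> sum L I" by (rule sum_nonneg[OF L0])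
    fix i and s s' :: "'a \<Rightarrow> real" assume i: "i \<in> I"
    have "L i * (\<Sum>j\<in>I. \<bar>s j - s' j\<bar>) \<le> sum L I * (\<Sum>j\<in>I. \<bar>s j - s' j\<bar>)"
      by (intro mult_right_mono member_le_sum sum_nonneg) (use i fin L0 in auto)
    then show "\<bar>G s i - G s' i\<bar> \<le> sum L I * (\<Sum>j\<in>I. \<bar>s j - s' j\<bar>)" using L[OF i, of s s'] by linarith
  qed
qed

section \<open>Global existence, convergence and uniqueness of the flow\<close>

context face_system
begin

lemma M_nonneg: "0 \<le> (\<Sum>i\<in>I. \<Sum>j\<in>I. M s i j * x i * x j)"
proof (cases "\<exists>i\<in>I. x i \<noteq> 0")
  case True
  then obtain i where "i \<in> I" "x i \<noteq> 0" by blast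
  then show ?thesis by (rule less_imp_le[OF M_pos_definite])
next
  case False
  then show ?thesis by (simp add: sum_nonneg)
qed

lemma W_cong: "(\<And>i. i \<in> I \<Longrightarrow> s i = s' i) \<Longrightarrow> W s = W s'"
  unfolding W_def using log_curv_cong[of s s'] by simp

text \<open>The gradient of \<open>W\<close> is \<open>T - That\<close>, and the velocity is its
  image under \<open>M\<close>, which is symmetric and positive semidefinite, with the sign
  reversed.\<close>

lemma flow_decreases_W:
  assumes t: "0 \<le> t"
    and d: "\<And>u i. u \<in> {0..t} \<Longrightarrow> i \<in> I \<Longrightarrow> ((\<lambda>u. x u i) has_real_derivative flow_field (x u) i) (at u within {0..t})"
    and c: "\<And>i. i \<in> I \<Longrightarrow> continuous_on {0..t} (\<lambda>u. flow_field (x u) i)"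
  shows "W (x t) \<le> W (x 0)"
proof (rule nonpos_derivative_imp_le[where f = "\<lambda>u. W (x u)" and a = 0 and b = t, OF t])
  fix u assume u: "u \<in> {0..t}"
  show "((\<lambda>u. W (x u)) has_real_derivative (\<Sum>i\<in>I. (T (x u) i - That i) * flow_field (x u) i)) (at u within {0..t})"
    by (rule W_has_derivative[OF u d c])
  let ?D = "\<lambda>i. T (x u) i - That i"
  have "(\<Sum>i\<in>I. ?D i * flow_field (x u) i) = - (\<Sum>i\<in>I. \<Sum>j\<in>I. M (x u) i j * ?D i * ?D j)"
    unfolding flow_field_def sum_negf[symmetric] sum_distrib_left mult_minus_right
    by (intro sum.cong refl) (simp add: M_sym[of _ _ j for j] ac_simps)
  then show "(\<Sum>i\<in>I. ?D i * flow_field (x u) i) \<le> 0" using M_nonneg[of "x u" ?D] by simp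
qed

text \<open>A solution of the clamped system is followed up to the first time at which it would
  reach the boundary of the box. Before that it solves the true flow, so \<open>W\<close> has not
  increased and all coordinates are bounded by \<open>R0 < R\<close>.\<close>

lemma bounded_flow:
  obtains x R where "0 \<le> R" "\<And>i. x 0 i = s0 i"
    "\<And>t i. 0 \<le> t \<Longrightarrow> i \<in> I \<Longrightarrow> ((\<lambda>t. x t i) has_real_derivative flow_field (x t) i) (at t within {0..})"
    "\<And>t i. 0 \<le> t \<Longrightarrow> i \<in> I \<Longrightarrow> \<bar>x t i\<bar> \<le> R"
proof -
  obtain \<delta> C where \<delta>: "0 < \<delta>" and WC: "\<And>s i. i \<in> I \<Longrightarrow> \<delta> * \<bar>s i\<bar> - C \<le> W s"
    using W_coercive by metis
  define R0 where "R0 = \<bar>W s0 + C\<bar> / \<delta>"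
  have R0: "0 \<le> R0" using \<delta> by (simp add: R0_def)
  have sub: "\<bar>s i\<bar> \<le> R0" if "W s \<le> W s0" "i \<in> I" for s i
  proof -
    have "\<delta> * \<bar>s i\<bar> \<le> \<bar>W s0 + C\<bar>" using WC[OF that(2), of s] that(1) by linarith
    then show ?thesis unfolding R0_def using \<delta> by (simp add: pos_le_divide_eq mult.commute)
  qed
  \<comment> \<open>The margin 1 leaves room for the intermediate value \<open>R0 + 1 / 2\<close> in
    the final contradiction.\<close>
  define R where "R = R0 + 1"
  have R: "0 \<le> R" using R0 by (simp add: R_def)
  define F where "F = (\<lambda>s. flow_field (clamp_coords R s))"
  obtain L where L: "0 \<le> L" "\<And>i s s'. i \<in> I \<Longrightarrow> \<bar>F s i - F s' i\<bar> \<le> L * (\<Sum>j\<in>I. \<bar>s j - s' j\<bar>)"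
    unfolding F_def using lip_bounded_common[where G = "\<lambda>s. flow_field (clamp_coords R s)", OF finI lip_bounded_flow_field[OF R]] by blast
  obtain x where x0: "\<And>i. x 0 i = s0 i"
    and xd: "\<And>t i. 0 \<le> t \<Longrightarrow> i \<in> I \<Longrightarrow> ((\<lambda>t. x t i) has_real_derivative F (x t) i) (at t within {0..})"
    using picard_global_solution[where F = F and ?x0.0 = s0, OF finI L] by blast
  have xc: "continuous_on {0..t} (\<lambda>t. x t i)" if "i \<in> I" for t i
  proof (rule DERIV_continuous_on)
    show "((\<lambda>t. x t i) has_real_derivative F (x u) i) (at u within {0..t})" if "u \<in> {0..t}" for u
      by (rule has_field_derivative_subset[OF xd]) (use that \<open>i \<in> I\<close> in auto)
  qed
  have F: "F (x t) = flow_field (x t)" if "\<And>i. i \<in> I \<Longrightarrow> \<bar>x t i\<bar> \<le> R" for t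
    unfolding F_def by (rule flow_field_cong, rule clamp_coords_id, rule that)
  have ok: "\<bar>x t i\<bar> \<le> R0" if t: "0 \<le> t" and b: "\<And>u j. u \<in> {0..t} \<Longrightarrow> j \<in> I \<Longrightarrow> \<bar>x u j\<bar> \<le> R" and i: "i \<in> I" for t i
  proof (rule sub[OF _ i])
    have Fu: "F (x u) = flow_field (x u)" if "u \<in> {0..t}" for u by (rule F) (use b that in auto)
    have "W (x t) \<le> W (x 0)"
    proof (rule flow_decreases_W[OF t])
      fix u j assume u: "u \<in> {0..t}" and j: "j \<in> I"
      show "((\<lambda>u. x u j) has_real_derivative flow_field (x u) j) (at u within {0..t})"
        unfolding Fu[OF u, symmetric] by (rule has_field_derivative_subset[OF xd]) (use u j in auto)
    next
      fix j assume j: "j \<in> I"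
      have "continuous_on {0..t} (\<lambda>u. F (x u) j)"
        unfolding F_def by (rule lip_bounded_continuous_on[OF lip_bounded_flow_field[OF R] xc])
      then show "continuous_on {0..t} (\<lambda>u. flow_field (x u) j)"
        by (rule continuous_on_eq) (use Fu in simp)
    qed
    also have "W (x 0) = W s0" by (rule W_cong) (rule x0)
    finally show "W (x t) \<le> W s0" .
  qed
  have s0R: "\<bar>s0 i\<bar> \<le> R0" if "i \<in> I" for i by (rule sub[OF order_refl that])
  have bound: "\<bar>x t i\<bar> < R" if t: "0 \<le> t" and i: "i \<in> I" for t i
  proof (rule ccontr)
    assume n: "\<not> \<bar>x t i\<bar> < R"
    define P where "P = (\<Union>j\<in>I. {u \<in> {0..t}. R \<le> \<bar>x u j\<bar>})"
    have "closed {u \<in> {0..t}. R \<le> \<bar>x u j\<bar>}" if "j \<in> I" for j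
    proof -
      have "closed ({0..t} \<inter> (\<lambda>u. \<bar>x u j\<bar>) -` {R..})"
        by (intro continuous_closed_preimage continuous_on_rabs xc that closed_atLeastAtMost closed_atLeast)
      moreover have "{0..t} \<inter> (\<lambda>u. \<bar>x u j\<bar>) -` {R..} = {u \<in> {0..t}. R \<le> \<bar>x u j\<bar>}" by auto
      ultimately show ?thesis by simp
    qed
    then have "compact P" unfolding P_def
      by (intro compact_UN finI) (auto simp: compact_eq_bounded_closed intro: bounded_subset[OF bounded_closed_interval[of 0 t]])
    moreover have "P \<noteq> {}"
    proof -
      have "t \<in> {u \<in> {0..t}. R \<le> \<bar>x u i\<bar>}" using n t by simp
      then show ?thesis unfolding P_def using i by blast
    qed
    ultimately obtain t1 where t1: "t1 \<in> P" "\<And>u. u \<in> P \<Longrightarrow> t1 \<le> u"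
      using compact_attains_inf by metis
    obtain j where j: "j \<in> I" "0 \<le> t1" "t1 \<le> t" "R \<le> \<bar>x t1 j\<bar>" using t1(1) by (auto simp: P_def)
    have before: "\<bar>x u k\<bar> \<le> R" if "0 \<le> u" "u < t1" "k \<in> I" for u k
    proof (rule ccontr)
      assume "\<not> \<bar>x u k\<bar> \<le> R"
      then have "u \<in> {v \<in> {0..t}. R \<le> \<bar>x v k\<bar>}" using that j by simp
      then have "u \<in> P" unfolding P_def using that by blast
      then show False using t1(2) that by fastforce
    qed
    \<comment> \<open>By continuity the coordinate passes \<open>R0 + 1 / 2\<close> strictly before
      \<open>t1\<close>, at a time when \<open>ok\<close> still bounds it by
      \<open>R0\<close>.\<close>
    have "\<exists>u\<ge>0. u \<le> t1 \<and> \<bar>x u j\<bar> = R0 + 1 / 2"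
      by (rule IVT'[where f = "\<lambda>u. \<bar>x u j\<bar>", OF _ _ j(2) continuous_on_rabs[OF xc[OF j(1)]]])
        (use s0R[OF j(1)] j(4) x0 in \<open>simp_all add: R_def\<close>)
    then obtain u where u: "0 \<le> u" "u \<le> t1" "\<bar>x u j\<bar> = R0 + 1 / 2" by blast
    have "u \<noteq> t1" using u(3) j(4) by (auto simp: R_def)
    then have "\<bar>x u j\<bar> \<le> R0" using ok[OF u(1) _ j(1)] before u by auto
    then show False using u(3) by simp
  qed
  show ?thesis
  proof (rule that[of R x])
    show "0 \<le> R" by (rule R)
    show "x 0 i = s0 i" for i by (rule x0)
    fix t :: real and i assume t: "0 \<le> t" and i: "i \<in> I"
    show "\<bar>x t i\<bar> \<le> R" using bound[OF t i] by simp
    have "F (x t) = flow_field (x t)" by (rule F) (use bound[OF t] in \<open>simp add: less_imp_le\<close>)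
    then show "((\<lambda>t. x t i) has_real_derivative flow_field (x t) i) (at t within {0..})" using xd[OF t i] by simp
  qed
qed

text \<open>The squared error \<open>E\<close> has derivative minus twice the squared speed, and the
  speed is at least \<open>\<delta>\<close> times the error, with \<open>\<delta>\<close> uniform on
  the box. So the error decays exponentially, hence also the speed, as the entries of
  \<open>M\<close> are bounded there.\<close>

lemma bounded_flow_converges:
  assumes R: "0 \<le> R"
    and d: "\<And>t i. 0 \<le> t \<Longrightarrow> i \<in> I \<Longrightarrow> ((\<lambda>t. x t i) has_real_derivative flow_field (x t) i) (at t within {0..})"
    and bd: "\<And>t i. 0 \<le> t \<Longrightarrow> i \<in> I \<Longrightarrow> \<bar>x t i\<bar> \<le> R"
  obtains l where "\<And>i. i \<in> I \<Longrightarrow> ((\<lambda>t. x t i) \<longlongrightarrow> l i) at_top" "\<And>i. i \<in> I \<Longrightarrow> T l i = That i"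
proof -
  have cl: "T (x t) = T (clamp_coords R (x t))" "M (x t) = M (clamp_coords R (x t))" if "0 \<le> t" for t
  proof -
    have e: "x t i = clamp_coords R (x t) i" if "i \<in> I" for i
      using clamp_coords_id[of "x t" i R] bd[OF \<open>0 \<le> t\<close> that] by simp
    show "T (x t) = T (clamp_coords R (x t))" by (rule T_cong[OF e])
    show "M (x t) = M (clamp_coords R (x t))" by (rule M_cong[OF e])
  qed
  obtain \<delta> where \<delta>: "0 < \<delta>"
    and Mc: "\<And>s x. \<delta> * (\<Sum>i\<in>I. (x i)\<^sup>2) \<le> (\<Sum>i\<in>I. \<Sum>j\<in>I. M (clamp_coords R s) i j * x i * x j)"
    using M_coercive[OF R] by blast
  define D where "D = (\<lambda>t i. T (x t) i - That i)"
  define E where "E = (\<lambda>t. \<Sum>i\<in>I. (D t i)\<^sup>2)"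
  have ff: "flow_field (x t) j = - (\<Sum>i\<in>I. M (x t) i j * D t i)" for t j by (simp add: flow_field_def D_def)
  have E0: "0 \<le> E t" for t by (simp add: E_def sum_nonneg)
  have dE: "(E has_real_derivative - 2 * (\<Sum>j\<in>I. (flow_field (x t) j)\<^sup>2)) (at t within {0..})" if t: "0 \<le> t" for t
  proof -
    have "(E has_real_derivative (\<Sum>i\<in>I. 2 * D t i * (\<Sum>j\<in>I. M (x t) i j * flow_field (x t) j))) (at t within {0..})"
      unfolding E_def
    proof (rule DERIV_sum)
      fix i
      have "((\<lambda>t. D t i) has_real_derivative (\<Sum>j\<in>I. M (x t) i j * flow_field (x t) j) - 0) (at t within {0..})"
        unfolding D_def by (intro DERIV_diff T_has_derivative d t DERIV_const)
      from DERIV_power[OF this, of 2]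
      show "((\<lambda>t. (D t i)\<^sup>2) has_real_derivative 2 * D t i * (\<Sum>j\<in>I. M (x t) i j * flow_field (x t) j)) (at t within {0..})"
        by (simp add: ac_simps)
    qed
    moreover have "(\<Sum>i\<in>I. 2 * D t i * (\<Sum>j\<in>I. M (x t) i j * flow_field (x t) j)) = - 2 * (\<Sum>j\<in>I. (flow_field (x t) j)\<^sup>2)"
    proof -
      have "(\<Sum>i\<in>I. 2 * D t i * (\<Sum>j\<in>I. M (x t) i j * flow_field (x t) j))
        = (\<Sum>j\<in>I. \<Sum>i\<in>I. 2 * D t i * (M (x t) i j * flow_field (x t) j))"
        unfolding sum_distrib_left by (rule sum.swap)
      also have "\<dots> = (\<Sum>j\<in>I. - 2 * (flow_field (x t) j)\<^sup>2)"
      proof (rule sum.cong[OF refl])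
        fix j
        have "(\<Sum>i\<in>I. 2 * D t i * (M (x t) i j * flow_field (x t) j)) = 2 * flow_field (x t) j * (\<Sum>i\<in>I. M (x t) i j * D t i)"
          by (simp add: sum_distrib_left ac_simps)
        also have "\<dots> = - 2 * (flow_field (x t) j)\<^sup>2" by (simp add: ff[of t j] power2_eq_square)
        finally show "(\<Sum>i\<in>I. 2 * D t i * (M (x t) i j * flow_field (x t) j)) = - 2 * (flow_field (x t) j)\<^sup>2" .
      qed
      finally show ?thesis by (simp add: sum_distrib_left)
    qed
    ultimately show ?thesis by simp
  qed
  \<comment> \<open>Cauchy-Schwarz turns the lower bound of the quadratic form into one for the
    length of \<open>flow_field\<close>. A factor \<open>E t\<close> is cancelled, hence the case
    distinction.\<close>
  have grad: "\<delta>\<^sup>2 * E t \<le> (\<Sum>j\<in>I. (flow_field (x t) j)\<^sup>2)" if t: "0 \<le> t" for t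
  proof (cases "E t = 0")
    case True
    then show ?thesis by (simp add: sum_nonneg)
  next
    case False
    then have E: "0 < E t" using E0[of t] by simp
    have "\<delta> * E t \<le> (\<Sum>i\<in>I. \<Sum>j\<in>I. M (x t) i j * D t i * D t j)"
      unfolding E_def cl(2)[OF t] by (rule Mc)
    also have "\<dots> = (\<Sum>j\<in>I. \<Sum>i\<in>I. M (x t) i j * D t i * D t j)" by (rule sum.swap)
    also have "\<dots> = (\<Sum>j\<in>I. - flow_field (x t) j * D t j)" by (simp add: ff sum_distrib_right)
    finally have "\<delta> * E t \<le> (\<Sum>j\<in>I. - flow_field (x t) j * D t j)" .
    then have "(\<delta> * E t)\<^sup>2 \<le> (\<Sum>j\<in>I. - flow_field (x t) j * D t j)\<^sup>2" using \<delta> E by (intro power_mono) auto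
    also have "\<dots> \<le> (\<Sum>j\<in>I. (- flow_field (x t) j)\<^sup>2) * (\<Sum>j\<in>I. (D t j)\<^sup>2)"
      by (rule Cauchy_Schwarz_ineq_sum)
    finally have "(\<delta>\<^sup>2 * E t) * E t \<le> (\<Sum>j\<in>I. (flow_field (x t) j)\<^sup>2) * E t"
      by (simp add: E_def power2_eq_square ac_simps)
    then show ?thesis using E by simp
  qed
  define \<mu> where "\<mu> = \<delta>\<^sup>2"
  have \<mu>: "0 < \<mu>" using \<delta> by (simp add: \<mu>_def)
  have Edecay: "E t \<le> E 0 * exp (- 2 * \<mu> * t)" if t: "0 \<le> t" for t
  proof -
    have "exp (2 * \<mu> * t) * E t \<le> exp (2 * \<mu> * 0) * E 0"
    proof (rule nonpos_derivative_imp_le[where f = "\<lambda>t. exp (2 * \<mu> * t) * E t" and a = 0 and b = t, OF t])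
      fix u assume u: "u \<in> {0..t}"
      have "((\<lambda>t. exp (2 * \<mu> * t)) has_real_derivative exp (2 * \<mu> * u) * (2 * \<mu>)) (at u within {0..t})"
        by (auto intro!: derivative_eq_intros)
      moreover have "(E has_real_derivative - 2 * (\<Sum>j\<in>I. (flow_field (x u) j)\<^sup>2)) (at u within {0..t})"
        by (rule has_field_derivative_subset[OF dE]) (use u in auto)
      ultimately show "((\<lambda>t. exp (2 * \<mu> * t) * E t) has_real_derivative
        exp (2 * \<mu> * u) * (2 * \<mu>) * E u + - 2 * (\<Sum>j\<in>I. (flow_field (x u) j)\<^sup>2) * exp (2 * \<mu> * u)) (at u within {0..t})"
        by (rule DERIV_mult)
      have "exp (2 * \<mu> * u) * (2 * \<mu>) * E u + - 2 * (\<Sum>j\<in>I. (flow_field (x u) j)\<^sup>2) * exp (2 * \<mu> * u)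
        = 2 * exp (2 * \<mu> * u) * (\<mu> * E u - (\<Sum>j\<in>I. (flow_field (x u) j)\<^sup>2))" by (simp add: algebra_simps)
      also have "\<dots> \<le> 0" using grad[of u] u by (intro mult_nonneg_nonpos) (auto simp: \<mu>_def)
      finally show "exp (2 * \<mu> * u) * (2 * \<mu>) * E u + - 2 * (\<Sum>j\<in>I. (flow_field (x u) j)\<^sup>2) * exp (2 * \<mu> * u) \<le> 0" .
    qed
    then have "exp (2 * \<mu> * t) * E t * exp (- 2 * \<mu> * t) \<le> E 0 * exp (- 2 * \<mu> * t)"
      by (intro mult_right_mono) auto
    then show ?thesis by (simp add: exp_minus field_simps)
  qed
  have Dle: "\<bar>D t i\<bar> \<le> sqrt (E 0) * exp (- \<mu> * t)" if t: "0 \<le> t" and i: "i \<in> I" for t i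
  proof -
    have "(D t i)\<^sup>2 \<le> E t" unfolding E_def by (rule member_le_sum[OF i]) (use finI in auto)
    also have "\<dots> \<le> E 0 * exp (- 2 * \<mu> * t)" by (rule Edecay[OF t])
    also have "exp (- 2 * \<mu> * t) = (exp (- \<mu> * t))\<^sup>2" by (simp flip: exp_double)
    also have "E 0 * (exp (- \<mu> * t))\<^sup>2 = (sqrt (E 0) * exp (- \<mu> * t))\<^sup>2"
      using E0[of 0] by (simp add: power_mult_distrib)
    finally have "\<bar>D t i\<bar> \<le> \<bar>sqrt (E 0) * exp (- \<mu> * t)\<bar>" unfolding abs_le_square_iff .
    then show ?thesis using E0[of 0] by (simp add: abs_mult)
  qed
  have "\<exists>B\<ge>0. \<forall>s. \<bar>M (clamp_coords R s) i j\<bar> \<le> B" for i j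
  proof -
    obtain B where B: "\<And>s. \<bar>M (clamp_coords R s) i j\<bar> \<le> B"
      using lip_bounded_M[OF R, of i j] unfolding lip_bounded_def by blast
    then have "0 \<le> B" using order_trans[OF abs_ge_zero] by blast
    with B show ?thesis by blast
  qed
  then obtain B where B: "\<And>i j. 0 \<le> B i j" "\<And>i j s. \<bar>M (clamp_coords R s) i j\<bar> \<le> B i j" by metis
  have speed: "\<bar>flow_field (x t) j\<bar> \<le> ((\<Sum>i\<in>I. B i j) * sqrt (E 0)) * exp (- \<mu> * t)" if t: "0 \<le> t" and j: "j \<in> I" for t j
  proof -
    have "\<bar>flow_field (x t) j\<bar> \<le> (\<Sum>i\<in>I. \<bar>M (x t) i j * D t i\<bar>)" unfolding ff abs_minus_cancel by (rule sum_abs)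
    also have "\<dots> \<le> (\<Sum>i\<in>I. B i j * (sqrt (E 0) * exp (- \<mu> * t)))"
      unfolding abs_mult cl(2)[OF t] by (intro sum_mono mult_mono B Dle t j) auto
    finally show ?thesis by (simp add: sum_distrib_right mult.assoc)
  qed
  have "\<exists>l. ((\<lambda>t. x t j) \<longlongrightarrow> l) at_top" if j: "j \<in> I" for j
    by (rule exp_decay_imp_convergent[OF \<mu> d[OF _ j] speed[OF _ j]])
  then obtain l where l: "\<And>j. j \<in> I \<Longrightarrow> ((\<lambda>t. x t j) \<longlongrightarrow> l j) at_top" by metis
  \<comment> \<open>The limit lies in the box too, so clamping does not change \<open>T\<close>
    there, and continuity of the clamped \<open>T\<close> can be used.\<close>
  have lR: "\<bar>l j\<bar> \<le> R" if j: "j \<in> I" for j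
  proof (rule tendsto_upperbound)
    show "((\<lambda>t. \<bar>x t j\<bar>) \<longlongrightarrow> \<bar>l j\<bar>) at_top" by (intro tendsto_intros l j)
    show "\<forall>\<^sub>F t in at_top. \<bar>x t j\<bar> \<le> R" by (intro eventually_at_top_linorderI[of 0] bd j)
  qed simp
  have "T l i = That i" if i: "i \<in> I" for i
  proof -
    have "T (clamp_coords R l) = T l" by (rule T_cong, rule clamp_coords_id, rule lR)
    moreover have "((\<lambda>t. T (clamp_coords R (x t)) i) \<longlongrightarrow> T (clamp_coords R l) i) at_top"
      by (rule lip_bounded_tendsto[OF lip_bounded_T[OF R] l])
    ultimately have "((\<lambda>t. T (clamp_coords R (x t)) i) \<longlongrightarrow> T l i) at_top" by simp
    moreover have "\<forall>\<^sub>F t in at_top. T (clamp_coords R (x t)) i = T (x t) i"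
      by (intro eventually_at_top_linorderI[of 0]) (simp add: cl(1))
    ultimately have 1: "((\<lambda>t. T (x t) i) \<longlongrightarrow> T l i) at_top" by (rule Lim_transform_eventually)
    have z: "((\<lambda>t. sqrt (E 0) * exp (- \<mu> * t)) \<longlongrightarrow> 0) at_top"
    proof -
      have "((\<lambda>t. exp (- \<mu> * t)) \<longlongrightarrow> 0) at_top" using \<mu> by real_asymp
      from tendsto_mult_right_zero[OF this] show ?thesis .
    qed
    have "\<forall>\<^sub>F t in at_top. norm (D t i) \<le> sqrt (E 0) * exp (- \<mu> * t)"
      by (rule eventually_at_top_linorderI[of 0], unfold real_norm_def, rule Dle[OF _ i])
    then have "((\<lambda>t. D t i) \<longlongrightarrow> 0) at_top" by (rule Lim_null_comparison[OF _ z])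
    then have "((\<lambda>t. T (x t) i) \<longlongrightarrow> That i) at_top" unfolding D_def by (rule LIM_zero_cancel)
    with 1 show ?thesis using tendsto_unique trivial_limit_at_top_linorder by blast
  qed
  with l show ?thesis using that by blast
qed

text \<open>The interval is half open because a competing solution is only assumed to exist on
  \<open>{0..<\<tau>}\<close>. On each \<open>{0..t}\<close> both solutions stay in some box, where
  the field is Lipschitz, and Gronwall applies to their squared distance.\<close>

lemma flow_unique:
  assumes x: "\<And>t i. t \<in> {0..<\<tau>} \<Longrightarrow> i \<in> I \<Longrightarrow> ((\<lambda>t. x t i) has_real_derivative flow_field (x t) i) (at t within {0..<\<tau>})"
    and y: "\<And>t i. t \<in> {0..<\<tau>} \<Longrightarrow> i \<in> I \<Longrightarrow> ((\<lambda>t. y t i) has_real_derivative flow_field (y t) i) (at t within {0..<\<tau>})"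
    and eq0: "\<And>i. i \<in> I \<Longrightarrow> x 0 i = y 0 i" and t: "t \<in> {0..<\<tau>}" and i: "i \<in> I"
  shows "x t i = y t i"
proof -
  have sub: "{0..t} \<subseteq> {0..<\<tau>}" using t by auto
  have xd: "((\<lambda>t. x t i) has_real_derivative flow_field (x u) i) (at u within {0..t})"
    and yd: "((\<lambda>t. y t i) has_real_derivative flow_field (y u) i) (at u within {0..t})"
    if "u \<in> {0..t}" "i \<in> I" for u i
  proof -
    have u: "u \<in> {0..<\<tau>}" using that(1) sub by blast
    show "((\<lambda>t. x t i) has_real_derivative flow_field (x u) i) (at u within {0..t})"
      by (rule has_field_derivative_subset[OF x[OF u that(2)] sub])
    show "((\<lambda>t. y t i) has_real_derivative flow_field (y u) i) (at u within {0..t})"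
      by (rule has_field_derivative_subset[OF y[OF u that(2)] sub])
  qed
  have "\<forall>j\<in>I. \<exists>r. \<forall>u\<in>{0..t}. \<bar>x u j\<bar> \<le> r \<and> \<bar>y u j\<bar> \<le> r"
  proof
    fix j assume j: "j \<in> I"
    have "continuous_on {0..t} (\<lambda>u. x u j)" "continuous_on {0..t} (\<lambda>u. y u j)"
      using xd yd j by (meson DERIV_continuous_on)+
    then have "bounded ((\<lambda>u. x u j) ` {0..t})" "bounded ((\<lambda>u. y u j) ` {0..t})"
      by (auto intro: compact_imp_bounded compact_continuous_image)
    then obtain r1 r2 where "\<forall>u\<in>{0..t}. \<bar>x u j\<bar> \<le> r1" "\<forall>u\<in>{0..t}. \<bar>y u j\<bar> \<le> r2"
      unfolding bounded_iff by (auto simp: ball_simps)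
    then have "\<forall>u\<in>{0..t}. \<bar>x u j\<bar> \<le> max r1 r2 \<and> \<bar>y u j\<bar> \<le> max r1 r2" by (simp add: le_max_iff_disj)
    then show "\<exists>r. \<forall>u\<in>{0..t}. \<bar>x u j\<bar> \<le> r \<and> \<bar>y u j\<bar> \<le> r" by blast
  qed
  then obtain r where r: "\<And>j u. j \<in> I \<Longrightarrow> u \<in> {0..t} \<Longrightarrow> \<bar>x u j\<bar> \<le> r j \<and> \<bar>y u j\<bar> \<le> r j" by metis
  define R where "R = (\<Sum>j\<in>I. \<bar>r j\<bar>)"
  have R: "0 \<le> R" by (simp add: R_def sum_nonneg)
  have rR: "r j \<le> R" if "j \<in> I" for j
  proof -
    have "\<bar>r j\<bar> \<le> R" unfolding R_def by (rule member_le_sum[OF that]) (use finI in auto)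
    then show ?thesis by simp
  qed
  have cx: "flow_field (x u) = flow_field (clamp_coords R (x u))" "flow_field (y u) = flow_field (clamp_coords R (y u))" if "u \<in> {0..t}" for u
  proof -
    have "x u j = clamp_coords R (x u) j" "y u j = clamp_coords R (y u) j" if j: "j \<in> I" for j
      using clamp_coords_id[of "x u" j R] clamp_coords_id[of "y u" j R] rR[OF j] r[OF j \<open>u \<in> {0..t}\<close>] by auto
    note e = this
    show "flow_field (x u) = flow_field (clamp_coords R (x u))" by (rule flow_field_cong[OF e(1)])
    show "flow_field (y u) = flow_field (clamp_coords R (y u))" by (rule flow_field_cong[OF e(2)])
  qed
  obtain L where L: "0 \<le> L"
    "\<And>i s s'. i \<in> I \<Longrightarrow> \<bar>flow_field (clamp_coords R s) i - flow_field (clamp_coords R s') i\<bar> \<le> L * (\<Sum>j\<in>I. \<bar>s j - s' j\<bar>)"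
    using lip_bounded_common[where G = "\<lambda>s. flow_field (clamp_coords R s)", OF finI lip_bounded_flow_field[OF R]] by blast
  define d where "d = (\<lambda>u j. x u j - y u j)"
  define d' where "d' = (\<lambda>u j. flow_field (x u) j - flow_field (y u) j)"
  define v where "v = (\<lambda>u. \<Sum>j\<in>I. (d u j)\<^sup>2)"
  have "v t \<le> 0"
  \<comment> \<open>In \<open>C\<close>, the 2 comes from differentiating squares and
    \<open>card I\<close> from Cauchy-Schwarz between the sum of the
    \<open>\<bar>d u j\<bar>\<close> and \<open>v u\<close>.\<close>
  proof (rule gronwall_zero[where u = v and b = t and u' = "\<lambda>u. \<Sum>j\<in>I. 2 * d u j * d' u j" and C = "2 * L * real (card I)"])
    fix u assume u: "u \<in> {0..t}"
    show "(v has_real_derivative (\<Sum>j\<in>I. 2 * d u j * d' u j)) (at u within {0..t})"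
      unfolding v_def
    proof (rule DERIV_sum)
      fix j assume j: "j \<in> I"
      have "((\<lambda>u. d u j) has_real_derivative d' u j) (at u within {0..t})"
        unfolding d_def d'_def by (intro DERIV_diff xd yd u j)
      from DERIV_power[OF this, of 2]
      show "((\<lambda>u. (d u j)\<^sup>2) has_real_derivative 2 * d u j * d' u j) (at u within {0..t})" by (simp add: ac_simps)
    qed
    let ?S = "\<Sum>j\<in>I. \<bar>d u j\<bar>"
    have "(\<Sum>j\<in>I. 2 * d u j * d' u j) \<le> (\<Sum>j\<in>I. 2 * \<bar>d u j\<bar> * (L * ?S))"
    proof (rule sum_mono)
      fix j assume j: "j \<in> I"
      have "\<bar>d' u j\<bar> \<le> L * ?S" unfolding d'_def d_def cx[OF u] by (rule L(2)[OF j])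
      then have "\<bar>d u j\<bar> * \<bar>d' u j\<bar> \<le> \<bar>d u j\<bar> * (L * ?S)" by (intro mult_left_mono) auto
      then show "2 * d u j * d' u j \<le> 2 * \<bar>d u j\<bar> * (L * ?S)"
        using abs_ge_self[of "d u j * d' u j"] by (simp add: abs_mult)
    qed
    also have "\<dots> = 2 * L * ?S\<^sup>2" by (simp add: power2_eq_square sum_distrib_left sum_distrib_right ac_simps)
    also have "\<dots> \<le> 2 * L * (real (card I) * v u)"
    proof (rule mult_left_mono)
      show "?S\<^sup>2 \<le> real (card I) * v u"
        using Cauchy_Schwarz_ineq_sum[of "\<lambda>j. 1" "\<lambda>j. \<bar>d u j\<bar>" I] by (simp add: v_def)
    qed (use L in simp)
    finally show "(\<Sum>j\<in>I. 2 * d u j * d' u j) \<le> 2 * L * real (card I) * v u" by (simp add: mult.assoc)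
  next
    show "v 0 = 0" using eq0 by (simp add: v_def d_def)
  qed (use t in auto)
  moreover have "(d t i)\<^sup>2 \<le> v t" unfolding v_def by (rule member_le_sum[OF i]) (use finI in auto)
  ultimately have "(d t i)\<^sup>2 \<le> 0" by linarith
  then show ?thesis by (simp add: d_def)
qed

end

section \<open>Packings on the surface\<close>

lemma face_verts_subset:
  assumes "closed_or_bordered_surface S" "f \<in> faces S"
  shows "face_verts S f \<subseteq> verts S"
  using assms unfolding closed_or_bordered_surface_def face_verts_def by blast

lemma boundary_verts_subset: "closed_or_bordered_surface S \<Longrightarrow> boundary_verts S \<subseteq> verts S"
  unfolding closed_or_bordered_surface_def boundary_verts_def boundary_edges_def by blast

lemma card_face_verts: "closed_or_bordered_surface S \<Longrightarrow> f \<in> faces S \<Longrightarrow> card (face_verts S f) = 3"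
  unfolding closed_or_bordered_surface_def by blast

definition curvature_sum :: "('v, 'e, 'f) triangulation \<Rightarrow> ('v \<Rightarrow> real) \<Rightarrow> 'v \<Rightarrow> real" where
  "curvature_sum S \<kappa> i = (\<Sum>f\<in>faces_at S i. face_curvature (face_verts S f) \<kappa> i)"

text \<open>The faces are independent of each other: a packing on the surface is a family of
  triangle packings with common curvatures.\<close>

lemma packing_exists:
  assumes S: "closed_or_bordered_surface S" and pos: "\<And>v. v \<in> verts S \<Longrightarrow> 0 < \<kappa> v"
  shows "\<exists>P. is_packing S \<kappa> P"
proof -
  have "\<exists>C D. triangle_packing (face_verts S f) \<kappa> C D" if "f \<in> faces S" for f
    by (rule triangle_existence[OF card_face_verts[OF S that]]) (use pos face_verts_subset[OF S that] in auto)
  then obtain C D where "\<And>f. f \<in> faces S \<Longrightarrow> triangle_packing (face_verts S f) \<kappa> (C f) (D f)" by metis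
  then have "is_packing S \<kappa> \<lparr>circle_at = C, dual_circle = D\<rparr>" by (simp add: is_packing_def)
  then show ?thesis ..
qed

lemma total_curvature_eq:
  assumes S: "closed_or_bordered_surface S" and P: "is_packing S \<kappa> P"
  shows "total_curvature S \<kappa> P i = curvature_sum S \<kappa> i"
  unfolding total_curvature_def curvature_sum_def
proof (rule sum.cong[OF refl])
  fix f assume "f \<in> faces_at S i"
  then have f: "f \<in> faces S" "i \<in> face_verts S f" by (auto simp: faces_at_def)
  have "triangle_packing (face_verts S f) \<kappa> (circle_at P f) (dual_circle P f)"
    using P f by (simp add: is_packing_def)
  from triangle_sub_arc_length(2)[OF card_face_verts[OF S f(1)] this f(2)]
  show "\<kappa> i * hlength (sub_arc (circle_at P f i) (dual_circle P f)) = face_curvature (face_verts S f) \<kappa> i"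
    by (simp add: face_curvature_def)
qed

text \<open>\<open>realizes\<close> does not mention positivity; it follows from validity of the
  circles, as every vertex lies in a face. It permits logarithms of the curvatures of a competing
  packing.\<close>

lemma packing_curvature_pos:
  assumes S: "closed_or_bordered_surface S" and P: "is_packing S \<kappa> P" and v: "v \<in> verts S"
  shows "0 < \<kappa> v"
proof -
  have "faces_at S v \<noteq> {}" using S v unfolding closed_or_bordered_surface_def by blast
  then obtain f where f: "f \<in> faces S" "v \<in> face_verts S f" by (auto simp: faces_at_def)
  have "triangle_packing (face_verts S f) \<kappa> (circle_at P f) (dual_circle P f)"
    using P f by (simp add: is_packing_def)
  then show ?thesis by (rule triangle_sub_arc_length(1)[OF card_face_verts[OF S f(1)] _ f(2)])
qed

text \<open>The definite description is legitimate: a packing exists, and the length formula gives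
  every packing the same total curvature.\<close>

lemma curvature_map_eq:
  assumes S: "closed_or_bordered_surface S"
    and pos: "\<And>v. v \<in> verts S \<Longrightarrow> 0 < with_boundary S khat k v"
  shows "curvature_map S khat k i = curvature_sum S (with_boundary S khat k) i"
  unfolding curvature_map_def
proof (rule the_equality)
  have "\<exists>P. is_packing S (with_boundary S khat k) P" by (rule packing_exists[OF S]) (rule pos)
  then show "\<exists>P. is_packing S (with_boundary S khat k) P \<and>
    curvature_sum S (with_boundary S khat k) i = total_curvature S (with_boundary S khat k) P i"
    using total_curvature_eq[OF S] by metis
next
  fix T assume "\<exists>P. is_packing S (with_boundary S khat k) P \<and> T = total_curvature S (with_boundary S khat k) P i"
  then show "T = curvature_sum S (with_boundary S khat k) i" using total_curvature_eq[OF S] by metis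
qed

text \<open>Uniqueness of the packing and of the flow is part of the conclusion, since only this
  justifies speaking of the packing and the solution. The intervals \<open>{0..<\<tau>}\<close>
  admit competitors that are not assumed to exist for all times.\<close>

theorem theorem1p4:
  fixes S :: "('v, 'e, 'f) triangulation"
    and g n :: nat
    and khat That k0 :: "'v \<Rightarrow> real"
  assumes "triangulates_surface S g n"
    and "n \<ge> 1"
    and "card (boundary_verts S) \<ge> 2"
    and "\<forall>f \<in> faces S. card (face_verts S f \<inter> boundary_verts S) \<le> 2"
    and "\<forall>i \<in> boundary_verts S. 0 < khat i"
    and "That \<in> admissible S"
    and "\<forall>i \<in> interior_verts S. 0 < k0 i"
  shows "\<exists>\<kappa> k.
      (\<exists>P. realizes S khat That \<kappa> P) \<and>
      (\<forall>\<kappa>' P'. realizes S khat That \<kappa>' P' \<longrightarrow> (\<forall>i \<in> verts S. \<kappa>' i = \<kappa> i)) \<and>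
      calabi_flow S khat That k0 {0..} k \<and>
      (\<forall>\<tau> k'. 0 < \<tau> \<and> calabi_flow S khat That k0 {0..<\<tau>} k' \<longrightarrow>
         (\<forall>t \<in> {0..<\<tau>}. \<forall>i \<in> interior_verts S. k' t i = k t i)) \<and>
      (\<forall>i \<in> interior_verts S. ((\<lambda>t. k t i) \<longlongrightarrow> \<kappa> i) at_top)"
proof -
  have S: "closed_or_bordered_surface S" using assms(1) by (simp add: triangulates_surface_def)
  define I where "I = interior_verts S"
  define b where "b = (\<lambda>v. ln (khat v))"
  have finV: "finite (verts S)" and finF: "finite (faces S)" using S by (auto simp: closed_or_bordered_surface_def)
  have IV: "I \<subseteq> verts S" "I \<inter> boundary_verts S = {}" "verts S = I \<union> boundary_verts S"
    using boundary_verts_subset[OF S] by (auto simp: I_def interior_verts_def)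
  have eb: "exp (b v) = khat v" if "v \<in> boundary_verts S" for v
    using that assms(5) by (simp add: b_def)
  interpret face_system "faces S" "face_verts S" I b That
  proof
    show "finite (faces S)" "finite I" using finF finite_subset[OF IV(1) finV] by auto
    show "card (face_verts S f) = 3" if "f \<in> faces S" for f by (rule card_face_verts[OF S that])
    show "\<exists>f\<in>faces S. i \<in> face_verts S f" if "i \<in> I" for i
    proof -
      have "faces_at S i \<noteq> {}" using S that IV unfolding closed_or_bordered_surface_def by blast
      then show ?thesis by (auto simp: faces_at_def)
    qed
    show "0 < That i" if "i \<in> I" for i using assms(6) that by (simp add: admissible_def I_def)
    show "(\<Sum>v\<in>J. That v) < pi * real (card {f \<in> faces S. \<exists>v\<in>J. v \<in> face_verts S f})"
      if "J \<noteq> {}" "J \<subseteq> I" for J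
      using assms(6) that by (simp add: admissible_def I_def faces_meeting_def)
  qed
  have sum_cong: "curvature_sum S \<kappa> i = T s i" if e: "\<And>v. v \<in> verts S \<Longrightarrow> \<kappa> v = exp (log_curv s v)" for \<kappa> s i
  proof -
    have "face_curvature (face_verts S f) \<kappa> i = face_curvature (face_verts S f) (\<lambda>v. exp (log_curv s v)) i"
      if "f \<in> faces_at S i" for f
    proof -
      have f: "f \<in> faces S" "i \<in> face_verts S f" using that by (auto simp: faces_at_def)
      have e': "\<kappa> v = exp (log_curv s v)" if "v \<in> face_verts S f" for v
        using e that face_verts_subset[OF S f(1)] by blast
      show ?thesis unfolding face_curvature_def dual_sq_def using e' f(2) by (simp cong: sum.cong)
    qed
    then have "curvature_sum S \<kappa> i = (\<Sum>f\<in>faces_at S i. face_curvature (face_verts S f) (\<lambda>v. exp (log_curv s v)) i)"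
      unfolding curvature_sum_def by (rule sum.cong[OF refl])
    also have "\<dots> = T s i"
      unfolding T_def faces_at_def by (rule sum.inter_filter[OF finF])
    finally show ?thesis .
  qed
  have wb': "with_boundary S khat k v = exp (log_curv (\<lambda>v. ln (k v)) v)"
    if "\<And>i. i \<in> I \<Longrightarrow> 0 < k i" "v \<in> verts S" for k v
    using that IV assms(5) by (auto simp: with_boundary_def log_curv_def eb)
  have map: "curvature_map S khat k i = T (\<lambda>v. ln (k v)) i" if k: "\<And>i. i \<in> I \<Longrightarrow> 0 < k i" for k i
  proof -
    have "curvature_map S khat k i = curvature_sum S (with_boundary S khat k) i"
      by (rule curvature_map_eq[OF S]) (use wb'[of k] k in simp)
    also have "\<dots> = T (\<lambda>v. ln (k v)) i" by (rule sum_cong) (use wb'[of k] k in simp)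
    finally show ?thesis .
  qed
  \<comment> \<open>Varying one logarithm is a curve whose velocity is the unit vector at
    \<open>j\<close>, so \<open>T_has_derivative\<close> yields the single entry
    \<open>M i j\<close>.\<close>
  have jac: "curvature_jacobian S khat k i j = M (\<lambda>v. ln (k v)) i j"
    if k: "\<And>i. i \<in> I \<Longrightarrow> 0 < k i" and j: "j \<in> I" for k i j
  proof -
    let ?s = "\<lambda>s v. if v = j then s else ln (k v)"
    have "curvature_map S khat (k(j := exp s)) i = T (?s s) i" for s
    proof -
      have "curvature_map S khat (k(j := exp s)) i = T (\<lambda>v. ln ((k(j := exp s)) v)) i"
        by (rule map) (use k in auto)
      also have "(\<lambda>v. ln ((k(j := exp s)) v)) = ?s s" by auto
      finally show ?thesis .
    qed
    moreover have "((\<lambda>s. T (?s s) i) has_real_derivative (\<Sum>l\<in>I. M (?s (ln (k j))) i l * (if l = j then 1 else 0))) (at (ln (k j)))"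
      by (rule T_has_derivative) auto
    moreover have "?s (ln (k j)) = (\<lambda>v. ln (k v))" by auto
    moreover have "(\<Sum>l\<in>I. M (\<lambda>v. ln (k v)) i l * (if l = j then 1 else 0)) = M (\<lambda>v. ln (k v)) i j"
      using j finI by (simp add: if_distrib[of "\<lambda>x. _ * x"] sum.delta cong: if_cong)
    ultimately show ?thesis unfolding curvature_jacobian_def by (simp add: DERIV_imp_deriv)
  qed
  \<comment> \<open>The index order \<open>j i\<close> encodes the transpose, and the factor
    \<open>k i\<close> is the one that the chain rule produces from
    \<open>k = exp s\<close>.\<close>
  have rhs: "- k i * (\<Sum>j\<in>interior_verts S. curvature_jacobian S khat k j i * (curvature_map S khat k j - That j))
    = k i * flow_field (\<lambda>v. ln (k v)) i" if k: "\<And>i. i \<in> I \<Longrightarrow> 0 < k i" and i: "i \<in> I" for k i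
    using jac[OF k i] map[OF k] by (simp add: flow_field_def I_def[symmetric])
  obtain x R where R: "0 \<le> R" and x0: "\<And>i. x 0 i = ln (k0 i)"
    and xd: "\<And>t i. 0 \<le> t \<Longrightarrow> i \<in> I \<Longrightarrow> ((\<lambda>t. x t i) has_real_derivative flow_field (x t) i) (at t within {0..})"
    and xR: "\<And>t i. 0 \<le> t \<Longrightarrow> i \<in> I \<Longrightarrow> \<bar>x t i\<bar> \<le> R"
    using bounded_flow[where ?s0.0 = "\<lambda>i. ln (k0 i)"] by metis
  obtain l where l: "\<And>i. i \<in> I \<Longrightarrow> ((\<lambda>t. x t i) \<longlongrightarrow> l i) at_top" and Tl: "\<And>i. i \<in> I \<Longrightarrow> T l i = That i"
    using bounded_flow_converges[OF R xd xR] by metis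
  define \<kappa> where "\<kappa> = (\<lambda>v. exp (log_curv l v))"
  define k where "k = (\<lambda>t v. exp (x t v))"
  have "\<exists>P. is_packing S \<kappa> P" by (rule packing_exists[OF S]) (simp add: \<kappa>_def)
  then obtain P where P: "is_packing S \<kappa> P" ..
  have "realizes S khat That \<kappa> P"
    unfolding realizes_def
  proof (intro conjI ballI P)
    show "\<kappa> i = khat i" if "i \<in> boundary_verts S" for i
      using that IV assms(5) by (auto simp: \<kappa>_def log_curv_def eb)
    show "total_curvature S \<kappa> P i = That i" if "i \<in> interior_verts S" for i
      using total_curvature_eq[OF S P] sum_cong[of \<kappa> l i] Tl that by (simp add: \<kappa>_def I_def)
  qed
  moreover have "\<kappa>' i = \<kappa> i" if r: "realizes S khat That \<kappa>' P'" and i: "i \<in> verts S" for \<kappa>' P' i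
  proof -
    have P': "is_packing S \<kappa>' P'" and bd: "\<And>i. i \<in> boundary_verts S \<Longrightarrow> \<kappa>' i = khat i"
      and tc: "\<And>i. i \<in> I \<Longrightarrow> total_curvature S \<kappa>' P' i = That i"
      using r by (auto simp: realizes_def I_def)
    \<comment> \<open>Positivity at every vertex brings the competing curvatures into the form
      \<open>exp (log_curv s v)\<close>, to which \<open>T_injective\<close> applies.\<close>
    have e: "\<kappa>' v = exp (log_curv (\<lambda>v. ln (\<kappa>' v)) v)" if v: "v \<in> verts S" for v
      using packing_curvature_pos[OF S P' v] v bd[of v] IV by (auto simp: log_curv_def eb)
    have "T (\<lambda>v. ln (\<kappa>' v)) j = T l j" if "j \<in> I" for j
      using sum_cong[OF e] total_curvature_eq[OF S P', of j] tc[OF that] Tl[OF that] by simp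
    then have "ln (\<kappa>' j) = l j" if "j \<in> I" for j using T_injective that by blast
    then have "log_curv (\<lambda>v. ln (\<kappa>' v)) = log_curv l" by (rule log_curv_cong)
    then show ?thesis using e[OF i] by (simp add: \<kappa>_def)
  qed
  moreover have "calabi_flow S khat That k0 {0..} k"
    unfolding calabi_flow_def
  proof (intro conjI ballI)
    show "k 0 i = k0 i" if "i \<in> interior_verts S" for i
      using assms(7) that by (simp add: k_def x0)
    fix t :: real and i assume t: "t \<in> {0..}" and "i \<in> interior_verts S"
    then have i: "i \<in> I" by (simp add: I_def)
    show "0 < k t i" by (simp add: k_def)
    have "((\<lambda>t. exp (x t i)) has_real_derivative exp (x t i) * flow_field (x t) i) (at t within {0..})"
      by (rule DERIV_chain2[OF DERIV_exp xd]) (use t i in auto)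
    moreover have "(\<lambda>v. ln (k t v)) = x t" by (simp add: k_def)
    ultimately show "((\<lambda>\<tau>. k \<tau> i) has_real_derivative - k t i *
      (\<Sum>j\<in>interior_verts S. curvature_jacobian S khat (k t) j i * (curvature_map S khat (k t) j - That j))) (at t within {0..})"
      using rhs[of "k t" i] i by (simp add: k_def)
  qed
  moreover have "k' t i = k t i"
    if \<tau>: "0 < \<tau>" and fl: "calabi_flow S khat That k0 {0..<\<tau>} k'" and t: "t \<in> {0..<\<tau>}" and "i \<in> interior_verts S" for \<tau> k' t i
  proof -
    have i: "i \<in> I" using that by (simp add: I_def)
    have k'0: "k' 0 i = k0 i" if "i \<in> I" for i using fl that by (simp add: calabi_flow_def I_def)
    have k'p: "0 < k' t i" if "t \<in> {0..<\<tau>}" "i \<in> I" for t i using fl that by (simp add: calabi_flow_def I_def)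
    have k'd: "((\<lambda>\<tau>. k' \<tau> i) has_real_derivative k' t i * flow_field (\<lambda>v. ln (k' t v)) i) (at t within {0..<\<tau>})"
      if "t \<in> {0..<\<tau>}" "i \<in> I" for t i
    proof -
      have "\<forall>t\<in>{0..<\<tau>}. \<forall>i\<in>interior_verts S. ((\<lambda>\<tau>. k' \<tau> i) has_real_derivative - k' t i *
        (\<Sum>j\<in>interior_verts S. curvature_jacobian S khat (k' t) j i * (curvature_map S khat (k' t) j - That j))) (at t within {0..<\<tau>})"
        using fl unfolding calabi_flow_def by blast
      then have "((\<lambda>\<tau>. k' \<tau> i) has_real_derivative - k' t i *
        (\<Sum>j\<in>interior_verts S. curvature_jacobian S khat (k' t) j i * (curvature_map S khat (k' t) j - That j))) (at t within {0..<\<tau>})"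
        using that unfolding I_def by blast
      moreover have "- k' t i * (\<Sum>j\<in>interior_verts S. curvature_jacobian S khat (k' t) j i *
        (curvature_map S khat (k' t) j - That j)) = k' t i * flow_field (\<lambda>v. ln (k' t v)) i"
        by (rule rhs) (use k'p that in auto)
      ultimately show ?thesis by (simp only:)
    qed
    have "x t i = ln (k' t i)"
    proof (rule flow_unique[where x = x and y = "\<lambda>t v. ln (k' t v)" and \<tau> = \<tau>, OF _ _ _ t i])
      fix t j assume t: "t \<in> {0..<\<tau>}" and j: "j \<in> I"
      show "((\<lambda>t. x t j) has_real_derivative flow_field (x t) j) (at t within {0..<\<tau>})"
        by (rule has_field_derivative_subset[OF xd]) (use t j in auto)
      have "((\<lambda>t. ln (k' t j)) has_real_derivative inverse (k' t j) * (k' t j * flow_field (\<lambda>v. ln (k' t v)) j)) (at t within {0..<\<tau>})"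
        by (rule DERIV_chain2[OF DERIV_ln k'd]) (use k'p t j in auto)
      then show "((\<lambda>t. ln (k' t j)) has_real_derivative flow_field (\<lambda>v. ln (k' t v)) j) (at t within {0..<\<tau>})"
        by (rule DERIV_cong) (use k'p[OF t j] in simp)
    next
      fix j assume "j \<in> I"
      then show "x 0 j = ln (k' 0 j)" using k'0 x0 by simp
    qed
    then show ?thesis using k'p[OF t i] by (simp add: k_def)
  qed
  moreover have "((\<lambda>t. k t i) \<longlongrightarrow> \<kappa> i) at_top" if "i \<in> interior_verts S" for i
  proof -
    have i: "i \<in> I" using that by (simp add: I_def)
    have "\<kappa> i = exp (l i)" using i by (simp add: \<kappa>_def log_curv_def)
    then show ?thesis unfolding k_def using tendsto_exp[OF l[OF i]] by simp
  qed
  ultimately show ?thesis by blast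
qed

end
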